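(* Let $n\ge 2$ and $1\le k\le n$ be integers. Suppose $\psi:(0,\infty)\times(0,\infty)\to(0,\infty)$ is a $C^1$ function with $\partial_1\psi\ge 0$, $\partial_2\psi\ge 0$ and at least one of these inequalities is strict. Then any smooth strictly convex solution $M$ to $$P_k(W)=\psi(u,r)\quad\text{on }\mathbb{S}^n$$ must be an origin-centred sphere.
   Context: $(\mathbb{S}^n,g_0,\nabla)$ is the unit sphere in $\mathbb{R}^{n+1}$ with its standard metric and Levi-Civita connection. A smooth strictly convex solution $M$ means a smooth closed hypersurface $M\subset\mathbb{R}^{n+1}$ with strictly positive Gauss curvature that bounds a convex body $K$ containing the origin in its interior, and such that the equation holds with the following notation. $u:\mathbb{S}^n\to(0,\infty)$ is the support function of $K$; $X(z)=u(z)z+\nabla u(z)$ is the point of $M$ with unit outer normal $z$; $r(z)=|X(z)|=\sqrt{u^2+|\nabla u|^2}$ is the radial function viewed on $\mathbb{S}^n$ via the Gauss map; $W=\nabla^2u+u g_0$. $P_k(W)=\binom{n}{k}^{-1}\sum_{j_1<\cdots<j_k}\lambda_{j_1}\cdots\lambda_{j_k}$, where $\lambda_1,\dots,\lambda_n$ are the eigenvalues of $W$ with respect to $g_0$. $\partial_1\psi,\partial_2\psi$ are the partial derivatives of $\psi$ in its first and second argument. *)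

theory Defs
  imports "HOL-Analysis.Analysis"
begin

section \<open>Functions of class \<open>C\<^sup>k\<close> on open subsets of Euclidean space\<close>

text \<open>Only meaningful for open \<open>S\<close>: derivatives are taken at points of \<open>S\<close> in the ambient space.
  A function is \<open>C\<^sup>k\<^sup>+\<^sup>1\<close> iff it is differentiable and all its directional derivatives are \<open>C\<^sup>k\<close>.\<close>

primrec Ck_on :: "nat \<Rightarrow> 'a set \<Rightarrow> ('a::euclidean_space \<Rightarrow> 'b::real_normed_vector) \<Rightarrow> bool" where
  "Ck_on 0 S f \<longleftrightarrow> continuous_on S f"
| "Ck_on (Suc k) S f \<longleftrightarrow>
     (\<forall>x\<in>S. f differentiable (at x)) \<and> (\<forall>v. Ck_on k S (\<lambda>x. frechet_derivative f (at x) v))"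

definition smooth_on :: "'a set \<Rightarrow> ('a::euclidean_space \<Rightarrow> 'b::real_normed_vector) \<Rightarrow> bool" where
  "smooth_on S f \<longleftrightarrow> (\<forall>k. Ck_on k S f)"


section \<open>Eigenvalues of a symmetric bilinear form\<close>

text \<open>\<open>V\<close> is a linear subspace with the inner product inherited from the ambient space, and
  \<open>B\<close> a bilinear form on it; eigenvalues are taken with respect to that inner product.\<close>

definition form_eigenspace :: "'a::euclidean_space set \<Rightarrow> ('a \<Rightarrow> 'a \<Rightarrow> real) \<Rightarrow> real \<Rightarrow> 'a set" where
  "form_eigenspace V B l = {v\<in>V. \<forall>w\<in>V. B v w = l * (v \<bullet> w)}"

text \<open>The eigenvalues in increasing order, each repeated according to the dimension of its
  eigenspace; for symmetric \<open>B\<close> the list therefore has length \<open>dim V\<close>.\<close>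

definition form_eigenvalues :: "'a::euclidean_space set \<Rightarrow> ('a \<Rightarrow> 'a \<Rightarrow> real) \<Rightarrow> real list" where
  "form_eigenvalues V B = sorted_list_of_multiset
     (\<Sum>l \<in> {l. \<exists>v\<in>form_eigenspace V B l. v \<noteq> 0}.
        replicate_mset (dim (form_eigenspace V B l)) l)"

definition normalized_elem_sym :: "nat \<Rightarrow> real list \<Rightarrow> real" where
  "normalized_elem_sym k ls =
     (\<Sum>J | J \<subseteq> {..<length ls} \<and> card J = k. \<Prod>j\<in>J. ls ! j) / real (length ls choose k)"


section \<open>Calculus on the unit sphere\<close>

abbreviation unit_sphere :: "'a::euclidean_space set" where
  "unit_sphere \<equiv> sphere 0 1"

definition tangent_sphere :: "'a::euclidean_space \<Rightarrow> 'a set" where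
  "tangent_sphere z = {v. z \<bullet> v = 0}"

text \<open>The derivative of a function along the sphere is not unique as a linear map on the ambient
  space, but it is determined on tangent vectors, and this is all that the next three definitions
  depend on.\<close>

definition sphere_grad :: "('a::euclidean_space \<Rightarrow> real) \<Rightarrow> 'a \<Rightarrow> 'a" where
  "sphere_grad f z = (THE g. g \<in> tangent_sphere z \<and>
     (f has_derivative (\<lambda>v. g \<bullet> v)) (at z within unit_sphere))"

text \<open>The Levi-Civita connection of the induced metric: for a tangent vector field \<open>Y\<close> and
  \<open>v\<close> tangent at \<open>z\<close>, the tangential component of the derivative of \<open>Y\<close> in the direction \<open>v\<close>.\<close>

definition sphere_connection :: "('a::euclidean_space \<Rightarrow> 'a) \<Rightarrow> 'a \<Rightarrow> 'a \<Rightarrow> 'a" where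
  "sphere_connection Y z v =
     (let D = frechet_derivative Y (at z within unit_sphere) v in D - (D \<bullet> z) *\<^sub>R z)"

definition sphere_hess :: "('a::euclidean_space \<Rightarrow> real) \<Rightarrow> 'a \<Rightarrow> 'a \<Rightarrow> 'a \<Rightarrow> real" where
  "sphere_hess f z v w = sphere_connection (sphere_grad f) z v \<bullet> w"


section \<open>Strictly convex hypersurfaces\<close>

definition smooth_hypersurface :: "'a::euclidean_space set \<Rightarrow> bool" where
  "smooth_hypersurface M \<longleftrightarrow>
     (\<forall>p\<in>M. \<exists>U (F :: 'a \<Rightarrow> real). open U \<and> p \<in> U \<and> smooth_on U F \<and>
        M \<inter> U = {x\<in>U. F x = 0} \<and> (\<forall>x\<in>M \<inter> U. \<exists>v. frechet_derivative F (at x) v \<noteq> 0))"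

definition convex_body :: "'a::euclidean_space set \<Rightarrow> bool" where
  "convex_body K \<longleftrightarrow> compact K \<and> convex K \<and> interior K \<noteq> {}"

text \<open>Well defined at boundary points where \<open>K\<close> has a unique supporting hyperplane, in particular
  everywhere if the boundary is a smooth hypersurface.\<close>

definition gauss_map :: "'a::euclidean_space set \<Rightarrow> 'a \<Rightarrow> 'a" where
  "gauss_map K p = (THE \<nu>. norm \<nu> = 1 \<and> (\<forall>x\<in>K. (x - p) \<bullet> \<nu> \<le> 0))"

text \<open>Sign convention: with the outer normal the form below is positive semidefinite on the
  boundary of a convex body, and equals the metric on the unit sphere.\<close>

definition second_fundamental_form :: "'a::euclidean_space set \<Rightarrow> 'a \<Rightarrow> 'a \<Rightarrow> 'a \<Rightarrow> real" where
  "second_fundamental_form K p v w =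
     frechet_derivative (gauss_map K) (at p within frontier K) v \<bullet> w"

text \<open>The product of the principal curvatures. The tangent space of the boundary at \<open>p\<close> is the
  orthogonal complement of the normal.\<close>

definition gauss_curvature :: "'a::euclidean_space set \<Rightarrow> 'a \<Rightarrow> real" where
  "gauss_curvature K p =
     prod_list (form_eigenvalues {v. gauss_map K p \<bullet> v = 0} (second_fundamental_form K p))"

definition smooth_strictly_convex :: "'a::euclidean_space set \<Rightarrow> 'a set \<Rightarrow> bool" where
  "smooth_strictly_convex M K \<longleftrightarrow>
     compact M \<and> smooth_hypersurface M \<and>
     convex_body K \<and> 0 \<in> interior K \<and> M = frontier K \<and>
     (\<forall>p\<in>M. gauss_curvature K p > 0)"


section \<open>Support function and radial function\<close>

definition support_fun :: "'a::euclidean_space set \<Rightarrow> 'a \<Rightarrow> real" where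
  "support_fun K z = (SUP x\<in>K. x \<bullet> z)"

text \<open>The boundary point with unit outer normal \<open>z\<close>.\<close>

definition inverse_gauss :: "'a::euclidean_space set \<Rightarrow> 'a \<Rightarrow> 'a" where
  "inverse_gauss K z = support_fun K z *\<^sub>R z + sphere_grad (support_fun K) z"

definition radial_fun :: "'a::euclidean_space set \<Rightarrow> 'a \<Rightarrow> real" where
  "radial_fun K z = norm (inverse_gauss K z)"

definition W_form :: "'a::euclidean_space set \<Rightarrow> 'a \<Rightarrow> 'a \<Rightarrow> 'a \<Rightarrow> real" where
  "W_form K z v w = sphere_hess (support_fun K) z v w + support_fun K z * (v \<bullet> w)"

definition P_W :: "nat \<Rightarrow> 'a::euclidean_space set \<Rightarrow> 'a \<Rightarrow> real" where
  "P_W k K z = normalized_elem_sym k (form_eigenvalues (tangent_sphere z) (W_form K z))"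

end

theory Submission
  imports Defs "HOL-Computational_Algebra.Formal_Power_Series"
begin

text \<open>Since \<open>W\<close> is a Codazzi tensor, its Newton tensors \<open>T\<^sub>j\<close> are divergence free, so the divergence
  theorem on the sphere applied to fields \<open>c T\<^sub>j \<nabla>u\<close> gives
  \<open>\<integral> T\<^sub>j(\<nabla>c, \<nabla>u) = (j + 1) (n choose (j + 1)) \<integral> c (u P\<^sub>j - P\<^sub>j\<^sub>+\<^sub>1)\<close>. For \<open>k < n\<close>, take \<open>j = 0\<close> with \<open>c = P\<^sub>k\<close> and
  \<open>j = k\<close> with \<open>c\<close> constant: \<open>\<integral> \<langle>\<nabla>P\<^sub>k, \<nabla>u\<rangle> = n \<integral> (P\<^sub>k\<^sub>+\<^sub>1 - P\<^sub>1 P\<^sub>k) \<le> 0\<close>. For \<open>k = n\<close>, a similar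
  combination of \<open>j = 0\<close>, \<open>c = 1\<close> and \<open>j = n - 1\<close>, \<open>c = - P\<^sub>n\<^bsup>-(n-1)/n\<^esup>\<close> and the arithmetic-geometric
  mean inequality give \<open>\<integral> T\<^sub>n\<^sub>-\<^sub>1(\<nabla>c, \<nabla>u) \<le> 0\<close>. But \<open>\<nabla>P\<^sub>k = \<partial>\<^sub>1\<psi> \<nabla>u + (\<partial>\<^sub>2\<psi>/r) W \<nabla>u\<close>, so these integrands are
  nonnegative and positive where \<open>\<nabla>u \<noteq> 0\<close>. Hence \<open>u\<close> is constant.

  No integration on manifolds is needed: the support function is extended 1-homogeneously to the
  ambient space, where \<open>W\<close> becomes its Hessian, and the tangential fields are multiplied by a radial
  cutoff, whose gradient is orthogonal to them.\<close>

section \<open>Maps of class \<open>C\<^sup>1\<close>\<close>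

text \<open>The hypotheses speak of M, so the regularity of W has to be established before anything
  can be differentiated. Every nonzero x is the unnormalized outer normal of exactly one boundary
  point X(x). This map X is the gradient of the extended support function h, has degree 0, and comes
  locally from the inverse function theorem, whose nondegeneracy is the positivity of the Gauss
  curvature. Its derivative H is the ambient Hessian of h: x spans the kernel of H, and for unit x
  the rest of H is W, so the extra eigenvalue 0 leaves every sigma_k unchanged. The Codazzi equation
  turns into the symmetry of third derivatives of h, and the zero-order terms of the sphere into
  Euler relations for homogeneous functions.

  The case k = n is separate because T_n vanishes on tangent vectors and a factor n/(n - k) would be
  infinite; the power of P_n is chosen so that both leftover terms are instances of the
  arithmetic-geometric mean inequality. Only signs enter the conclusion: a nonnegative divergence
  with integral 0 vanishes pointwise, and so does each of its nonnegative summands.\<close>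

abbreviation C1_on :: "'a set \<Rightarrow> ('a::euclidean_space \<Rightarrow> 'b::real_normed_vector) \<Rightarrow> bool" where
  "C1_on \<equiv> Ck_on (Suc 0)"

lemma C1_onI:
  assumes "\<And>x. x \<in> S \<Longrightarrow> (f has_derivative f' x) (at x)"
    and "\<And>v. continuous_on S (\<lambda>x. f' x v)"
  shows "C1_on S f"
proof -
  have "frechet_derivative f (at x) = f' x" if "x \<in> S" for x
    using assms(1)[OF that] by (metis frechet_derivative_at)
  then show ?thesis
    using assms by (auto simp: differentiable_def cong: continuous_on_cong)
qed

lemma C1_on_has_derivative:
  assumes "C1_on S f" "x \<in> S"
  shows "(f has_derivative frechet_derivative f (at x)) (at x)"
  using assms by (simp add: frechet_derivative_works)

lemma C1_on_continuous_derivative: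
  "C1_on S f \<Longrightarrow> continuous_on S (\<lambda>x. frechet_derivative f (at x) v)"
  by simp

lemma C1_on_imp_continuous_on: "C1_on S f \<Longrightarrow> continuous_on S f"
  by (meson C1_on_has_derivative continuous_at_imp_continuous_on has_derivative_continuous)

lemma C1_on_subset: "C1_on S f \<Longrightarrow> T \<subseteq> S \<Longrightarrow> C1_on T f"
  using continuous_on_subset by auto blast

lemma C1_on_cong:
  assumes "open S" "\<And>x. x \<in> S \<Longrightarrow> f x = g x" "C1_on S f"
  shows "C1_on S g"
proof (rule C1_onI)
  fix x assume x: "x \<in> S"
  show "(g has_derivative frechet_derivative f (at x)) (at x)"
    by (rule has_derivative_transform_within_open[OF C1_on_has_derivative[OF assms(3) x] assms(1) x])
       (use assms(2) in auto)
qed (use assms(3) in auto)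

lemma C1_on_open_Un:
  assumes "open S" "open T" "C1_on S f" "C1_on T f"
  shows "C1_on (S \<union> T) f"
  using assms by (auto intro!: continuous_on_open_Un)

lemma C1_on_const: "C1_on S (\<lambda>x. c)"
  by (rule C1_onI[where f' = "\<lambda>x v. 0"]) auto

lemma C1_on_bounded_linear:
  assumes "bounded_linear L" "C1_on S f"
  shows "C1_on S (\<lambda>x. L (f x))"
proof (rule C1_onI)
  show "((\<lambda>x. L (f x)) has_derivative (\<lambda>v. L (frechet_derivative f (at x) v))) (at x)" if "x \<in> S" for x
    by (rule bounded_linear.has_derivative[OF assms(1) C1_on_has_derivative[OF assms(2) that]])
  show "continuous_on S (\<lambda>x. L (frechet_derivative f (at x) v))" for v
    using assms by (intro bounded_linear.continuous_on[OF assms(1)]) simp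
qed

lemma C1_on_ident: "C1_on S (\<lambda>x. x)"
  by (rule C1_onI[where f' = "\<lambda>x v. v"]) auto

lemma C1_on_linear_self: "bounded_linear L \<Longrightarrow> C1_on S L"
  using C1_on_bounded_linear[OF _ C1_on_ident] by blast

lemma C1_on_add:
  assumes "C1_on S f" "C1_on S g"
  shows "C1_on S (\<lambda>x. f x + g x)"
  by (rule C1_onI, rule has_derivative_add[OF C1_on_has_derivative[OF assms(1)] C1_on_has_derivative[OF assms(2)]])
     (use assms in \<open>auto intro!: continuous_on_add\<close>)

lemma C1_on_minus: "C1_on S f \<Longrightarrow> C1_on S (\<lambda>x. - f x)"
  by (rule C1_on_bounded_linear[OF bounded_linear_minus[OF bounded_linear_ident]])

lemma C1_on_diff: "C1_on S f \<Longrightarrow> C1_on S g \<Longrightarrow> C1_on S (\<lambda>x. f x - g x)"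
  using C1_on_add[OF _ C1_on_minus, of S f g] by simp

lemma C1_on_sum:
  assumes "\<And>i. i \<in> I \<Longrightarrow> C1_on S (f i)"
  shows "C1_on S (\<lambda>x. \<Sum>i\<in>I. f i x)"
  using assms by (induction I rule: infinite_finite_induct) (auto simp del: Ck_on.simps intro: C1_on_const C1_on_add)

lemma C1_on_bilinear:
  assumes B: "bounded_bilinear B" and f: "C1_on S f" and g: "C1_on S g"
  shows "C1_on S (\<lambda>x. B (f x) (g x))"
  by (rule C1_onI, rule bounded_bilinear.FDERIV[OF B C1_on_has_derivative[OF f] C1_on_has_derivative[OF g]])
     (use f g C1_on_imp_continuous_on[OF f] C1_on_imp_continuous_on[OF g] in
       \<open>auto intro!: continuous_on_add bounded_bilinear.continuous_on[OF B]\<close>)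

lemma C1_on_compose:
  fixes f :: "'a::euclidean_space \<Rightarrow> 'b::euclidean_space" and g :: "'b \<Rightarrow> 'c::real_normed_vector"
  assumes f: "C1_on S f" and g: "C1_on T g" and fS: "\<And>x. x \<in> S \<Longrightarrow> f x \<in> T"
  shows "C1_on S (\<lambda>x. g (f x))"
proof (rule C1_onI)
  let ?D = "\<lambda>x v. frechet_derivative g (at (f x)) (frechet_derivative f (at x) v)"
  show "((\<lambda>x. g (f x)) has_derivative ?D x) (at x)" if "x \<in> S" for x
    by (rule has_derivative_compose[OF C1_on_has_derivative[OF f that]
          has_derivative_at_withinI[OF C1_on_has_derivative[OF g fS[OF that]]]])
  fix v
  have eq: "?D x v = (\<Sum>b\<in>Basis. (frechet_derivative f (at x) v \<bullet> b) *\<^sub>R frechet_derivative g (at (f x)) b)"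
    if "x \<in> S" for x
  proof -
    interpret linear "frechet_derivative g (at (f x))"
      using C1_on_has_derivative[OF g fS[OF that]] has_derivative_linear by blast
    show ?thesis
      by (subst euclidean_representation[symmetric, of "frechet_derivative f (at x) v"])
         (simp only: sum scale)
  qed
  have "continuous_on S (\<lambda>x. frechet_derivative g (at (f x)) b)" for b
    by (rule continuous_on_compose2[OF _ C1_on_imp_continuous_on[OF f]]) (use g fS in auto)
  then have "continuous_on S
      (\<lambda>x. \<Sum>b\<in>Basis. (frechet_derivative f (at x) v \<bullet> b) *\<^sub>R frechet_derivative g (at (f x)) b)"
    using f by (auto intro!: continuous_intros)
  then show "continuous_on S (\<lambda>x. ?D x v)"
    by (simp add: eq cong: continuous_on_cong)
qed

lemma C1_on_real_compose:
  fixes f :: "'a::euclidean_space \<Rightarrow> real"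
  assumes f: "C1_on S f" and g: "\<And>t. t \<in> T \<Longrightarrow> (g has_real_derivative g' t) (at t)"
    and g': "continuous_on T g'" and fS: "\<And>x. x \<in> S \<Longrightarrow> f x \<in> T"
  shows "C1_on S (\<lambda>x. g (f x))"
  by (rule C1_on_compose[OF f _ fS], rule C1_onI[where f' = "\<lambda>t. (*) (g' t)"])
     (use g g' in \<open>auto simp: has_field_derivative_def intro!: continuous_intros\<close>)

lemma C1_on_inverse:
  fixes f :: "'a::euclidean_space \<Rightarrow> real"
  assumes "C1_on S f" "\<And>x. x \<in> S \<Longrightarrow> f x \<noteq> 0"
  shows "C1_on S (\<lambda>x. inverse (f x))"
proof (rule C1_on_real_compose[OF assms(1)])
  show "(inverse has_real_derivative - (inverse t ^ Suc (Suc 0))) (at t)" if "t \<in> - {0}" for t :: real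
    by (rule DERIV_inverse) (use that in simp)
  show "continuous_on (- {0}) (\<lambda>t::real. - (inverse t ^ Suc (Suc 0)))"
    by (intro continuous_on_minus continuous_on_power continuous_on_inverse continuous_on_id) simp
  show "f x \<in> - {0}" if "x \<in> S" for x using assms(2)[OF that] by simp
qed

lemmas C1_on_scaleR = C1_on_bilinear[OF bounded_bilinear_scaleR]
lemmas C1_on_mult = C1_on_bilinear[OF bounded_bilinear_mult]
lemmas C1_on_inner = C1_on_bilinear[OF bounded_bilinear_inner]
lemmas C1_on_blinfun_apply = C1_on_bilinear[OF bounded_bilinear_blinfun_apply]
lemmas C1_on_blinfun_compose = C1_on_bilinear[OF bounded_bilinear_blinfun_compose]

text \<open>In finite dimension an operator is the sum of the rank-one maps
  \<open>?L b (A x b)\<close>, which depend linearly on its values on the basis; so testing on each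
  \<open>v\<close> suffices for a statement in operator norm.\<close>

lemma C1_on_blinfunI:
  fixes A :: "'a::euclidean_space \<Rightarrow> ('b::euclidean_space \<Rightarrow>\<^sub>L 'c::real_normed_vector)"
  assumes "\<And>v. C1_on S (\<lambda>x. A x v)"
  shows "C1_on S A"
proof -
  let ?L = "\<lambda>b c. blinfun_scaleR_left c o\<^sub>L (blinfun_inner_left b :: 'b \<Rightarrow>\<^sub>L real)"
  have L: "bounded_linear (?L b)" for b :: 'b
    by (rule bounded_linear_compose[OF
          bounded_bilinear.bounded_linear_left[OF bounded_bilinear_blinfun_compose]
          bounded_linear_blinfun_scaleR_left])
  have "A = (\<lambda>x. \<Sum>b\<in>Basis. ?L b (A x b))"
  proof (intro ext blinfun_eqI)
    fix x v
    have "A x v = A x (\<Sum>b\<in>Basis. (v \<bullet> b) *\<^sub>R b)"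
      by (simp add: euclidean_representation)
    also have "\<dots> = blinfun_apply (\<Sum>b\<in>Basis. ?L b (A x b)) v"
      by (simp add: blinfun.sum_right blinfun.sum_left blinfun.scaleR_right inner_commute)
    finally show "A x v = blinfun_apply (\<Sum>b\<in>Basis. ?L b (A x b)) v" .
  qed
  moreover have "C1_on S (\<lambda>x. \<Sum>b\<in>Basis. ?L b (A x b))"
    by (intro C1_on_sum C1_on_bounded_linear[OF L] assms)
  ultimately show ?thesis by metis
qed

section \<open>Inverses of operator-valued maps\<close>

lemma blinfun_right_inverse_perturbation:
  fixes A B :: "'a::real_normed_vector \<Rightarrow>\<^sub>L 'a"
  assumes "A o\<^sub>L B = id_blinfun" "B0 o\<^sub>L A0 = id_blinfun"
  shows "B - B0 = - (B0 o\<^sub>L (A - A0) o\<^sub>L B)"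
proof (rule blinfun_eqI)
  fix v
  have "A (B v) = v" "B0 (A0 (B v)) = B v"
    using assms by (metis blinfun_apply_blinfun_compose blinfun_apply_id_blinfun)+
  then show "blinfun_apply (B - B0) v = blinfun_apply (- (B0 o\<^sub>L (A - A0) o\<^sub>L B)) v"
    by (simp add: blinfun.diff_left blinfun.diff_right blinfun.minus_left)
qed

text \<open>The perturbation identity estimates \<open>B y - B x\<close> by \<open>B x\<close>,
  \<open>A y - A x\<close> and \<open>B y\<close>. As \<open>B y\<close> reappears on the right, its
  norm is first shown to be at most \<open>2 * norm (B x)\<close> near \<open>x\<close>.\<close>

lemma continuous_on_blinfun_inverse:
  fixes A B :: "'a::metric_space \<Rightarrow> 'b::real_normed_vector \<Rightarrow>\<^sub>L 'b"
  assumes A: "continuous_on S A"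
    and AB: "\<And>x. x \<in> S \<Longrightarrow> A x o\<^sub>L B x = id_blinfun"
    and BA: "\<And>x. x \<in> S \<Longrightarrow> B x o\<^sub>L A x = id_blinfun"
  shows "continuous_on S B"
  unfolding continuous_on_def
proof
  fix x assume x: "x \<in> S"
  have lim: "((\<lambda>y. norm (A y - A x)) \<longlongrightarrow> 0) (at x within S)"
    by (rule tendsto_norm_zero[OF LIM_zero]) (use A x in \<open>simp add: continuous_on_def\<close>)
  let ?b = "norm (B x)"
  have est: "norm (B y - B x) \<le> ?b * norm (A y - A x) * norm (B y)" if "y \<in> S" for y
  proof -
    have "norm (B y - B x) = norm (B x o\<^sub>L (A y - A x) o\<^sub>L B y)"
      by (simp only: blinfun_right_inverse_perturbation[OF AB[OF that] BA[OF x]] norm_minus_cancel)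
    also have "\<dots> \<le> norm (B x o\<^sub>L (A y - A x)) * norm (B y)"
      by (rule norm_blinfun_compose)
    also have "\<dots> \<le> ?b * norm (A y - A x) * norm (B y)"
      by (intro mult_right_mono norm_blinfun_compose) auto
    finally show ?thesis .
  qed
  have "((\<lambda>y. ?b * norm (A y - A x)) \<longlongrightarrow> ?b * 0) (at x within S)"
    by (intro tendsto_intros lim)
  then have ev: "\<forall>\<^sub>F y in at x within S. ?b * norm (A y - A x) < 1/2"
    by (intro order_tendstoD) auto
  have eventually_at_in_S: "\<forall>\<^sub>F y in at x within S. y \<in> S"
    by (simp add: eventually_at_filter)
  have "\<forall>\<^sub>F y in at x within S. norm (B y - B x) \<le> ?b * norm (A y - A x) * (2 * ?b)"
    using ev eventually_at_in_S
  proof eventually_elim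
    case (elim y)
    have "norm (B y) \<le> ?b + norm (B y - B x)"
      by (rule norm_triangle_sub)
    also have "norm (B y - B x) \<le> ?b * norm (A y - A x) * norm (B y)"
      by (rule est[OF elim(2)])
    also have "\<dots> \<le> 1/2 * norm (B y)"
      using elim(1) by (intro mult_right_mono) auto
    finally have "norm (B y) \<le> 2 * ?b" by simp
    then show ?case
      by (intro order_trans[OF est[OF elim(2)]] mult_left_mono) auto
  qed
  moreover have "((\<lambda>y. ?b * norm (A y - A x) * (2 * ?b)) \<longlongrightarrow> 0) (at x within S)"
    using tendsto_mult_left_zero[OF tendsto_mult_right_zero[OF lim, of ?b], of "2 * ?b"] by simp
  ultimately have "((\<lambda>y. B y - B x) \<longlongrightarrow> 0) (at x within S)"
    by (rule Lim_null_comparison)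
  then show "(B \<longlongrightarrow> B x) (at x within S)"
    by (rule LIM_zero_cancel)
qed

text \<open>Differentiating A B = I suggests the derivative \<open>?B'\<close>. By the perturbation
  identity the remainder splits into a term with the linearization error of \<open>A\<close> and a
  term with \<open>B y - B x\<close>; these give the two summands of \<open>H\<close>.\<close>

lemma C1_on_blinfun_inverse:
  fixes A B :: "'a::euclidean_space \<Rightarrow> 'b::real_normed_vector \<Rightarrow>\<^sub>L 'b"
  assumes S: "open S" and A: "C1_on S A"
    and AB: "\<And>x. x \<in> S \<Longrightarrow> A x o\<^sub>L B x = id_blinfun"
    and BA: "\<And>x. x \<in> S \<Longrightarrow> B x o\<^sub>L A x = id_blinfun"
  shows "C1_on S B"
proof (rule C1_onI)
  let ?A' = "\<lambda>x. frechet_derivative A (at x)"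
  let ?B' = "\<lambda>x v. - (B x o\<^sub>L ?A' x v o\<^sub>L B x)"
  have contB: "continuous_on S B"
    by (rule continuous_on_blinfun_inverse[OF C1_on_imp_continuous_on[OF A] AB BA])
  fix x assume x: "x \<in> S"
  have bl: "bounded_linear (?A' x)"
    using C1_on_has_derivative[OF A x] by (rule has_derivative_bounded_linear)
  obtain c where c: "\<And>v. norm (?A' x v) \<le> norm v * c"
    using bounded_linear.bounded[OF bl] by blast
  have limB: "(B \<longlongrightarrow> B x) (at x)"
    using contB S x by (simp add: continuous_on_eq_continuous_at isCont_def)
  obtain e where e: "e > 0" "ball x e \<subseteq> S"
    using S x openE by blast
  let ?R = "\<lambda>y. norm (A y - A x - ?A' x (y - x)) / norm (y - x)"
  let ?b = "norm (B x)"
  have R: "(?R \<longlongrightarrow> 0) (at x)"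
    using C1_on_has_derivative[OF A x] by (simp add: has_derivative_iff_norm)
  show "(B has_derivative ?B' x) (at x)"
  proof (rule has_derivativeI_sandwich[OF e(1),
        where H = "\<lambda>y. ?b * ?R y * norm (B y) + ?b * c * norm (B y - B x)"])
    show "bounded_linear (?B' x)"
      by (intro bounded_linear_minus
          bounded_linear_compose[OF bounded_bilinear.bounded_linear_left[OF bounded_bilinear_blinfun_compose]]
          bounded_linear_compose[OF bounded_bilinear.bounded_linear_right[OF bounded_bilinear_blinfun_compose]] bl)
    have "((\<lambda>y. ?b * ?R y * norm (B y) + ?b * c * norm (B y - B x)) \<longlongrightarrow>
        ?b * 0 * norm (B x) + ?b * c * norm (B x - B x)) (at x)"
      by (intro tendsto_intros R limB)
    then show "((\<lambda>y. ?b * ?R y * norm (B y) + ?b * c * norm (B y - B x)) \<longlongrightarrow> 0) (at x)"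
      by simp
    fix y assume y: "y \<noteq> x" "dist y x < e"
    then have yS: "y \<in> S" using e(2) by (auto simp: dist_commute)
    let ?D = "?A' x (y - x)"
    have "- (B x o\<^sub>L (A y - A x - ?D) o\<^sub>L B y) - (B x o\<^sub>L ?D o\<^sub>L (B y - B x)) =
        - (B x o\<^sub>L (A y - A x) o\<^sub>L B y) + (B x o\<^sub>L ?D o\<^sub>L B x)"
      by (intro blinfun_eqI) (simp add: blinfun.bilinear_simps algebra_simps)
    then have eq: "B y - B x - ?B' x (y - x) =
        - (B x o\<^sub>L (A y - A x - ?D) o\<^sub>L B y) - (B x o\<^sub>L ?D o\<^sub>L (B y - B x))"
      using blinfun_right_inverse_perturbation[OF AB[OF yS] BA[OF x]]
      by (simp only: diff_minus_eq_add)
    have "norm (B y - B x - ?B' x (y - x)) \<le>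
        norm (B x o\<^sub>L (A y - A x - ?A' x (y - x)) o\<^sub>L B y) + norm (B x o\<^sub>L ?A' x (y - x) o\<^sub>L (B y - B x))"
      unfolding eq
      using norm_triangle_ineq4[of "- (B x o\<^sub>L (A y - A x - ?D) o\<^sub>L B y)" "B x o\<^sub>L ?D o\<^sub>L (B y - B x)"]
      by (simp only: norm_minus_cancel)
    also have "\<dots> \<le> ?b * norm (A y - A x - ?A' x (y - x)) * norm (B y)
        + ?b * (norm (y - x) * c) * norm (B y - B x)"
      by (intro add_mono order_trans[OF norm_blinfun_compose] mult_right_mono mult_left_mono c) auto
    finally show "norm (B y - B x - ?B' x (y - x)) / norm (y - x)
        \<le> ?b * ?R y * norm (B y) + ?b * c * norm (B y - B x)"
      using y(1) by (simp add: field_simps)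
  qed
next
  show "continuous_on S (\<lambda>x. - (B x o\<^sub>L frechet_derivative A (at x) v o\<^sub>L B x))" for v
    by (intro continuous_on_minus bounded_bilinear.continuous_on[OF bounded_bilinear_blinfun_compose]
        C1_on_continuous_derivative[OF A] continuous_on_blinfun_inverse[OF C1_on_imp_continuous_on[OF A] AB BA])
qed

section \<open>Elementary symmetric functions\<close>

text \<open>Indexed by a set: below, \<open>I\<close> is an orthonormal eigenbasis and
  \<open>f\<close> assigns the eigenvalues, so multiplicities are kept and omitting an eigenvector
  is set difference.\<close>

definition esym :: "nat \<Rightarrow> 'i set \<Rightarrow> ('i \<Rightarrow> real) \<Rightarrow> real" where
  "esym k I f = (\<Sum>J | J \<subseteq> I \<and> card J = k. \<Prod>j\<in>J. f j)"

lemma esym_0: "finite I \<Longrightarrow> esym 0 I f = 1"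
proof -
  assume "finite I"
  then have "{J. J \<subseteq> I \<and> card J = 0} = {{}}"
    using finite_subset by fastforce
  then show ?thesis by (simp add: esym_def)
qed

lemma esym_empty_Suc: "esym (Suc k) {} f = 0"
proof -
  have "{J::'a set. J \<subseteq> {} \<and> card J = Suc k} = {}" by auto
  then show ?thesis unfolding esym_def by (simp only: sum.empty)
qed

lemma esym_insert:
  assumes "finite I" "a \<notin> I"
  shows "esym (Suc k) (insert a I) f = esym (Suc k) I f + f a * esym k I f"
proof -
  let ?A = "{J. J \<subseteq> I \<and> card J = Suc k}" and ?B = "{J. J \<subseteq> I \<and> card J = k}"
  have fin: "finite ?A" "finite ?B" using assms(1) by auto
  have eq: "{J. J \<subseteq> insert a I \<and> card J = Suc k} = ?A \<union> insert a ` ?B"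
  proof (intro equalityI subsetI)
    fix J assume J: "J \<in> {J. J \<subseteq> insert a I \<and> card J = Suc k}"
    show "J \<in> ?A \<union> insert a ` ?B"
    proof (cases "a \<in> J")
      case True
      then have "J = insert a (J - {a})" "J - {a} \<in> ?B" using J by auto
      then show ?thesis by blast
    qed (use J in auto)
  next
    fix J assume "J \<in> ?A \<union> insert a ` ?B"
    then show "J \<in> {J. J \<subseteq> insert a I \<and> card J = Suc k}"
      using assms by (auto simp: card_insert_if finite_subset)
  qed
  have "esym (Suc k) (insert a I) f = (\<Sum>J\<in>?A. \<Prod>j\<in>J. f j) + (\<Sum>J\<in>insert a ` ?B. \<Prod>j\<in>J. f j)"
    unfolding esym_def eq by (rule sum.union_disjoint) (use fin assms in auto)
  also have "(\<Sum>J\<in>insert a ` ?B. \<Prod>j\<in>J. f j) = (\<Sum>J\<in>?B. \<Prod>j\<in>insert a J. f j)"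
    by (rule sum.reindex_cong[of "insert a"]) (use assms(2) in \<open>auto simp: inj_on_def\<close>)
  also have "\<dots> = (\<Sum>J\<in>?B. f a * (\<Prod>j\<in>J. f j))"
    by (rule sum.cong) (use assms in \<open>auto intro!: prod.insert finite_subset[OF _ assms(1)]\<close>)
  finally show ?thesis
    by (simp add: esym_def sum_distrib_left)
qed

lemma esym_remove:
  assumes "finite I" "i \<in> I"
  shows "esym (Suc k) I f = esym (Suc k) (I - {i}) f + f i * esym k (I - {i}) f"
  using esym_insert[of "I - {i}" i k f] assms by (simp add: insert_absorb)

text \<open>Double counting: a subset of size k + 1 arises once from each of its elements. It is
  also Euler's relation, since \<open>esym k (I - {i}) f\<close> is the partial derivative of
  \<open>esym (Suc k) I f\<close> in \<open>f i\<close>.\<close>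

lemma sum_mult_esym_remove:
  "finite I \<Longrightarrow> (\<Sum>i\<in>I. f i * esym k (I - {i}) f) = real (Suc k) * esym (Suc k) I f"
proof (induction I arbitrary: k rule: finite_induct)
  case empty
  then show ?case by (simp add: esym_empty_Suc)
next
  case (insert a I)
  have eq: "insert a I - {i} = insert a (I - {i})" if "i \<in> I" for i using that insert by auto
  have "(\<Sum>i\<in>I. f i * esym k (insert a I - {i}) f) =
      real (Suc k) * esym (Suc k) I f + f a * (real k * esym k I f)"
  proof (cases k)
    case 0
    then show ?thesis
      using insert.IH[of 0] insert.hyps by (simp add: esym_0)
  next
    case (Suc m)
    have "(\<Sum>i\<in>I. f i * esym k (insert a I - {i}) f) =
        (\<Sum>i\<in>I. f i * esym k (I - {i}) f + f a * (f i * esym m (I - {i}) f))"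
      by (rule sum.cong) (use insert.hyps eq in \<open>auto simp: Suc esym_insert algebra_simps\<close>)
    also have "\<dots> = real (Suc k) * esym (Suc k) I f + f a * (real k * esym k I f)"
      unfolding sum.distrib sum_distrib_left[symmetric] insert.IH Suc ..
    finally show ?thesis .
  qed
  then show ?case
    using insert.hyps by (simp add: esym_insert algebra_simps)
qed

text \<open>Double counting: a k-subset of \<open>I\<close> avoids \<open>card I - k\<close>
  indices.\<close>

lemma sum_esym_remove:
  assumes "finite I"
  shows "(\<Sum>i\<in>I. esym k (I - {i}) f) = (real (card I) - real k) * esym k I f"
proof (cases k)
  case 0
  then show ?thesis using assms by (simp add: esym_0)
next
  case (Suc m)
  have "(\<Sum>i\<in>I. esym k I f) = (\<Sum>i\<in>I. esym k (I - {i}) f + f i * esym m (I - {i}) f)"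
    by (rule sum.cong) (use esym_remove[OF assms] Suc in auto)
  also have "\<dots> = (\<Sum>i\<in>I. esym k (I - {i}) f) + real k * esym k I f"
    unfolding sum.distrib sum_mult_esym_remove[OF assms] Suc ..
  finally show ?thesis by (simp add: algebra_simps)
qed

lemma esym_nonneg: "(\<And>i. i \<in> I \<Longrightarrow> 0 \<le> f i) \<Longrightarrow> 0 \<le> esym k I f"
  unfolding esym_def by (intro sum_nonneg prod_nonneg) auto

lemma esym_pos:
  assumes "finite I" "\<And>i. i \<in> I \<Longrightarrow> 0 < f i" "k \<le> card I"
  shows "0 < esym k I f"
proof -
  obtain J where "J \<subseteq> I" "card J = k" using assms(3) by (metis obtain_subset_with_card_n)
  then have "{J. J \<subseteq> I \<and> card J = k} \<noteq> {}" by blast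
  then show ?thesis
    unfolding esym_def using assms by (intro sum_pos prod_pos) auto
qed

lemma esym_card: "finite I \<Longrightarrow> esym (card I) I f = (\<Prod>i\<in>I. f i)"
proof -
  assume "finite I"
  then have "{J. J \<subseteq> I \<and> card J = card I} = {I}" using card_subset_eq by blast
  then show ?thesis by (simp add: esym_def)
qed

lemma esym_1: "finite I \<Longrightarrow> esym (Suc 0) I f = (\<Sum>i\<in>I. f i)"
  using sum_mult_esym_remove[of I f 0] by (simp add: esym_0)

lemma esym_reindex:
  assumes "bij_betw g I J"
  shows "esym k I (f \<circ> g) = esym k J f"
  unfolding esym_def
proof (rule sum.reindex_bij_witness[where i = "\<lambda>B. inv_into I g ` B" and j = "image g"])
  have inj: "inj_on g I" and img: "g ` I = J" using assms by (auto simp: bij_betw_def)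
  fix A assume A: "A \<in> {A. A \<subseteq> I \<and> card A = k}"
  then have injA: "inj_on g A" using inj inj_on_subset by blast
  show "inv_into I g ` (g ` A) = A"
    using inj A by (simp add: inv_into_image_cancel)
  show "g ` A \<in> {B. B \<subseteq> J \<and> card B = k}"
    using A img injA by (auto simp: card_image)
  show "(\<Prod>j\<in>g ` A. f j) = (\<Prod>j\<in>A. (f \<circ> g) j)"
    by (simp add: prod.reindex[OF injA])
next
  have inj: "inj_on g I" and img: "g ` I = J" using assms by (auto simp: bij_betw_def)
  fix B assume B: "B \<in> {B. B \<subseteq> J \<and> card B = k}"
  show "g ` (inv_into I g ` B) = B"
    using B img by (simp add: image_inv_into_cancel)
  have "inj_on (inv_into I g) B"
    using B img by (intro inj_on_inv_into) auto
  then show "inv_into I g ` B \<in> {A. A \<subseteq> I \<and> card A = k}"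
    using B img by (auto simp: card_image inv_into_into)
qed

text \<open>Chebyshev's sum inequality for \<open>f i\<close> and \<open>esym k (I - {i}) f\<close>, which are oppositely ordered.\<close>

lemma esym_Suc_le:
  assumes fin: "finite I" and nonneg: "\<And>i. i \<in> I \<Longrightarrow> 0 \<le> f i"
  shows "real (card I) * (real (Suc k) * esym (Suc k) I f)
    \<le> (real (card I) - real k) * (esym (Suc 0) I f * esym k I f)"
proof -
  let ?a = "\<lambda>i. esym k (I - {i}) f"
  have opp: "(f i - f j) * (?a i - ?a j) \<le> 0" if "i \<in> I" "j \<in> I" for i j
  proof (cases "i = j \<or> k = 0")
    case True
    then show ?thesis using fin by (auto simp: esym_0)
  next
    case False
    then obtain m where m: "k = Suc m" and ij: "i \<noteq> j" by (cases k) auto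
    \<comment> \<open>Expanded over the set without both indices, \<open>?a i\<close> and
      \<open>?a j\<close> differ only by \<open>(f j - f i) * esym m ?I f\<close>, whence the
      opposite ordering.\<close>
    let ?I = "I - {i} - {j}"
    have "?a i = esym k ?I f + f j * esym m ?I f" "?a j = esym k ?I f + f i * esym m ?I f"
      using esym_remove[of "I - {i}" j m f] esym_remove[of "I - {j}" i m f] that ij fin m
      by (auto simp: insert_commute Diff_insert2[symmetric])
    then have "(f i - f j) * (?a i - ?a j) = - ((f i - f j)\<^sup>2 * esym m ?I f)"
      by (simp add: power2_eq_square algebra_simps)
    also have "\<dots> \<le> 0"
      using esym_nonneg[of ?I f m] nonneg by simp
    finally show ?thesis .
  qed
  have "0 \<ge> (\<Sum>i\<in>I. \<Sum>j\<in>I. (f i - f j) * (?a i - ?a j))"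
    using opp by (intro sum_nonpos) auto
  also have "(\<Sum>i\<in>I. \<Sum>j\<in>I. (f i - f j) * (?a i - ?a j)) =
      2 * (real (card I) * (\<Sum>i\<in>I. f i * ?a i) - (\<Sum>i\<in>I. f i) * (\<Sum>i\<in>I. ?a i))"
  proof -
    have "(\<Sum>i\<in>I. \<Sum>j\<in>I. (f i - f j) * (?a i - ?a j)) =
        (\<Sum>i\<in>I. \<Sum>j\<in>I. f i * ?a i + f j * ?a j - f i * ?a j - f j * ?a i)"
      by (simp add: algebra_simps)
    also have "\<dots> = real (card I) * (\<Sum>i\<in>I. f i * ?a i) + real (card I) * (\<Sum>i\<in>I. f i * ?a i)
        - (\<Sum>i\<in>I. f i) * (\<Sum>i\<in>I. ?a i) - (\<Sum>i\<in>I. f i) * (\<Sum>i\<in>I. ?a i)"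
      by (simp add: sum.distrib sum_subtractf flip: sum_distrib_left sum_distrib_right)
    finally show ?thesis by simp
  qed
  finally show ?thesis
    unfolding sum_mult_esym_remove[OF fin] sum_esym_remove[OF fin] esym_1[OF fin]
    by (simp add: algebra_simps)
qed

text \<open>As \<open>y\<close> is the geometric mean, the numbers \<open>x i / y\<close> have
  product 1; summing ln s \<le> s - 1 over them gives the claim.\<close>

lemma arith_geo_mean:
  fixes x :: "'i \<Rightarrow> real"
  assumes "finite I" "\<And>i. i \<in> I \<Longrightarrow> 0 < x i" "0 < y" "y ^ card I = (\<Prod>i\<in>I. x i)"
  shows "real (card I) * y \<le> (\<Sum>i\<in>I. x i)"
proof -
  have "0 = ln ((\<Prod>i\<in>I. x i) / y ^ card I)"
    using assms(3,4) by (metis div_self ln_one power_eq_0_iff less_irrefl)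
  also have "\<dots> = ln (\<Prod>i\<in>I. x i / y)"
    by (simp add: prod_dividef)
  also have "\<dots> = (\<Sum>i\<in>I. ln (x i / y))"
    by (rule ln_prod[OF assms(1)]) (use assms(2,3) in force)
  also have "\<dots> \<le> (\<Sum>i\<in>I. x i / y - 1)"
    using assms by (intro sum_mono ln_le_minus_one) auto
  also have "\<dots> = (\<Sum>i\<in>I. x i) / y - real (card I)"
    by (simp add: sum_subtractf sum_divide_distrib)
  finally show ?thesis
    using assms(3) by (simp add: field_simps)
qed

text \<open>The arithmetic-geometric mean inequality for the products \<open>?x i\<close> of all
  factors but one. The product of these is the (n - 1)-th power of the product of all
  \<open>f i\<close>, so their geometric mean is y^(n - 1).\<close>

lemma esym_arith_geo_mean:
  assumes fin: "finite I" and pos: "\<And>i. i \<in> I \<Longrightarrow> 0 < f i"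
    and y: "0 < y" "y ^ card I = esym (card I) I f"
  shows "real (card I) * y ^ (card I - 1) \<le> esym (card I - 1) I f"
proof -
  let ?n = "card I" and ?x = "\<lambda>i. \<Prod>j\<in>I - {i}. f j"
  have "(\<Prod>i\<in>I. ?x i * f i) = (\<Prod>i\<in>I. \<Prod>j\<in>I. f j)"
    by (rule prod.cong) (use fin in \<open>auto simp: prod.remove mult.commute\<close>)
  then have "(\<Prod>i\<in>I. ?x i) * y ^ ?n = (y ^ ?n) ^ ?n"
    using y(2) by (simp add: prod.distrib esym_card[OF fin])
  then have "(\<Prod>i\<in>I. ?x i) * y ^ ?n = (y ^ (?n - 1)) ^ ?n * y ^ ?n"
    by (cases ?n) (simp_all flip: power_mult power_add add: algebra_simps)
  then have "(y ^ (?n - 1)) ^ ?n = (\<Prod>i\<in>I. ?x i)"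
    using y(1) by simp
  then have "real ?n * y ^ (?n - 1) \<le> (\<Sum>i\<in>I. ?x i)"
    using pos y(1) by (intro arith_geo_mean[OF fin]) (auto intro!: prod_pos)
  also have "\<dots> = (\<Sum>i\<in>I. esym (?n - 1) (I - {i}) f)"
  proof (rule sum.cong[OF refl])
    fix i assume "i \<in> I"
    then show "?x i = esym (?n - 1) (I - {i}) f"
      using esym_card[of "I - {i}" f] fin by (simp add: card_Diff_singleton)
  qed
  also have "\<dots> = (real ?n - real (?n - 1)) * esym (?n - 1) I f"
    by (rule sum_esym_remove[OF fin])
  \<comment> \<open>The factor \<open>real ?n - real (?n - 1)\<close> is 1, except for empty
    \<open>I\<close>, where truncated subtraction makes it 0.\<close>
  also have "\<dots> \<le> esym (?n - 1) I f"
    using esym_nonneg[of I f "?n - 1"] pos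
    by (cases "?n = 0") (auto simp: of_nat_diff Suc_le_eq less_imp_le)
  finally show ?thesis .
qed

section \<open>Newton tensors\<close>

definition blinfun_trace :: "('a::euclidean_space \<Rightarrow>\<^sub>L 'a) \<Rightarrow> real" where
  "blinfun_trace A = (\<Sum>b\<in>Basis. A b \<bullet> b)"

lemma bounded_linear_blinfun_trace: "bounded_linear blinfun_trace"
  unfolding blinfun_trace_def
  by (intro bounded_linear_sum bounded_linear_inner_left_comp
      bounded_bilinear.bounded_linear_left[OF bounded_bilinear_blinfun_apply])

lemmas blinfun_trace_add = linear_add[OF bounded_linear.linear[OF bounded_linear_blinfun_trace]]
lemmas blinfun_trace_scaleR = linear_scale[OF bounded_linear.linear[OF bounded_linear_blinfun_trace]]
lemmas blinfun_trace_sum = linear_sum[OF bounded_linear.linear[OF bounded_linear_blinfun_trace]]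

lemma blinfun_trace_compose_commute:
  fixes A B :: "'a::euclidean_space \<Rightarrow>\<^sub>L 'a"
  shows "blinfun_trace (A o\<^sub>L B) = blinfun_trace (B o\<^sub>L A)"
proof -
  have eq: "A (B b) \<bullet> b = (\<Sum>c\<in>Basis. (B b \<bullet> c) * (A c \<bullet> b))" for A B :: "'a \<Rightarrow>\<^sub>L 'a" and b
  proof -
    have "A (B b) = A (\<Sum>c\<in>Basis. (B b \<bullet> c) *\<^sub>R c)"
      by (simp add: euclidean_representation)
    then show ?thesis
      by (simp add: blinfun.sum_right blinfun.scaleR_right inner_sum_left)
  qed
  show ?thesis
    unfolding blinfun_trace_def blinfun_apply_blinfun_compose eq[of A B] eq[of B A]
    by (subst sum.swap) (simp only: mult.commute)
qed

lemma blinfun_trace_orthonormal: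
  assumes E: "finite E" "pairwise orthogonal E" "\<And>e. e \<in> E \<Longrightarrow> norm e = 1" "span E = UNIV"
  shows "blinfun_trace A = (\<Sum>e\<in>E. A e \<bullet> e)"
proof -
  have ex: "x = (\<Sum>e\<in>E. (x \<bullet> e) *\<^sub>R e)" for x
    using orthonormal_basis_expand[OF E(2,3) _ E(1), of x] E(4) by simp
  have "blinfun_trace A = (\<Sum>b\<in>Basis. \<Sum>e\<in>E. (b \<bullet> e) * (A e \<bullet> b))"
    unfolding blinfun_trace_def
    by (rule sum.cong[OF refl], subst ex)
       (simp add: blinfun.sum_right blinfun.scaleR_right inner_sum_left)
  also have "\<dots> = (\<Sum>e\<in>E. \<Sum>b\<in>Basis. (A e \<bullet> b) * (e \<bullet> b))"
    by (subst sum.swap) (simp add: mult.commute inner_commute)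
  also have "\<dots> = (\<Sum>e\<in>E. A e \<bullet> e)"
    by (intro sum.cong refl euclidean_inner[symmetric])
  finally show ?thesis .
qed

text \<open>The Faddeev--LeVerrier recursion: \<open>sigma_op k A\<close> is the \<open>k\<close>-th elementary symmetric function
  of the eigenvalues of \<open>A\<close>, and \<open>newton_tensor (k - 1) A\<close> is its gradient.\<close>

primrec newton_tensor :: "nat \<Rightarrow> ('a::euclidean_space \<Rightarrow>\<^sub>L 'a) \<Rightarrow> ('a \<Rightarrow>\<^sub>L 'a)" where
  "newton_tensor 0 A = id_blinfun"
| "newton_tensor (Suc k) A =
    (blinfun_trace (newton_tensor k A o\<^sub>L A) / real (Suc k)) *\<^sub>R id_blinfun - (newton_tensor k A o\<^sub>L A)"

primrec sigma_op :: "nat \<Rightarrow> ('a::euclidean_space \<Rightarrow>\<^sub>L 'a) \<Rightarrow> real" where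
  "sigma_op 0 A = 1"
| "sigma_op (Suc k) A = blinfun_trace (newton_tensor k A o\<^sub>L A) / real (Suc k)"

lemma newton_tensor_Suc: "newton_tensor (Suc k) A = sigma_op (Suc k) A *\<^sub>R id_blinfun - (newton_tensor k A o\<^sub>L A)"
  by (simp add: newton_tensor.simps(2) sigma_op.simps(2))

declare newton_tensor.simps(2) [simp del] sigma_op.simps(2) [simp del]

section \<open>Newton's identities and the derivative of \<open>sigma_op\<close>\<close>

primrec blinfun_pow :: "nat \<Rightarrow> ('a::real_normed_vector \<Rightarrow>\<^sub>L 'a) \<Rightarrow> ('a \<Rightarrow>\<^sub>L 'a)" where
  "blinfun_pow 0 A = id_blinfun"
| "blinfun_pow (Suc k) A = blinfun_pow k A o\<^sub>L A"

lemma blinfun_compose_id [simp]: "A o\<^sub>L id_blinfun = A" "id_blinfun o\<^sub>L A = A"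
  by (auto intro: blinfun_eqI)

lemma blinfun_compose_assoc: "(A o\<^sub>L B) o\<^sub>L C = A o\<^sub>L (B o\<^sub>L C)"
  by (auto intro: blinfun_eqI)

lemmas blinfun_compose_sum_left = bounded_bilinear.sum_left[OF bounded_bilinear_blinfun_compose]
lemmas blinfun_compose_scaleR_left = bounded_bilinear.scaleR_left[OF bounded_bilinear_blinfun_compose]

text \<open>Unrolled, the recursion shows a polynomial in \<open>A\<close> whose coefficients form a
  convolution with the sequence \<open>sigma_op\<close>, the shape that generating functions can
  handle.\<close>

lemma newton_tensor_expansion:
  "newton_tensor k A = (\<Sum>i\<le>k. ((-1) ^ i * sigma_op (k - i) A) *\<^sub>R blinfun_pow i A)"
proof (induction k)
  case (Suc k)
  have "newton_tensor (Suc k) A = sigma_op (Suc k) A *\<^sub>R id_blinfun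
      - ((\<Sum>i\<le>k. ((-1) ^ i * sigma_op (k - i) A) *\<^sub>R blinfun_pow i A) o\<^sub>L A)"
    unfolding newton_tensor_Suc Suc ..
  also have "\<dots> = sigma_op (Suc k) A *\<^sub>R id_blinfun
      + (\<Sum>i\<le>k. ((-1) ^ Suc i * sigma_op (k - i) A) *\<^sub>R blinfun_pow (Suc i) A)"
    unfolding blinfun_compose_sum_left blinfun_compose_scaleR_left blinfun_pow.simps(2) power_Suc
    by (simp only: mult_minus_left mult_1_left scaleR_minus_left sum_negf add_uminus_conv_diff)
  also have "\<dots> = (\<Sum>i\<le>Suc k. ((-1) ^ i * sigma_op (Suc k - i) A) *\<^sub>R blinfun_pow i A)"
    unfolding sum.atMost_Suc_shift[where n = k] diff_Suc_Suc
    by (simp only: power_0 mult_1_left diff_zero blinfun_pow.simps(1))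
  finally show ?case .
qed simp

lemma trace_newton_tensor_compose:
  "blinfun_trace (newton_tensor k A o\<^sub>L B) =
    (\<Sum>i\<le>k. (-1) ^ i * sigma_op (k - i) A * blinfun_trace (blinfun_pow i A o\<^sub>L B))"
  unfolding newton_tensor_expansion
  unfolding blinfun_compose_sum_left blinfun_compose_scaleR_left blinfun_trace_sum blinfun_trace_scaleR
    real_scaleR_def ..

text \<open>Since \<open>sigma_op\<close> is defined by the recursion and not through eigenvalues,
  these identities are its expansion traced against \<open>A\<close>, valid for every operator,
  diagonalizable or not.\<close>

lemma Newton_identity:
  "real (Suc k) * sigma_op (Suc k) A =
    (\<Sum>i\<le>k. (-1) ^ i * sigma_op (k - i) A * blinfun_trace (blinfun_pow (Suc i) A))"
  using trace_newton_tensor_compose[of k A A] by (simp add: sigma_op.simps(2))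

lemma has_derivative_blinfun_compose:
  assumes "(f has_derivative f') (at x)" "(g has_derivative g') (at x)"
  shows "((\<lambda>y. f y o\<^sub>L g y) has_derivative (\<lambda>v. (f x o\<^sub>L g' v) + (f' v o\<^sub>L g x))) (at x)"
  by (rule bounded_bilinear.FDERIV[OF bounded_bilinear_blinfun_compose assms])

text \<open>The derivative of a power is a sum of noncommuting products; under a trace against an
  operator commuting with \<open>A x\<close>, cyclicity makes all summands equal. Quantifying over
  \<open>C\<close> lets the induction pass from \<open>C\<close> to \<open>A x o\<^sub>L C\<close>.
  For \<open>i = 0\<close> the factor \<open>real i\<close> hides the truncated exponent.\<close>

lemma blinfun_pow_differentiable:
  fixes A :: "'a::real_normed_vector \<Rightarrow> 'b::euclidean_space \<Rightarrow>\<^sub>L 'b"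
  assumes A: "(A has_derivative A') (at x)"
  shows "\<exists>P'. ((\<lambda>y. blinfun_pow i (A y)) has_derivative P') (at x) \<and>
    (\<forall>v C. C o\<^sub>L A x = A x o\<^sub>L C \<longrightarrow>
       blinfun_trace (C o\<^sub>L P' v) = real i * blinfun_trace (C o\<^sub>L blinfun_pow (i - 1) (A x) o\<^sub>L A' v))"
proof (induction i)
  case 0
  show ?case by (rule exI[of _ "\<lambda>v. 0"]) (auto simp: blinfun_trace_def)
next
  case (Suc i)
  then obtain P' where P': "((\<lambda>y. blinfun_pow i (A y)) has_derivative P') (at x)"
    and tr: "\<And>v C. C o\<^sub>L A x = A x o\<^sub>L C \<Longrightarrow>
      blinfun_trace (C o\<^sub>L P' v) = real i * blinfun_trace (C o\<^sub>L blinfun_pow (i - 1) (A x) o\<^sub>L A' v)"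
    by blast
  have comm: "blinfun_pow j (A x) o\<^sub>L A x = A x o\<^sub>L blinfun_pow j (A x)" for j
    by (induction j) (simp, metis blinfun_compose_assoc blinfun_pow.simps(2))
  show ?case
  proof (intro exI conjI allI impI)
    show "((\<lambda>y. blinfun_pow (Suc i) (A y)) has_derivative
        (\<lambda>v. (blinfun_pow i (A x) o\<^sub>L A' v) + (P' v o\<^sub>L A x))) (at x)"
      using has_derivative_blinfun_compose[OF P' A] by simp
    fix v and C :: "'b \<Rightarrow>\<^sub>L 'b" assume C: "C o\<^sub>L A x = A x o\<^sub>L C"
    have "blinfun_trace (C o\<^sub>L (P' v o\<^sub>L A x)) = blinfun_trace ((A x o\<^sub>L C) o\<^sub>L P' v)"
      by (metis blinfun_compose_assoc blinfun_trace_compose_commute)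
    also have "\<dots> = real i * blinfun_trace (A x o\<^sub>L C o\<^sub>L blinfun_pow (i - 1) (A x) o\<^sub>L A' v)"
      by (rule tr) (metis C blinfun_compose_assoc)
    also have "\<dots> = real i * blinfun_trace (C o\<^sub>L blinfun_pow i (A x) o\<^sub>L A' v)"
    proof (cases i)
      case (Suc j)
      have "A x o\<^sub>L C o\<^sub>L blinfun_pow j (A x) = C o\<^sub>L blinfun_pow i (A x)"
        by (metis C Suc blinfun_compose_assoc blinfun_pow.simps(2) comm)
      then show ?thesis by (simp add: Suc)
    qed simp
    finally show "blinfun_trace (C o\<^sub>L ((blinfun_pow i (A x) o\<^sub>L A' v) + (P' v o\<^sub>L A x))) =
        real (Suc i) * blinfun_trace (C o\<^sub>L blinfun_pow (Suc i - 1) (A x) o\<^sub>L A' v)"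
      by (simp add: bounded_bilinear.add_right[OF bounded_bilinear_blinfun_compose] blinfun_trace_add
          blinfun_compose_assoc algebra_simps)
  qed
qed

lemma has_derivative_trace_pow:
  fixes A :: "'a::real_normed_vector \<Rightarrow> 'b::euclidean_space \<Rightarrow>\<^sub>L 'b"
  assumes A: "(A has_derivative A') (at x)"
  shows "((\<lambda>y. blinfun_trace (blinfun_pow (Suc i) (A y))) has_derivative
    (\<lambda>v. real (Suc i) * blinfun_trace (blinfun_pow i (A x) o\<^sub>L A' v))) (at x)"
proof -
  obtain P' where P': "((\<lambda>y. blinfun_pow (Suc i) (A y)) has_derivative P') (at x)"
    and tr: "\<And>v C. C o\<^sub>L A x = A x o\<^sub>L C \<Longrightarrow> blinfun_trace (C o\<^sub>L P' v) =
      real (Suc i) * blinfun_trace (C o\<^sub>L blinfun_pow (Suc i - 1) (A x) o\<^sub>L A' v)"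
    using blinfun_pow_differentiable[OF A, of "Suc i"] by blast
  show ?thesis
    using bounded_linear.has_derivative[OF bounded_linear_blinfun_trace P'] tr[of id_blinfun] by simp
qed

lemma newton_tensor_differentiable:
  fixes A :: "'a::real_normed_vector \<Rightarrow> 'b::euclidean_space \<Rightarrow>\<^sub>L 'b"
  assumes A: "(A has_derivative A') (at x)"
  obtains T' s' where "\<And>k. ((\<lambda>y. newton_tensor k (A y)) has_derivative T' k) (at x)"
    "\<And>k. ((\<lambda>y. sigma_op k (A y)) has_derivative s' k) (at x)"
proof -
  have sig: "\<exists>s'. ((\<lambda>y. sigma_op (Suc k) (A y)) has_derivative s') (at x)"
    if T': "((\<lambda>y. newton_tensor k (A y)) has_derivative T') (at x)" for k T'
    unfolding sigma_op.simps divide_inverse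
    using has_derivative_mult_left[OF bounded_linear.has_derivative[OF bounded_linear_blinfun_trace
          has_derivative_blinfun_compose[OF T' A]]] by blast
  have T: "\<exists>T'. ((\<lambda>y. newton_tensor k (A y)) has_derivative T') (at x)" for k
  proof (induction k)
    case (Suc k)
    then obtain T' where T': "((\<lambda>y. newton_tensor k (A y)) has_derivative T') (at x)" by blast
    obtain s' where s': "((\<lambda>y. sigma_op (Suc k) (A y)) has_derivative s') (at x)"
      using sig[OF T'] by blast
    show ?case
      unfolding newton_tensor_Suc
      using has_derivative_diff[OF has_derivative_scaleR_left[OF s']
          has_derivative_blinfun_compose[OF T' A], of id_blinfun] by blast
  qed (auto intro: has_derivative_const)
  have S: "\<exists>s'. ((\<lambda>y. sigma_op k (A y)) has_derivative s') (at x)" for k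
  proof (cases k)
    case (Suc j)
    then show ?thesis using T[of j] sig by blast
  qed (auto intro: has_derivative_const)
  show ?thesis using T S that by metis
qed

text \<open>By Newton's identities the generating function \<open>S\<close> of the \<open>sigma_op k\<close> satisfies \<open>S' = P S\<close>.
  Both the variation \<open>D\<close> of \<open>S\<close> and \<open>X b S\<close> solve the linearized equation with initial value 0.\<close>

lemma has_derivative_sigma:
  fixes A :: "'a::real_normed_vector \<Rightarrow> 'b::euclidean_space \<Rightarrow>\<^sub>L 'b"
  assumes A: "(A has_derivative A') (at x)"
  shows "((\<lambda>y. sigma_op (Suc k) (A y)) has_derivative
    (\<lambda>v. blinfun_trace (newton_tensor k (A x) o\<^sub>L A' v))) (at x)"
proof -
  obtain s' where s': "\<And>k. ((\<lambda>y. sigma_op k (A y)) has_derivative s' k) (at x)"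
    using newton_tensor_differentiable[OF A] by metis
  have "s' (Suc k) v = blinfun_trace (newton_tensor k (A x) o\<^sub>L A' v)" for k v
  proof -
    define S where "S = Abs_fps (\<lambda>k. sigma_op k (A x))"
    define D where "D = Abs_fps (\<lambda>k. s' k v)"
    define b where "b = Abs_fps (\<lambda>i. (-1) ^ i * blinfun_trace (blinfun_pow i (A x) o\<^sub>L A' v))"
    define P where "P = Abs_fps (\<lambda>i. (-1) ^ i * blinfun_trace (blinfun_pow (Suc i) (A x)))"
    \<comment> \<open>The coefficients (-1)^i tr A^(i+1) of \<open>P\<close> have the variation
      (-1)^i (i+1) tr(A^i A'), and these are the coefficients of the derivative of
      \<open>fps_X * b\<close>. In terms of series the claim reads D = X b S.\<close>
    define dP where "dP = fps_deriv (fps_X * b)"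
    have newton: "fps_deriv S = P * S"
    proof (rule fps_ext)
      fix k
      have "fps_nth (fps_deriv S) k = real (Suc k) * sigma_op (Suc k) (A x)"
        by (simp add: S_def)
      also have "\<dots> = fps_nth (P * S) k"
        unfolding Newton_identity fps_mult_nth by (simp add: S_def P_def atLeast0AtMost mult_ac)
      finally show "fps_nth (fps_deriv S) k = fps_nth (P * S) k" .
    qed
    have dP_nth: "fps_nth dP i = (-1) ^ i * (real (Suc i) * blinfun_trace (blinfun_pow i (A x) o\<^sub>L A' v))" for i
      by (cases i) (simp_all add: dP_def b_def algebra_simps)
    have s'0: "s' 0 v = 0"
      using has_derivative_unique[OF s'[of 0], of "\<lambda>v. 0"] by simp
    have newton': "fps_deriv D = P * D + dP * S"
    proof (rule fps_ext)
      fix k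
      let ?p = "\<lambda>i y. blinfun_trace (blinfun_pow (Suc i) (A y))"
      let ?p' = "\<lambda>i v. real (Suc i) * blinfun_trace (blinfun_pow i (A x) o\<^sub>L A' v)"
      have "((\<lambda>y. \<Sum>i\<le>k. (-1) ^ i * (sigma_op (k - i) (A y) * ?p i y)) has_derivative
          (\<lambda>v. \<Sum>i\<le>k. (-1) ^ i * (sigma_op (k - i) (A x) * ?p' i v + s' (k - i) v * ?p i x))) (at x)"
        by (intro has_derivative_sum has_derivative_mult_right has_derivative_mult s'
            has_derivative_trace_pow A)
      then have "((\<lambda>y. real (Suc k) * sigma_op (Suc k) (A y)) has_derivative
          (\<lambda>v. \<Sum>i\<le>k. (-1) ^ i * (sigma_op (k - i) (A x) * ?p' i v + s' (k - i) v * ?p i x))) (at x)"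
        unfolding Newton_identity mult.assoc .
      from fun_cong[OF has_derivative_unique[OF has_derivative_mult_right[OF s'] this], of v] have "real (Suc k) * s' (Suc k) v =
          (\<Sum>i\<le>k. (-1) ^ i * (sigma_op (k - i) (A x) * ?p' i v + s' (k - i) v * ?p i x))"
        .
      then show "fps_nth (fps_deriv D) k = fps_nth (P * D + dP * S) k"
        unfolding fps_add_nth fps_mult_nth
        by (simp add: D_def P_def S_def dP_nth atLeast0AtMost sum.distrib algebra_simps)
    qed
    define Y where "Y = D - S * (fps_X * b)"
    have Y': "fps_deriv Y = P * Y"
      by (simp add: Y_def newton newton' dP_def algebra_simps)
    \<comment> \<open>The equation Y' = P Y determines each coefficient from the earlier ones, and
      the constant coefficient is 0.\<close>
    have "fps_nth Y n = 0" for n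
    proof (induction n rule: less_induct)
      case (less n)
      show ?case
      proof (cases n)
        case 0
        then show ?thesis by (simp add: Y_def D_def s'0)
      next
        case (Suc m)
        have "real (Suc m) * fps_nth Y (Suc m) = (\<Sum>i=0..m. fps_nth P i * fps_nth Y (m - i))"
          using arg_cong[OF Y', of "\<lambda>F. fps_nth F m"] by (simp add: fps_mult_nth)
        also have "\<dots> = 0"
          using less Suc by (intro sum.neutral) auto
        finally show ?thesis using Suc by simp
      qed
    qed
    from this[of "Suc k"] have "fps_nth D (Suc k) = fps_nth (S * (fps_X * b)) (Suc k)"
      unfolding Y_def fps_sub_nth by (rule eq_iff_diff_eq_0[THEN iffD2])
    also have "S * (fps_X * b) = (b * S) * fps_X"
      by (simp only: mult_ac)
    also have "fps_nth ((b * S) * fps_X) (Suc k) = fps_nth (b * S) k"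
      by simp
    finally show ?thesis
      unfolding fps_mult_nth
      by (simp add: D_def b_def S_def trace_newton_tensor_compose atLeast0AtMost mult_ac)
  qed
  then have "s' (Suc k) = (\<lambda>v. blinfun_trace (newton_tensor k (A x) o\<^sub>L A' v))" by blast
  then show ?thesis using s'[of "Suc k"] by simp
qed

section \<open>Divergence theorem and symmetry of second derivatives\<close>

text \<open>The derivative is bounded on the ball by compactness and zero outside it. The constant
  dominates the difference quotients when the limit is taken under the integral below.\<close>

lemma Lipschitz_of_compact_support:
  fixes f :: "'a::euclidean_space \<Rightarrow> real"
  assumes f: "C1_on UNIV f" and supp: "\<And>x. R < norm x \<Longrightarrow> f x = 0"
  obtains C where "0 \<le> C" "\<And>x y. \<bar>f y - f x\<bar> \<le> C * norm (y - x)"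
proof -
  let ?D = "\<lambda>x. frechet_derivative f (at x)"
  have D: "(f has_derivative ?D x) (at x)" for x
    using C1_on_has_derivative[OF f] by simp
  have "\<exists>B. \<forall>x\<in>cball 0 R. \<bar>?D x b\<bar> \<le> B" for b
  proof -
    have "compact ((\<lambda>x. ?D x b) ` cball 0 R)"
      using f by (intro compact_continuous_image) (auto intro: continuous_on_subset)
    then have "bounded ((\<lambda>x. ?D x b) ` cball 0 R)" by (rule compact_imp_bounded)
    then show ?thesis by (auto simp: bounded_iff)
  qed
  then obtain B where B: "\<And>b x. x \<in> cball 0 R \<Longrightarrow> \<bar>?D x b\<bar> \<le> B b" by metis
  define C where "C = (\<Sum>b\<in>Basis. \<bar>B b\<bar>)"
  have C: "C \<ge> 0" by (simp add: C_def sum_nonneg)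
  have on: "onorm (?D x) \<le> C" for x
  proof (cases "norm x \<le> R")
    case True
    have "norm (?D x v) \<le> C * norm v" for v
    proof -
      interpret linear "?D x" using D has_derivative_linear by blast
      have "norm (?D x v) = \<bar>\<Sum>b\<in>Basis. (v \<bullet> b) * ?D x b\<bar>"
        by (subst euclidean_representation[symmetric, of v]) (simp only: sum scale real_scaleR_def real_norm_def)
      also have "\<dots> \<le> (\<Sum>b\<in>Basis. norm v * \<bar>B b\<bar>)"
        using B[of x] True
        by (intro order_trans[OF sum_abs] sum_mono) (auto simp: abs_mult intro!: mult_mono Basis_le_norm intro: order_trans[OF _ abs_ge_self])
      finally show ?thesis by (simp add: C_def sum_distrib_left mult.commute)
    qed
    then show ?thesis by (rule onorm_bound[OF C])
  next
    case False
    have "open (- cball (0::'a) R)" by (rule open_Compl) (rule closed_cball)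
    then have "(f has_derivative (\<lambda>v. 0)) (at x)"
      by (rule has_derivative_transform_within_open[OF has_derivative_const[of 0]])
         (use False supp in auto)
    then have "?D x = (\<lambda>v. 0)" by (metis frechet_derivative_at)
    then show ?thesis using C by (simp add: onorm_zero)
  qed
  have "norm (f y - f x) \<le> C * norm (y - x)" for x y
    by (rule differentiable_bound[of UNIV f ?D]) (use D on in auto)
  then show ?thesis using that C by simp
qed

lemma integral_translation:
  fixes f :: "'a::euclidean_space \<Rightarrow> real"
  assumes "f \<in> borel_measurable borel"
  shows "(\<integral>x. f (a + x) \<partial>lborel) = (\<integral>x. f x \<partial>lborel)"
  by (subst (2) lborel_distr_plus[of a, symmetric], subst integral_distr) (use assms in auto)

text \<open>Differentiate the translation invariance of the Lebesgue integral.\<close>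

lemma integral_directional_derivative_eq_0:
  fixes f :: "'a::euclidean_space \<Rightarrow> real"
  assumes f: "C1_on UNIV f" and supp: "\<And>x. R < norm x \<Longrightarrow> f x = 0"
  shows "integrable lborel (\<lambda>x. frechet_derivative f (at x) v)"
    and "(\<integral>x. frechet_derivative f (at x) v \<partial>lborel) = 0"
proof -
  let ?D = "\<lambda>x. frechet_derivative f (at x) v"
  obtain C where C: "0 \<le> C" "\<And>x y. \<bar>f y - f x\<bar> \<le> C * norm (y - x)"
    using Lipschitz_of_compact_support[OF f supp] by blast
  have cont: "continuous_on UNIV f" by (rule C1_on_imp_continuous_on[OF f])
  have meas: "f \<in> borel_measurable borel" by (rule borel_measurable_continuous_onI[OF cont])
  have intf: "integrable lborel f"
  proof -
    have "set_integrable lborel (cball 0 R) f"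
      unfolding set_integrable_def
      by (rule borel_integrable_compact) (use cont continuous_on_subset in auto)
    moreover have "(\<lambda>x. indicator (cball 0 R) x *\<^sub>R f x) = f"
      using supp by (force simp: indicator_def)
    ultimately show ?thesis by (simp add: set_integrable_def)
  qed
  have intf': "integrable lborel (\<lambda>x. f (a + x))" for a
  proof -
    have "integrable (distr lborel borel ((+) a)) f"
      using intf lborel_distr_plus[of a] by simp
    then show ?thesis using integrable_distr[of "(+) a" lborel borel f] by simp
  qed
  \<comment> \<open>The steps have length at most \<open>norm v\<close>, so all quotients vanish
    outside the ball of radius \<open>R + norm v\<close>; inside it the Lipschitz bound gives
    \<open>C * norm v\<close>. Hence the dominating function \<open>w\<close>.\<close>
  define s where "s n x = real (Suc n) * (f ((1 / real (Suc n)) *\<^sub>R v + x) - f x)" for n x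
  define w where "w x = C * norm v * indicator (cball (0::'a) (R + norm v)) x" for x
  have s0: "(\<integral>x. s n x \<partial>lborel) = 0" for n
    using integral_translation[OF meas] intf intf' by (simp add: s_def)
  have lim: "(\<lambda>n. s n x) \<longlonglongrightarrow> ?D x" for x
  proof -
    have "(f has_derivative frechet_derivative f (at x)) (at x)"
      using C1_on_has_derivative[OF f] by simp
    then have "((\<lambda>t. f (x + t *\<^sub>R v)) has_derivative (\<lambda>t. frechet_derivative f (at x) (t *\<^sub>R v))) (at 0)"
      by (intro has_derivative_compose[of "\<lambda>t. x + t *\<^sub>R v" _ 0 UNIV f]) (auto intro!: derivative_eq_intros)
    moreover have "frechet_derivative f (at x) (t *\<^sub>R v) = ?D x * t" for t
      using linear_scale[OF has_derivative_linear[OF C1_on_has_derivative[OF f, of x]]] by simp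
    ultimately have "((\<lambda>t. f (x + t *\<^sub>R v)) has_real_derivative ?D x) (at 0)"
      by (simp add: has_field_derivative_def)
    then have "((\<lambda>h. (f (x + h *\<^sub>R v) - f x) / h) \<longlongrightarrow> ?D x) (at 0)"
      by (simp add: DERIV_def)
    moreover have "filterlim (\<lambda>n. 1 / real (Suc n)) (at 0) sequentially"
      unfolding filterlim_at using LIMSEQ_inverse_real_of_nat by (simp add: inverse_eq_divide)
    ultimately have "(\<lambda>n. (f (x + (1 / real (Suc n)) *\<^sub>R v) - f x) / (1 / real (Suc n))) \<longlonglongrightarrow> ?D x"
      by (rule filterlim_compose)
    then show ?thesis by (simp add: s_def add.commute mult.commute)
  qed
  have bound: "norm (s n x) \<le> w x" for n x
  proof (cases "norm x \<le> R + norm v")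
    case True
    have "\<bar>f ((1 / real (Suc n)) *\<^sub>R v + x) - f x\<bar> \<le> C * (norm v / real (Suc n))"
      using C(2)[where y="(1 / real (Suc n)) *\<^sub>R v + x" and x=x] by simp
    then have "real (Suc n) * \<bar>f ((1 / real (Suc n)) *\<^sub>R v + x) - f x\<bar> \<le> C * norm v"
      by (simp add: field_simps)
    then show ?thesis using True by (simp only: s_def w_def abs_mult real_norm_def abs_of_nat) simp
  next
    case False
    have "norm x \<le> norm ((1 / real (Suc n)) *\<^sub>R v + x) + norm ((1 / real (Suc n)) *\<^sub>R v)"
      by (metis add_diff_cancel_left' norm_triangle_ineq4 add.commute)
    moreover have "norm ((1 / real (Suc n)) *\<^sub>R v) \<le> norm v"
      by (simp add: field_simps)
    ultimately have "R < norm ((1 / real (Suc n)) *\<^sub>R v + x)" using False by linarith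
    moreover have "R < norm x" using False norm_ge_zero[of v] by linarith
    ultimately show ?thesis using supp False by (simp add: s_def w_def)
  qed
  have w: "integrable lborel w"
    unfolding w_def by (intro integrable_mult_right) (use emeasure_bounded_finite[OF bounded_cball] in \<open>simp add: integrable_indicator_iff\<close>)
  have Dm: "?D \<in> borel_measurable lborel"
    using f by (simp add: borel_measurable_continuous_onI)
  have sm: "s n \<in> borel_measurable lborel" for n
    unfolding s_def using intf intf' by (intro borel_measurable_integrable integrable_mult_right Bochner_Integration.integrable_diff) auto
  show "integrable lborel ?D"
    by (rule integrable_dominated_convergence[where s = s, OF Dm sm w]) (use lim bound in auto)
  have "(\<lambda>n. \<integral>x. s n x \<partial>lborel) \<longlonglongrightarrow> (\<integral>x. ?D x \<partial>lborel)"
    by (rule integral_dominated_convergence[where s = s, OF Dm sm w]) (use lim bound in auto)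
  then show "(\<integral>x. ?D x \<partial>lborel) = 0"
    unfolding s0 by (simp add: LIMSEQ_const_iff)
qed

definition divergence :: "('a::euclidean_space \<Rightarrow> 'a) \<Rightarrow> 'a \<Rightarrow> real" where
  "divergence V x = (\<Sum>b\<in>Basis. frechet_derivative V (at x) b \<bullet> b)"

lemma divergence_eq: "(V has_derivative V') (at x) \<Longrightarrow> divergence V x = (\<Sum>b\<in>Basis. V' b \<bullet> b)"
  unfolding divergence_def by (simp flip: frechet_derivative_at)

text \<open>The divergence has integral 0, so being nonnegative it is 0 almost everywhere; by
  continuity its zero set is closed, and a closed set of full measure is the whole space.\<close>

theorem divergence_nonneg_imp_0:
  fixes V :: "'a::euclidean_space \<Rightarrow> 'a"
  assumes V: "C1_on UNIV V" and supp: "\<And>x. R < norm x \<Longrightarrow> V x = 0"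
    and nonneg: "\<And>x. 0 \<le> divergence V x"
  shows "divergence V x = 0"
proof -
  have Vb: "C1_on UNIV (\<lambda>x. V x \<bullet> b)" for b
    by (intro C1_on_inner V C1_on_const)
  have D: "frechet_derivative (\<lambda>x. V x \<bullet> b) (at x) v = frechet_derivative V (at x) v \<bullet> b" for b v x
  proof -
    have "((\<lambda>x. V x \<bullet> b) has_derivative (\<lambda>v. frechet_derivative V (at x) v \<bullet> b)) (at x)"
      using C1_on_has_derivative[OF V] by (intro derivative_intros) auto
    then show ?thesis by (metis frechet_derivative_at)
  qed
  have int: "integrable lborel (\<lambda>x. frechet_derivative V (at x) v \<bullet> b)"
    and int0: "(\<integral>x. frechet_derivative V (at x) v \<bullet> b \<partial>lborel) = 0" for v b
    using integral_directional_derivative_eq_0[OF Vb, of R b v] supp unfolding D by auto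
  have intd: "integrable lborel (divergence V)" "(\<integral>x. divergence V x \<partial>lborel) = 0"
    unfolding divergence_def using int int0 by simp_all
  have cont: "continuous_on UNIV (divergence V)"
    unfolding divergence_def using V by (auto intro!: continuous_intros)
  have "AE x in lborel. divergence V x = 0"
    using integral_nonneg_eq_0_iff_AE[OF intd(1)] intd(2) nonneg by simp
  then have ae: "AE x in lborel. x \<in> {x. divergence V x = 0}" by simp
  have "closed {x. divergence V x = 0}"
    using continuous_closed_preimage_constant[OF cont closed_UNIV, of 0] by simp
  then have "x \<in> {x. divergence V x = 0}"
    using AE_completion[OF ae] by (rule mem_closed_if_AE_lebesgue)
  then show ?thesis by simp
qed

text \<open>Young's form of the theorem, with second derivatives at the single point
  \<open>x\<close>: the second difference \<open>Q t\<close> is symmetric in \<open>v\<close> and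
  \<open>w\<close>, and divided by t^2 it tends to either mixed derivative.\<close>

lemma second_derivative_symmetric:
  fixes f :: "'a::real_normed_vector \<Rightarrow> real"
  assumes S: "open S" "x \<in> S"
    and f: "\<And>y. y \<in> S \<Longrightarrow> (f has_derivative f' y) (at y)"
    and v: "((\<lambda>y. f' y v) has_derivative f'' v) (at x)"
    and w: "((\<lambda>y. f' y w) has_derivative f'' w) (at x)"
  shows "f'' v w = f'' w v"
proof -
  define Q where "Q t = f (x + t *\<^sub>R v + t *\<^sub>R w) - f (x + t *\<^sub>R v) - f (x + t *\<^sub>R w) + f x" for t
  have main: "((\<lambda>t. Q t / t\<^sup>2) \<longlongrightarrow> f'' v w) (at_right 0)"
    if v: "((\<lambda>y. f' y v) has_derivative f'' v) (at x)"
      and Q: "\<And>t. Q t = f (x + t *\<^sub>R v + t *\<^sub>R w) - f (x + t *\<^sub>R v) - f (x + t *\<^sub>R w) + f x" for v w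
  proof (rule tendstoI)
    fix e :: real assume e: "0 < e"
    \<comment> \<open>Displacements s v + r w with coefficients of size at most \<open>t\<close>
      have norm at most \<open>t * (K/2)\<close>; the summand 1 keeps \<open>K\<close> positive when
      both vectors are 0.\<close>
    define K where "K = 2 * (norm v + norm w) + 1"
    have K: "K > 0" by (simp add: K_def add_nonneg_pos)
    interpret L: linear "f'' v" using v has_derivative_linear by blast
    obtain d1 where d1: "d1 > 0" "\<And>y. norm (y - x) < d1 \<Longrightarrow>
        norm (f' y v - f' x v - f'' v (y - x)) \<le> (e / (2 * K)) * norm (y - x)"
      using v e K unfolding has_derivative_at_alt by (metis divide_pos_pos mult_pos_pos zero_less_numeral)
    obtain d2 where d2: "d2 > 0" "ball x d2 \<subseteq> S" using S openE by blast
    define d where "d = min d1 d2 / K"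
    have "d > 0" using d1 d2 K by (simp add: d_def)
    have "\<bar>Q t / t\<^sup>2 - f'' v w\<bar> < e" if t: "0 < t" "t < d" for t
    proof -
      have tK: "t * K < min d1 d2" using t K by (simp add: d_def field_simps)
      have small: "norm (s *\<^sub>R v + r *\<^sub>R w) \<le> t * (K/2)" "norm (s *\<^sub>R v + r *\<^sub>R w) < min d1 d2"
        if "\<bar>s\<bar> \<le> t" "\<bar>r\<bar> \<le> t" for s r
      proof -
        have "norm (s *\<^sub>R v + r *\<^sub>R w) \<le> \<bar>s\<bar> * norm v + \<bar>r\<bar> * norm w"
          by (metis norm_scaleR norm_triangle_ineq)
        also have "\<dots> \<le> t * norm v + t * norm w"
          using that by (intro add_mono mult_right_mono) auto
        also have "\<dots> \<le> t * (K/2)" using t by (simp add: K_def algebra_simps)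
        finally show 1: "norm (s *\<^sub>R v + r *\<^sub>R w) \<le> t * (K/2)" .
        show "norm (s *\<^sub>R v + r *\<^sub>R w) < min d1 d2"
          using 1 tK t K by (smt (verit) mult_pos_pos field_sum_of_halves mult.commute times_divide_eq_right)
      qed
      have inS: "x + (s *\<^sub>R v + r *\<^sub>R w) \<in> S" if "\<bar>s\<bar> \<le> t" "\<bar>r\<bar> \<le> t" for s r
        using small(2)[OF that] d2(2) by (intro subsetD[OF d2(2)]) (subst mem_ball, subst dist_commute, simp add: dist_norm)
      define g where "g s = f (x + (s *\<^sub>R v + t *\<^sub>R w)) - f (x + (s *\<^sub>R v + 0 *\<^sub>R w))" for s
      define g' where "g' s = f' (x + (s *\<^sub>R v + t *\<^sub>R w)) v - f' (x + (s *\<^sub>R v + 0 *\<^sub>R w)) v" for s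
      have der: "((\<lambda>s. f (x + (s *\<^sub>R v + r *\<^sub>R w))) has_real_derivative f' (x + (s *\<^sub>R v + r *\<^sub>R w)) v) (at s)"
        if "\<bar>s\<bar> \<le> t" "\<bar>r\<bar> \<le> t" for s r
      proof -
        have F: "(f has_derivative f' (x + (s *\<^sub>R v + r *\<^sub>R w))) (at (x + (s *\<^sub>R v + r *\<^sub>R w)))"
          using f inS[OF that] by blast
        have "((\<lambda>s. f (x + (s *\<^sub>R v + r *\<^sub>R w))) has_derivative (\<lambda>h. f' (x + (s *\<^sub>R v + r *\<^sub>R w)) (h *\<^sub>R v))) (at s)"
          by (rule has_derivative_compose[of "\<lambda>s. x + (s *\<^sub>R v + r *\<^sub>R w)" _ s UNIV f, OF _ F])
             (auto intro!: derivative_eq_intros)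
        then show ?thesis
          by (simp add: has_field_derivative_def linear_scale[OF has_derivative_linear[OF F]] mult_commute_abs)
      qed
      \<comment> \<open>The mean value theorem is used in the direction \<open>v\<close> only;
        linearizing the derivative along \<open>v\<close> at both ends of the edge t w then leaves
        \<open>t * f'' v w\<close>.\<close>
      have "\<exists>z>0. z < t \<and> g t - g 0 = (t - 0) * g' z"
        by (rule MVT2[OF t(1)]) (unfold g_def g'_def, intro DERIV_diff der, use t in auto)
      then obtain z where z: "0 < z" "z < t" "g t - g 0 = t * g' z" by auto
      have Qg: "Q t = t * g' z"
        unfolding z(3)[symmetric] by (simp add: g_def Q algebra_simps)
      let ?y = "x + (z *\<^sub>R v + t *\<^sub>R w)" and ?yz = "x + (z *\<^sub>R v + 0 *\<^sub>R w)"
      have dv: "norm (f' (x + u) v - f' x v - f'' v u) \<le> (e / (2 * K)) * (t * (K/2))"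
        if "norm u \<le> t * (K/2)" "norm u < min d1 d2" for u
      proof -
        have "norm (f' (x + u) v - f' x v - f'' v u) \<le> (e / (2 * K)) * norm u"
          using d1(2)[of "x + u"] that by simp
        also have "\<dots> \<le> (e / (2 * K)) * (t * (K/2))"
          by (rule mult_left_mono[OF that(1)]) (use e K in simp)
        finally show ?thesis .
      qed
      have e1: "norm (f' ?y v - f' x v - f'' v (z *\<^sub>R v + t *\<^sub>R w)) \<le> (e / (2 * K)) * (t * (K/2))"
        using z by (intro dv small) auto
      have e2: "norm (f' ?yz v - f' x v - f'' v (z *\<^sub>R v + 0 *\<^sub>R w)) \<le> (e / (2 * K)) * (t * (K/2))"
        using z t by (intro dv small) auto
      have "\<bar>g' z - t * f'' v w\<bar> \<le> 2 * ((e / (2 * K)) * (t * (K/2)))"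
        using e1 e2 unfolding g'_def L.add L.scale real_norm_def real_scaleR_def by linarith
      also have "\<dots> = t * (e/2)" using K by (simp add: field_simps)
      finally have "\<bar>(g' z - t * f'' v w) / t\<bar> \<le> e/2"
        using t by (simp add: abs_divide pos_divide_le_eq mult.commute)
      moreover have "Q t / t\<^sup>2 - f'' v w = (g' z - t * f'' v w) / t"
        using t unfolding Qg by (simp add: power2_eq_square diff_divide_distrib)
      ultimately have "\<bar>Q t / t\<^sup>2 - f'' v w\<bar> \<le> e/2" by simp
      then show ?thesis using e by simp
    qed
    then show "\<forall>\<^sub>F t in at_right 0. dist (Q t / t\<^sup>2) (f'' v w) < e"
      using \<open>d > 0\<close> by (auto simp: eventually_at_right_field dist_real_def)
  qed
  have "((\<lambda>t. Q t / t\<^sup>2) \<longlongrightarrow> f'' v w) (at_right 0)" by (rule main[OF v]) (simp add: Q_def)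
  moreover have "((\<lambda>t. Q t / t\<^sup>2) \<longlongrightarrow> f'' w v) (at_right 0)"
    by (rule main[OF w]) (simp add: Q_def algebra_simps)
  ultimately show ?thesis by (rule tendsto_unique[OF trivial_limit_at_right_real])
qed

section \<open>Regularity, scaling, divergence and eigenvectors of Newton tensors\<close>

lemma C1_on_newton_tensor:
  assumes "C1_on S A"
  shows "C1_on S (\<lambda>x. newton_tensor k (A x))"
proof (induction k)
  case (Suc k)
  show ?case
    unfolding newton_tensor_Suc sigma_op.simps divide_inverse
    by (intro C1_on_diff C1_on_scaleR C1_on_mult C1_on_const C1_on_blinfun_compose Suc assms
        C1_on_bounded_linear[OF bounded_linear_blinfun_trace])
qed (simp del: Ck_on.simps add: C1_on_const)

lemma C1_on_sigma_op:
  assumes "C1_on S A"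
  shows "C1_on S (\<lambda>x. sigma_op k (A x))"
proof (cases k)
  case (Suc j)
  show ?thesis
    unfolding Suc sigma_op.simps divide_inverse
    by (intro C1_on_mult C1_on_const C1_on_blinfun_compose C1_on_newton_tensor assms
        C1_on_bounded_linear[OF bounded_linear_blinfun_trace])
qed (simp del: Ck_on.simps add: C1_on_const)

lemma newton_tensor_scaleR: "newton_tensor k (c *\<^sub>R A) = c ^ k *\<^sub>R newton_tensor k A"
  and sigma_op_scaleR: "sigma_op k (c *\<^sub>R A) = c ^ k * sigma_op k A"
proof -
  have S: "sigma_op (Suc k) (c *\<^sub>R A) = c ^ Suc k * sigma_op (Suc k) A"
    if "newton_tensor k (c *\<^sub>R A) = c ^ k *\<^sub>R newton_tensor k A" for k
    unfolding sigma_op.simps that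
      bounded_bilinear.scaleR_left[OF bounded_bilinear_blinfun_compose]
      bounded_bilinear.scaleR_right[OF bounded_bilinear_blinfun_compose] blinfun_trace_scaleR
    by simp
  have T: "newton_tensor k (c *\<^sub>R A) = c ^ k *\<^sub>R newton_tensor k A" for k
  proof (induction k)
    case (Suc k)
    show ?case
      unfolding newton_tensor_Suc S[OF Suc] Suc
        bounded_bilinear.scaleR_left[OF bounded_bilinear_blinfun_compose]
        bounded_bilinear.scaleR_right[OF bounded_bilinear_blinfun_compose]
      by (simp add: scaleR_diff_right mult.commute)
  qed simp
  show "newton_tensor k (c *\<^sub>R A) = c ^ k *\<^sub>R newton_tensor k A" by (rule T)
  show "sigma_op k (c *\<^sub>R A) = c ^ k * sigma_op k A"
  proof (cases k)
    case (Suc j)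
    show ?thesis unfolding Suc by (rule S[OF T])
  qed simp
qed

text \<open>On the kernel only the scalar term of the recursion survives. The kernel vector in
  question will be the radial direction.\<close>

lemma newton_tensor_kernel:
  fixes A :: "'a::euclidean_space \<Rightarrow>\<^sub>L 'a"
  assumes "A x = 0"
  shows "newton_tensor k A x = sigma_op k A *\<^sub>R x"
  by (cases k) (simp_all add: newton_tensor_Suc blinfun.diff_left blinfun.scaleR_left assms)

lemma newton_tensor_commute:
  fixes A :: "'a::euclidean_space \<Rightarrow>\<^sub>L 'a"
  shows "newton_tensor k A (A v) = A (newton_tensor k A v)"
  by (induction k arbitrary: v)
     (simp_all add: newton_tensor_Suc blinfun.diff_left blinfun.scaleR_left blinfun.diff_right blinfun.scaleR_right)

lemma newton_tensor_selfadjoint: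
  fixes A :: "'a::euclidean_space \<Rightarrow>\<^sub>L 'a"
  assumes "\<And>v w. A v \<bullet> w = v \<bullet> A w"
  shows "newton_tensor k A v \<bullet> w = v \<bullet> newton_tensor k A w"
  by (induction k arbitrary: v w)
     (simp_all add: newton_tensor_Suc blinfun.diff_left blinfun.scaleR_left inner_diff_left inner_diff_right
        assms newton_tensor_commute)

text \<open>Induction on the recursion. The derivative of sigma_(k+1) in direction \<open>w\<close>
  is the trace of T_k composed with \<open>A' w\<close>; the Codazzi symmetry turns the divergence
  of T_k A into the same trace, since T_k itself contributes nothing by the induction hypothesis at
  \<open>A x w\<close>.\<close>

lemma newton_tensor_divergence_free:
  fixes A :: "'a::euclidean_space \<Rightarrow> 'a \<Rightarrow>\<^sub>L 'a"
  assumes A: "(A has_derivative A') (at x)"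
    and codazzi: "\<And>v w. A' v w = A' w v"
    and T': "((\<lambda>y. newton_tensor k (A y)) has_derivative T') (at x)"
  shows "(\<Sum>b\<in>Basis. T' b w \<bullet> b) = 0"
  using T'
proof (induction k arbitrary: T' w)
  case 0
  then have "T' = (\<lambda>v. 0)"
    using has_derivative_unique[OF _ has_derivative_const] by auto
  then show ?case by simp
next
  case (Suc k)
  obtain Tk where Tk: "((\<lambda>y. newton_tensor k (A y)) has_derivative Tk) (at x)"
    using newton_tensor_differentiable[OF A] by metis
  let ?s = "\<lambda>v. blinfun_trace (newton_tensor k (A x) o\<^sub>L A' v)"
  have "((\<lambda>y. newton_tensor (Suc k) (A y)) has_derivative
      (\<lambda>v. ?s v *\<^sub>R id_blinfun - ((newton_tensor k (A x) o\<^sub>L A' v) + (Tk v o\<^sub>L A x)))) (at x)"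
    unfolding newton_tensor_Suc
    by (intro has_derivative_diff has_derivative_scaleR_left has_derivative_sigma[OF A]
        has_derivative_blinfun_compose Tk A)
  from has_derivative_unique[OF Suc.prems this]
  have T': "T' v = ?s v *\<^sub>R id_blinfun - ((newton_tensor k (A x) o\<^sub>L A' v) + (Tk v o\<^sub>L A x))" for v
    by (rule fun_cong)
  have lin: "linear ?s"
    using has_derivative_linear[OF has_derivative_sigma[OF A]] .
  have "(\<Sum>b\<in>Basis. ?s b * (w \<bullet> b)) = ?s (\<Sum>b\<in>Basis. (w \<bullet> b) *\<^sub>R b)"
    unfolding linear_sum[OF lin] linear_scale[OF lin] by (simp add: mult.commute)
  then have 1: "(\<Sum>b\<in>Basis. ?s b * (w \<bullet> b)) = ?s w"
    by (simp add: euclidean_representation)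
  have 2: "(\<Sum>b\<in>Basis. newton_tensor k (A x) (A' b w) \<bullet> b) = ?s w"
    unfolding blinfun_trace_def by (simp add: codazzi[of w])
  show ?case
    unfolding T'
    using 1 2 Suc.IH[OF Tk, of "A x w"]
    by (simp add: blinfun.diff_left blinfun.add_left blinfun.scaleR_left inner_diff_left inner_add_left
        sum_subtractf sum.distrib)
qed

text \<open>On an eigenvector the recursion becomes \<open>esym_remove\<close>, and its trace
  becomes \<open>sum_mult_esym_remove\<close>; so the two claims climb together in
  \<open>k\<close>.\<close>

lemma newton_tensor_eigenbasis:
  fixes A :: "'a::euclidean_space \<Rightarrow>\<^sub>L 'a"
  assumes E: "finite E" "pairwise orthogonal E" "\<And>e. e \<in> E \<Longrightarrow> norm e = 1" "span E = UNIV"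
    and A: "\<And>e. e \<in> E \<Longrightarrow> A e = \<mu> e *\<^sub>R e"
  shows newton_tensor_eigenvector: "e \<in> E \<Longrightarrow> newton_tensor k A e = esym k (E - {e}) \<mu> *\<^sub>R e"
    and sigma_op_eq_esym: "sigma_op k A = esym k E \<mu>"
proof -
  have S: "sigma_op (Suc k) A = esym (Suc k) E \<mu>"
    if "\<And>e. e \<in> E \<Longrightarrow> newton_tensor k A e = esym k (E - {e}) \<mu> *\<^sub>R e" for k
  proof -
    have "blinfun_trace (newton_tensor k A o\<^sub>L A) = (\<Sum>e\<in>E. newton_tensor k A (A e) \<bullet> e)"
      using blinfun_trace_orthonormal[OF E, of "newton_tensor k A o\<^sub>L A"] by simp
    also have "\<dots> = (\<Sum>e\<in>E. \<mu> e * esym k (E - {e}) \<mu>)"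
    proof (rule sum.cong[OF refl])
      fix e assume e: "e \<in> E"
      then have "e \<bullet> e = 1" using E(3) by (simp add: norm_eq_1)
      then show "newton_tensor k A (A e) \<bullet> e = \<mu> e * esym k (E - {e}) \<mu>"
        by (simp add: A[OF e] that[OF e] blinfun.scaleR_right)
    qed
    also have "\<dots> = real (Suc k) * esym (Suc k) E \<mu>"
      by (rule sum_mult_esym_remove[OF E(1)])
    finally show ?thesis by (simp add: sigma_op.simps(2))
  qed
  have T: "newton_tensor k A e = esym k (E - {e}) \<mu> *\<^sub>R e" if "e \<in> E" for k e
    using that
  proof (induction k arbitrary: e)
    case 0
    then show ?case using E(1) by (simp add: esym_0)
  next
    case (Suc k)
    have "newton_tensor (Suc k) A e = (esym (Suc k) E \<mu> - \<mu> e * esym k (E - {e}) \<mu>) *\<^sub>R e"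
      unfolding newton_tensor_Suc
      by (simp add: blinfun.diff_left blinfun.scaleR_left blinfun.scaleR_right A[OF Suc.prems] Suc.IH[OF Suc.prems]
          S[OF Suc.IH] scaleR_diff_left)
    then show ?case
      using esym_remove[OF E(1) Suc.prems, of k \<mu>] by simp
  qed
  show "newton_tensor k A e = esym k (E - {e}) \<mu> *\<^sub>R e" if "e \<in> E" by (rule T[OF that])
  show "sigma_op k A = esym k E \<mu>"
  proof (cases k)
    case (Suc j)
    show ?thesis unfolding Suc by (rule S[OF T])
  qed (simp add: E(1) esym_0)
qed

section \<open>Spectral theorem and lists of eigenvalues\<close>

lemma selfadjoint_eigenvector:
  fixes A :: "'a::euclidean_space \<Rightarrow> 'a"
  assumes V: "subspace V" "V \<noteq> {0}" and A: "linear A" "\<And>v. v \<in> V \<Longrightarrow> A v \<in> V"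
    and sym: "\<And>v w. v \<in> V \<Longrightarrow> w \<in> V \<Longrightarrow> A v \<bullet> w = v \<bullet> A w"
  obtains v l where "v \<in> V" "norm v = 1" "A v = l *\<^sub>R v"
proof -
  interpret A: linear A by (rule A(1))
  have "compact (V \<inter> sphere 0 1)"
    by (intro closed_Int_compact closed_subspace V) simp
  moreover obtain u where u: "u \<in> V" "u \<noteq> 0" using V subspace_0 by blast
  then have "(1 / norm u) *\<^sub>R u \<in> V \<inter> sphere 0 1"
    using V(1) by (simp add: subspace_scale)
  then have "V \<inter> sphere 0 1 \<noteq> {}" by blast
  moreover have "continuous_on (V \<inter> sphere 0 1) (\<lambda>v. A v \<bullet> v)"
    using A(1) by (intro continuous_intros linear_continuous_on) (simp add: linear_conv_bounded_linear)
  ultimately have "\<exists>v\<in>V \<inter> sphere 0 1. \<forall>w\<in>V \<inter> sphere 0 1. A w \<bullet> w \<le> A v \<bullet> v"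
    by (rule continuous_attains_sup)
  then obtain v where v: "v \<in> V \<inter> sphere 0 1"
    and max: "\<And>w. w \<in> V \<inter> sphere 0 1 \<Longrightarrow> A w \<bullet> w \<le> A v \<bullet> v"
    by blast
  define l where "l = A v \<bullet> v"
  have le: "A w \<bullet> w \<le> l * (w \<bullet> w)" if "w \<in> V" for w
  proof (cases "w = 0")
    case False
    let ?w = "(1 / norm w) *\<^sub>R w"
    have "A ?w \<bullet> ?w \<le> l"
      unfolding l_def using that False V(1) by (intro max) (simp add: subspace_scale)
    then show ?thesis
      using False by (simp add: A.scale dot_square_norm power2_eq_square field_simps)
  qed (simp add: A.zero)
  have "(l *\<^sub>R v - A v) \<bullet> w = 0" if w: "w \<in> V" for w
  proof -
    define b where "b = (l *\<^sub>R v - A v) \<bullet> w"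
    define c where "c = l * (w \<bullet> w) - A w \<bullet> w"
    \<comment> \<open>First variation of the Rayleigh quotient at its maximum \<open>v\<close>: a
      quadratic in \<open>t\<close> without constant term that is nonnegative for all
      \<open>t\<close> has linear coefficient 0.\<close>
    have quad: "0 \<le> 2 * t * b + t\<^sup>2 * c" for t
    proof -
      have "0 \<le> l * ((v + t *\<^sub>R w) \<bullet> (v + t *\<^sub>R w)) - A (v + t *\<^sub>R w) \<bullet> (v + t *\<^sub>R w)"
        using le[of "v + t *\<^sub>R w"] v w V(1) by (simp add: subspace_add subspace_scale)
      also have "\<dots> = (l * (v \<bullet> v) - A v \<bullet> v) + 2 * t * b + t\<^sup>2 * c"
        using sym[of w v] v w by (simp add: A.add A.scale b_def c_def algebra_simps inner_commute power2_eq_square)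
      also have "l * (v \<bullet> v) - A v \<bullet> v = 0"
        using v by (simp add: l_def norm_eq_1)
      finally show ?thesis by simp
    qed
    have "b = 0"
    proof (rule ccontr)
      assume "b \<noteq> 0"
      \<comment> \<open>\<open>d\<close> is a positive upper bound of \<open>c\<close>, and
        \<open>t\<close> minimizes the quadratic with \<open>c\<close> replaced by
        \<open>d\<close>.\<close>
      define d where "d = 1 + \<bar>c\<bar>"
      define t where "t = - b / d"
      have d: "d > 0" "c \<le> d" by (auto simp: d_def)
      have "2 * t * b + t\<^sup>2 * c \<le> 2 * t * b + t\<^sup>2 * d"
        using d by (intro add_left_mono mult_left_mono) auto
      also have "\<dots> = - (b\<^sup>2 / d)"
        using d(1) by (simp add: t_def power2_eq_square field_simps)
      also have "\<dots> < 0" using \<open>b \<noteq> 0\<close> d(1) by simp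
      finally show False using quad[of t] by simp
    qed
    then show ?thesis by (simp add: b_def)
  qed
  moreover have "l *\<^sub>R v - A v \<in> V"
    using v V(1) A(2) by (simp add: subspace_diff subspace_scale)
  ultimately have "l *\<^sub>R v - A v = 0" by (metis inner_eq_zero_iff)
  then show ?thesis using v by (intro that[of v l]) auto
qed

lemma selfadjoint_eigenbasis:
  fixes A :: "'a::euclidean_space \<Rightarrow> 'a"
  assumes "subspace V" and "linear A" "\<And>v. v \<in> V \<Longrightarrow> A v \<in> V"
    and "\<And>v w. v \<in> V \<Longrightarrow> w \<in> V \<Longrightarrow> A v \<bullet> w = v \<bullet> A w"
  obtains E \<mu> where "finite E" "E \<subseteq> V" "span E = V" "pairwise orthogonal E" "\<And>e. e \<in> E \<Longrightarrow> norm e = 1"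
    "\<And>e. e \<in> E \<Longrightarrow> A e = \<mu> e *\<^sub>R e"
proof -
  have "\<exists>E. finite E \<and> E \<subseteq> V \<and> span E = V \<and> pairwise orthogonal E \<and> (\<forall>e\<in>E. norm e = 1 \<and> (\<exists>l. A e = l *\<^sub>R e))"
    using assms
  proof (induction "dim V" arbitrary: V rule: less_induct)
    case less
    show ?case
    proof (cases "V = {0}")
      case True
      then show ?thesis by (intro exI[of _ "{}"]) auto
    next
      case False
      obtain v l where v: "v \<in> V" "norm v = 1" "A v = l *\<^sub>R v"
        using selfadjoint_eigenvector[OF less.prems(1) False less.prems(2,3,4)] by metis
      have v0: "v \<noteq> 0" using v(2) by auto
      define V' where "V' = {w \<in> V. v \<bullet> w = 0}"
      have V': "subspace V'"
        using less.prems(1) by (auto simp: V'_def subspace_def inner_add_right)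
      have "v \<notin> V'" using v0 by (simp add: V'_def)
      moreover have "V' \<subseteq> V" by (auto simp: V'_def)
      ultimately have "V' \<subset> V" using v(1) by blast
      then have "dim V' < dim V"
        using V' less.prems(1) by (metis dim_psubset span_eq_iff)
      moreover have "A w \<in> V'" if "w \<in> V'" for w
        using that less.prems(3,4) v by (auto simp: V'_def) (metis inner_scaleR_left mult_zero_right v(3))
      moreover have "A u \<bullet> w = u \<bullet> A w" if "u \<in> V'" "w \<in> V'" for u w
        using that less.prems(4) by (auto simp: V'_def)
      ultimately obtain E where E: "finite E" "E \<subseteq> V'" "span E = V'" "pairwise orthogonal E"
        "\<forall>e\<in>E. norm e = 1 \<and> (\<exists>l. A e = l *\<^sub>R e)"
        using less.hyps[of V'] V' less.prems(2) by metis
      have "span (insert v E) = V"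
      proof
        show "span (insert v E) \<subseteq> V"
          using E(2) v(1) less.prems(1) by (intro span_minimal) (auto simp: V'_def)
        show "V \<subseteq> span (insert v E)"
        proof
          fix w assume w: "w \<in> V"
          have "w - (v \<bullet> w) *\<^sub>R v \<in> V'"
            using w v less.prems(1)
            by (auto simp: V'_def subspace_diff subspace_scale inner_diff_right norm_eq_1)
          then have "w - (v \<bullet> w) *\<^sub>R v \<in> span (insert v E)"
            using E(3) span_mono[of E "insert v E"] by blast
          then have "(w - (v \<bullet> w) *\<^sub>R v) + (v \<bullet> w) *\<^sub>R v \<in> span (insert v E)"
            by (rule span_add[OF _ span_scale[OF span_base]]) simp
          then show "w \<in> span (insert v E)" by simp
        qed
      qed
      moreover have "pairwise orthogonal (insert v E)"
        using E(2,4) by (auto simp: pairwise_insert V'_def orthogonal_def inner_commute)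
      ultimately show ?thesis
        using E v by (intro exI[of _ "insert v E"]) (auto simp: V'_def)
    qed
  qed
  then obtain E where E: "finite E" "E \<subseteq> V" "span E = V" "pairwise orthogonal E"
    "\<forall>e\<in>E. norm e = 1 \<and> (\<exists>l. A e = l *\<^sub>R e)"
    by blast
  then obtain \<mu> where "\<And>e. e \<in> E \<Longrightarrow> A e = \<mu> e *\<^sub>R e" by metis
  with E that show ?thesis by metis
qed

text \<open>Each eigenspace is spanned by the basis vectors with that eigenvalue, so its dimension
  counts them and the multiset is the image of \<open>E\<close> under \<open>\<mu>\<close>. The list
  \<open>es\<close> enumerates \<open>E\<close> sorted by eigenvalue; through it, products and
  symmetric functions of the list become ones over \<open>E\<close>.\<close>

lemma form_eigenvalues_eq:
  fixes A :: "'a::euclidean_space \<Rightarrow> 'a"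
  assumes V: "subspace V" and A: "linear A" "\<And>v. v \<in> V \<Longrightarrow> A v \<in> V"
    and B: "\<And>v w. v \<in> V \<Longrightarrow> w \<in> V \<Longrightarrow> B v w = A v \<bullet> w"
    and E: "finite E" "E \<subseteq> V" "span E = V" "pairwise orthogonal E" "\<And>e. e \<in> E \<Longrightarrow> norm e = 1"
    and \<mu>: "\<And>e. e \<in> E \<Longrightarrow> A e = \<mu> e *\<^sub>R e"
  obtains es where "form_eigenvalues V B = map \<mu> es" "distinct es" "set es = E"
proof -
  interpret A: linear A by (rule A(1))
  have E0: "0 \<notin> E" using E(5) by force
  have ind: "independent F" if "F \<subseteq> E" for F
    using pairwise_orthogonal_independent[of F] E(4) E0 that by (meson in_mono pairwise_subset)
  have eig: "form_eigenspace V B l = span {e \<in> E. \<mu> e = l}" for l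
  proof
    show "span {e \<in> E. \<mu> e = l} \<subseteq> form_eigenspace V B l"
    proof (rule span_minimal)
      show "{e \<in> E. \<mu> e = l} \<subseteq> form_eigenspace V B l"
        using E(2) B \<mu> by (auto simp: form_eigenspace_def subset_iff)
      show "subspace (form_eigenspace V B l)"
        using V B by (auto simp: form_eigenspace_def subspace_def A.add A.scale A.zero inner_add_left algebra_simps)
    qed
    show "form_eigenspace V B l \<subseteq> span {e \<in> E. \<mu> e = l}"
    proof
      fix v assume v: "v \<in> form_eigenspace V B l"
      then have vV: "v \<in> V" by (simp add: form_eigenspace_def)
      have "A v - l *\<^sub>R v \<in> V" using vV V A(2) by (simp add: subspace_diff subspace_scale)
      moreover have "(A v - l *\<^sub>R v) \<bullet> w = 0" if "w \<in> V" for w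
        using v that B[OF vV that] by (simp add: form_eigenspace_def inner_diff_left)
      ultimately have Av: "A v = l *\<^sub>R v" by (metis inner_eq_zero_iff right_minus_eq)
      have ex: "v = (\<Sum>e\<in>E. (v \<bullet> e) *\<^sub>R e)"
        using orthonormal_basis_expand[OF E(4,5) _ E(1), of v] vV E(3) by simp
      have zero: "v \<bullet> e = 0" if e: "e \<in> E" "\<mu> e \<noteq> l" for e
      proof -
        have ee: "e' \<bullet> e = (if e' = e then 1 else 0)" if "e' \<in> E" for e'
          using that e E(4,5) by (auto simp: pairwise_def orthogonal_def norm_eq_1)
        have "A v \<bullet> e = (\<Sum>e'\<in>E. (v \<bullet> e') * \<mu> e' * (e' \<bullet> e))"
          by (subst ex) (simp add: A.sum A.scale \<mu> inner_sum_left mult.assoc)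
        also have "\<dots> = (\<Sum>e'\<in>E. if e' = e then (v \<bullet> e) * \<mu> e else 0)"
          by (rule sum.cong[OF refl]) (simp add: ee)
        also have "\<dots> = (v \<bullet> e) * \<mu> e" using E(1) e(1) by simp
        finally have "(v \<bullet> e) * (\<mu> e - l) = 0" unfolding Av by (auto simp: algebra_simps)
        then show ?thesis using e(2) by simp
      qed
      have "(\<Sum>e\<in>E. (v \<bullet> e) *\<^sub>R e) \<in> span {e \<in> E. \<mu> e = l}"
      proof (rule span_sum)
        fix e assume "e \<in> E"
        then show "(v \<bullet> e) *\<^sub>R e \<in> span {e \<in> E. \<mu> e = l}"
          using zero[of e] by (cases "\<mu> e = l") (auto intro: span_scale span_base span_zero)
      qed
      then show "v \<in> span {e \<in> E. \<mu> e = l}" using ex by simp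
    qed
  qed
  have dim: "dim (form_eigenspace V B l) = card {e \<in> E. \<mu> e = l}" for l
    unfolding eig dim_span by (rule dim_eq_card_independent[OF ind]) auto
  have set: "{l. \<exists>v\<in>form_eigenspace V B l. v \<noteq> 0} = \<mu> ` E"
  proof (intro equalityI subsetI)
    fix l assume "l \<in> {l. \<exists>v\<in>form_eigenspace V B l. v \<noteq> 0}"
    then have "{e \<in> E. \<mu> e = l} \<noteq> {}" unfolding eig by force
    then show "l \<in> \<mu> ` E" by blast
  next
    fix l assume "l \<in> \<mu> ` E"
    then obtain e where "e \<in> E" "\<mu> e = l" by blast
    then show "l \<in> {l. \<exists>v\<in>form_eigenspace V B l. v \<noteq> 0}"
      unfolding eig using E0 by (auto intro!: bexI[of _ e] span_base)
  qed
  have mset: "(\<Sum>l\<in>\<mu> ` E. replicate_mset (card {e \<in> E. \<mu> e = l}) l) = image_mset \<mu> (mset_set E)"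
  proof (rule multiset_eqI)
    fix x
    have "count (\<Sum>l\<in>\<mu> ` E. replicate_mset (card {e \<in> E. \<mu> e = l}) l) x =
        (\<Sum>l\<in>\<mu> ` E. if x = l then card {e \<in> E. \<mu> e = l} else 0)"
      by (simp add: count_sum)
    also have "\<dots> = (if x \<in> \<mu> ` E then card {e \<in> E. \<mu> e = x} else 0)"
      using E(1) by simp
    also have "\<dots> = card {e \<in> E. \<mu> e = x}"
      by (auto simp: card_eq_0_iff)
    also have "\<dots> = count (image_mset \<mu> (mset_set E)) x"
      using E(1) by (simp add: count_image_mset vimage_def Int_def conj_commute)
    finally show "count (\<Sum>l\<in>\<mu> ` E. replicate_mset (card {e \<in> E. \<mu> e = l}) l) x =
      count (image_mset \<mu> (mset_set E)) x" .
  qed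
  obtain fs where fs: "set fs = E" "distinct fs" using finite_distinct_list[OF E(1)] by blast
  have "form_eigenvalues V B = sorted_list_of_multiset (image_mset \<mu> (mset_set E))"
    unfolding form_eigenvalues_def dim set mset ..
  also have "image_mset \<mu> (mset_set E) = mset (map \<mu> fs)"
    using mset_set_set[OF fs(2)] fs(1) by simp
  also have "sorted_list_of_multiset \<dots> = map \<mu> (sort_key \<mu> fs)"
    unfolding sorted_list_of_multiset_mset
    by (rule properties_for_sort) (auto simp: mset_map)
  finally show ?thesis
    using fs by (intro that[of "sort_key \<mu> fs"]) auto
qed

lemma normalized_elem_sym_map:
  assumes "distinct es"
  shows "normalized_elem_sym k (map \<mu> es) = esym k (set es) \<mu> / real (card (set es) choose k)"
proof -
  have "esym k {..<length es} (\<mu> \<circ> nth es) = esym k (set es) \<mu>"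
    by (rule esym_reindex) (simp add: bij_betw_nth assms)
  moreover have "(\<Prod>j\<in>J. map \<mu> es ! j) = (\<Prod>j\<in>J. (\<mu> \<circ> nth es) j)" if "J \<subseteq> {..<length es}" for J
    using that by (intro prod.cong) auto
  ultimately show ?thesis
    using distinct_card[OF assms] by (simp add: normalized_elem_sym_def esym_def cong: conj_cong)
qed

section \<open>Outer normals of smooth convex hypersurfaces\<close>

lemma has_derivative_at_remainder:
  fixes F :: "'a::real_normed_vector \<Rightarrow> 'b::real_normed_vector"
  assumes "(F has_derivative D) (at p)" "0 < e"
  obtains d where "0 < d" "\<And>y. norm y < d \<Longrightarrow> norm (F (p + y) - F p - D y) \<le> e * norm y"
proof -
  obtain d where "d > 0" "\<And>y. norm (y - p) < d \<Longrightarrow> norm (F y - F p - D (y - p)) \<le> e * norm (y - p)"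
    using assms unfolding has_derivative_at_alt by blast
  then show ?thesis using that[of d] by (metis add_diff_cancel_left')
qed

text \<open>The derivative along a regular level set is determined on tangent vectors \<open>v\<close>: by the
  intermediate value theorem in the direction of the gradient, the level set contains points
  \<open>p + t v + s g\<close> with \<open>s = o(t)\<close>.\<close>

lemma has_derivative_within_level_set_unique:
  fixes F :: "'a::euclidean_space \<Rightarrow> real" and f :: "'a \<Rightarrow> 'b::real_normed_vector"
  assumes U: "open U" "p \<in> U" "continuous_on U F"
    and F: "(F has_derivative (\<lambda>v. g \<bullet> v)) (at p)" "F p = 0" "g \<noteq> 0"
    and M: "\<And>x. x \<in> U \<Longrightarrow> F x = 0 \<Longrightarrow> x \<in> M"
    and L: "(f has_derivative L1) (at p within M)" "(f has_derivative L2) (at p within M)"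
    and v: "g \<bullet> v = 0"
  shows "L1 v = L2 v"
proof -
  define L where "L v = L1 v - L2 v" for v
  have "((\<lambda>x. f x - f x) has_derivative L) (at p within M)"
    unfolding L_def by (rule has_derivative_diff[OF L])
  then have D: "((\<lambda>x. 0) has_derivative L) (at p within M)" by simp
  interpret L: linear L by (rule has_derivative_linear[OF D])
  have "norm (L v) \<le> e * (norm v + norm g + norm (L g))" if e: "0 < e" "e < 1" for e
  proof -
    define r where "r = norm v + norm g"
    have r: "r > 0" using F(3) by (simp add: r_def add_nonneg_pos)
    obtain d1 where d1: "d1 > 0" "\<And>y. y \<in> M \<Longrightarrow> norm (y - p) < d1 \<Longrightarrow> norm (L (y - p)) \<le> e * norm (y - p)"
      using D e(1) unfolding has_derivative_within_alt by auto
    \<comment> \<open>Within distance t r this tolerance keeps the linearization error of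
      \<open>F\<close> to at most half of e t |g|^2, the amount that a shift by \<open>e * t\<close>
      along \<open>g\<close> contributes; so \<open>F\<close> changes sign between s = - e t and s =
      e t.\<close>
    have "0 < e * (norm g)\<^sup>2 / (2 * r)" using e F(3) r by simp
    then obtain d2 where d2: "d2 > 0" "\<And>y. norm y < d2 \<Longrightarrow>
        \<bar>F (p + y) - g \<bullet> y\<bar> \<le> (e * (norm g)\<^sup>2 / (2 * r)) * norm y"
      using has_derivative_at_remainder[OF F(1)] F(2) by (metis diff_0_right real_norm_def)
    obtain d3 where d3: "d3 > 0" "ball p d3 \<subseteq> U" using U openE by blast
    define t where "t = min d1 (min d2 d3) / (2 * r)"
    have t: "t > 0" using d1 d2 d3 r by (simp add: t_def)
    have tr: "t * r < d1" "t * r < d2" "t * r < d3" using d1 d2 d3 r by (auto simp: t_def)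
    define y where "y s = t *\<^sub>R v + s *\<^sub>R g" for s
    have ny: "norm (y s) \<le> t * r" if "\<bar>s\<bar> \<le> e * t" for s
    proof -
      have "norm (y s) \<le> t * norm v + \<bar>s\<bar> * norm g"
        unfolding y_def using t by (metis abs_of_pos norm_scaleR norm_triangle_ineq)
      also have "\<bar>s\<bar> * norm g \<le> t * norm g"
        using that e t by (intro mult_right_mono) (auto intro: order_trans[OF _ mult_left_le_one_le])
      finally show ?thesis by (simp add: r_def algebra_simps)
    qed
    have close: "\<bar>F (p + y s) - s * (norm g)\<^sup>2\<bar> \<le> e * t * (norm g)\<^sup>2 / 2" if "\<bar>s\<bar> \<le> e * t" for s
    proof -
      have "\<bar>F (p + y s) - g \<bullet> y s\<bar> \<le> (e * (norm g)\<^sup>2 / (2 * r)) * norm (y s)"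
        using ny[OF that] tr by (intro d2(2)) simp
      also have "\<dots> \<le> (e * (norm g)\<^sup>2 / (2 * r)) * (t * r)"
        using ny[OF that] e r by (intro mult_left_mono) auto
      also have "\<dots> = e * t * (norm g)\<^sup>2 / 2" using r by (simp add: field_simps)
      also have "g \<bullet> y s = s * (norm g)\<^sup>2"
        by (simp add: y_def inner_add_right v dot_square_norm)
      finally show ?thesis .
    qed
    have pos: "0 < e * t * (norm g)\<^sup>2" using e t F(3) by simp
    have et: "0 < e * t" using e t by simp
    have "continuous_on {- (e * t)..e * t} (\<lambda>s. F (p + y s))"
    proof (rule continuous_on_compose2[OF U(3)])
      show "continuous_on {- (e * t)..e * t} (\<lambda>s. p + y s)"
        unfolding y_def by (intro continuous_intros)
      show "(\<lambda>s. p + y s) ` {- (e * t)..e * t} \<subseteq> U"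
        using ny tr(3) by (intro order_trans[OF _ d3(2)]) (force simp: dist_norm abs_le_iff)
    qed
    moreover have "F (p + y (- (e * t))) \<le> 0" "0 \<le> F (p + y (e * t))"
    proof -
      have "\<bar>F (p + y (- (e * t))) + e * t * (norm g)\<^sup>2\<bar> \<le> e * t * (norm g)\<^sup>2 / 2"
        "\<bar>F (p + y (e * t)) - e * t * (norm g)\<^sup>2\<bar> \<le> e * t * (norm g)\<^sup>2 / 2"
        using close[of "- (e * t)"] close[of "e * t"] et by simp_all
      then show "F (p + y (- (e * t))) \<le> 0" "0 \<le> F (p + y (e * t))"
        using pos by linarith+
    qed
    ultimately obtain s where s: "- (e * t) \<le> s" "s \<le> e * t" "F (p + y s) = 0"
      using IVT'[of "\<lambda>s. F (p + y s)" "- (e * t)" 0 "e * t"] et by auto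
    then have s': "\<bar>s\<bar> \<le> e * t" by (simp add: abs_le_iff)
    have "p + y s \<in> U" using ny[OF s'] tr(3) d3(2) by (auto simp: dist_norm intro!: subsetD[OF d3(2)])
    then have "norm (L (y s)) \<le> e * norm (y s)"
      using d1(2)[of "p + y s"] M s(3) ny[OF s'] tr(1) by simp
    also have "\<dots> \<le> e * (t * r)" using ny[OF s'] e by simp
    finally have 1: "norm (L (y s)) \<le> t * (e * r)" by (simp add: mult_ac)
    have "t * norm (L v) = norm (L (y s) - s *\<^sub>R L g)"
      using t by (simp add: y_def L.add L.scale)
    also have "\<dots> \<le> norm (L (y s)) + \<bar>s\<bar> * norm (L g)"
      by (metis norm_scaleR norm_triangle_ineq4)
    also have "\<dots> \<le> t * (e * r) + (e * t) * norm (L g)"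
      by (intro add_mono 1 mult_right_mono s') auto
    finally have "t * norm (L v) \<le> t * (e * (r + norm (L g)))" by (simp add: algebra_simps)
    then show ?thesis using t by (simp add: r_def)
  qed note bound = this
  define C where "C = norm v + norm g + norm (L g)"
  have C: "C \<ge> 0" by (simp add: C_def)
  have "norm (L v) \<le> 0 + e" if "e > 0" for e
  proof -
    define e' where "e' = min (1/2) (e / (C + 1))"
    have "e' > 0" "e' < 1" "e' \<le> e / (C + 1)"
      using that C by (auto simp: e'_def)
    then have "e' * (C + 1) \<le> e" using C by (simp add: pos_le_divide_eq)
    have "norm (L v) \<le> e' * C"
      using bound[OF \<open>e' > 0\<close> \<open>e' < 1\<close>] by (simp add: C_def)
    also have "\<dots> \<le> e' * (C + 1)" using \<open>e' > 0\<close> by (intro mult_left_mono) auto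
    finally show ?thesis using \<open>e' * (C + 1) \<le> e\<close> by simp
  qed
  then have "norm (L v) \<le> 0" by (rule field_le_epsilon)
  then show ?thesis by (simp add: L_def)
qed

text \<open>Unnormalized, so that normals range over an open subset of the ambient space, on which
  support points can be differentiated.\<close>

definition outer_normal :: "'a::euclidean_space set \<Rightarrow> 'a \<Rightarrow> 'a \<Rightarrow> bool" where
  "outer_normal K p \<nu> \<longleftrightarrow> \<nu> \<noteq> 0 \<and> (\<forall>x\<in>K. (x - p) \<bullet> \<nu> \<le> 0)"

lemma outer_normal_scaleR: "outer_normal K p \<nu> \<Longrightarrow> 0 < c \<Longrightarrow> outer_normal K p (c *\<^sub>R \<nu>)"
  by (simp add: outer_normal_def mult_le_0_iff)

lemma outer_normal_exists:
  fixes K :: "'a::euclidean_space set"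
  assumes "convex K" "closed K" "interior K \<noteq> {}" "p \<in> frontier K"
  obtains \<nu> where "outer_normal K p \<nu>"
proof -
  have "p \<in> K" "p \<notin> rel_interior K"
    using assms by (auto simp: frontier_def rel_interior_nonempty_interior)
  then obtain a where "a \<noteq> 0" "\<And>y. y \<in> K \<Longrightarrow> a \<bullet> p \<le> a \<bullet> y"
    using supporting_hyperplane_rel_boundary[OF assms(1)] by metis
  then have "outer_normal K p (- a)"
    by (auto simp: outer_normal_def inner_diff_left inner_diff_right inner_commute)
  then show ?thesis by (rule that)
qed

lemma outer_normal_pos:
  fixes K :: "'a::euclidean_space set"
  assumes "0 \<in> interior K" "outer_normal K p \<nu>"
  shows "0 < \<nu> \<bullet> p"
proof -
  obtain e where e: "e > 0" "ball 0 e \<subseteq> K"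
    using assms(1) by (metis mem_interior)
  let ?x = "(e / (2 * norm \<nu>)) *\<^sub>R \<nu>"
  have "\<nu> \<noteq> 0" using assms(2) by (simp add: outer_normal_def)
  then have "?x \<in> K" using e by (intro subsetD[OF e(2)]) simp
  then have "(?x - p) \<bullet> \<nu> \<le> 0" using assms(2) by (simp add: outer_normal_def)
  moreover have "?x \<bullet> \<nu> > 0" using \<open>\<nu> \<noteq> 0\<close> e(1) by simp
  ultimately show ?thesis unfolding inner_diff_left inner_commute[of \<nu> p] by linarith
qed

text \<open>If a direction \<open>v\<close> on the inner side of the tangent plane had
  \<open>\<nu> \<bullet> v > 0\<close>, then p + t v would lie outside \<open>K\<close>, while p + t
  v0, toward an interior point, lies inside. The segment between them meets the frontier, where
  \<open>F\<close> is 0, although to first order \<open>F\<close> stays away from 0 along it. So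
  \<open>\<nu>\<close> is nonpositive on an open half-space, which makes it a multiple of
  \<open>g\<close>.\<close>

lemma outer_normal_parallel_gradient:
  fixes K :: "'a::euclidean_space set" and F :: "'a \<Rightarrow> real"
  assumes K: "convex K" "interior K \<noteq> {}" "p \<in> frontier K"
    and U: "open U" "p \<in> U"
    and F: "(F has_derivative (\<lambda>v. g \<bullet> v)) (at p)" "g \<noteq> 0"
    and KU: "frontier K \<inter> U = {x \<in> U. F x = 0}"
    and \<nu>: "outer_normal K p \<nu>"
  shows "\<exists>c. \<nu> = c *\<^sub>R g"
proof -
  have Fp: "F p = 0" using KU K(3) U(2) by blast
  obtain q where q: "q \<in> interior K" "g \<bullet> (q - p) \<noteq> 0"
  proof -
    obtain q0 where q0: "q0 \<in> interior K" using K(2) by blast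
    then obtain e where e: "e > 0" "ball q0 e \<subseteq> interior K" using open_interior openE by blast
    let ?q = "q0 + (e / (2 * norm g)) *\<^sub>R g"
    have "?q \<in> interior K" using e F(2) by (intro subsetD[OF e(2)]) (simp add: dist_norm)
    moreover have "g \<bullet> (?q - p) \<noteq> 0 \<or> g \<bullet> (q0 - p) \<noteq> 0"
      using e F(2) by (auto simp: inner_diff_right inner_add_right)
    ultimately show ?thesis using q0 that by blast
  qed
  \<comment> \<open>The sign makes \<open>g0\<close> point to the side of the interior point
    \<open>q\<close>.\<close>
  define g0 where "g0 = sgn (g \<bullet> (q - p)) *\<^sub>R g"
  have sg: "\<bar>sgn (g \<bullet> (q - p))\<bar> = 1" using q(2) by (simp add: sgn_if)
  define v0 where "v0 = q - p"
  have g0v0: "g0 \<bullet> v0 > 0" using q(2) by (auto simp: g0_def v0_def sgn_if)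
  have absg: "\<bar>g0 \<bullet> w\<bar> = \<bar>g \<bullet> w\<bar>" for w using sg by (simp add: g0_def abs_mult)
  have half: "\<nu> \<bullet> v \<le> 0" if v: "g0 \<bullet> v > 0" for v
  proof (rule ccontr)
    assume "\<not> \<nu> \<bullet> v \<le> 0"
    then have \<nu>v: "\<nu> \<bullet> v > 0" by simp
    define m where "m = min (g0 \<bullet> v0) (g0 \<bullet> v)"
    define r where "r = norm v0 + norm v"
    have m: "m > 0" using v g0v0 by (simp add: m_def)
    have "v \<noteq> 0" using v by auto
    then have r: "r > 0" by (simp add: r_def add_nonneg_pos)
    obtain d1 where d1: "d1 > 0" "\<And>y. norm y < d1 \<Longrightarrow> \<bar>F (p + y) - g \<bullet> y\<bar> \<le> (m / (2 * r)) * norm y"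
      using has_derivative_at_remainder[OF F(1), of "m / (2 * r)"] m r Fp
      by (metis diff_0_right real_norm_def divide_pos_pos mult_pos_pos zero_less_numeral)
    obtain d2 where d2: "d2 > 0" "ball p d2 \<subseteq> U" using U openE by blast
    define t where "t = min 1 (min d1 d2 / (2 * r))"
    have t: "0 < t" "t \<le> 1" using d1 d2 r by (auto simp: t_def)
    have "t * r \<le> (min d1 d2 / (2 * r)) * r"
      using r by (intro mult_right_mono) (auto simp: t_def)
    then have "t * r \<le> min d1 d2 / 2" using r by simp
    then have tr: "t * r < d1" "t * r < d2" using d1 d2 by linarith+
    let ?C = "closed_segment (p + t *\<^sub>R v0) (p + t *\<^sub>R v)"
    have "p - t *\<^sub>R (p - q) \<in> interior K"
      using K(1,3) q(1) t by (intro mem_interior_closure_convex_shrink) (auto simp: frontier_def)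
    moreover have "p - t *\<^sub>R (p - q) = p + t *\<^sub>R v0" by (simp add: v0_def algebra_simps)
    ultimately have "p + t *\<^sub>R v0 \<in> K" using interior_subset by auto
    then have "?C \<inter> K \<noteq> {}" using ends_in_segment(1) by blast
    moreover have "p + t *\<^sub>R v \<notin> K"
    proof
      assume "p + t *\<^sub>R v \<in> K"
      then have "(p + t *\<^sub>R v - p) \<bullet> \<nu> \<le> 0" using \<nu> unfolding outer_normal_def by blast
      then have "t * (\<nu> \<bullet> v) \<le> 0" by (simp add: inner_commute)
      then show False using t \<nu>v by (simp add: mult_le_0_iff)
    qed
    then have "?C - K \<noteq> {}" using ends_in_segment(2) by blast
    ultimately have "?C \<inter> frontier K \<noteq> {}"
      by (intro connected_Int_frontier connected_segment)
    then obtain x where x: "x \<in> ?C" "x \<in> frontier K" by blast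
    obtain s where s: "0 \<le> s" "s \<le> 1" and xs: "x = (1 - s) *\<^sub>R (p + t *\<^sub>R v0) + s *\<^sub>R (p + t *\<^sub>R v)"
      using x(1) by (auto simp: in_segment)
    define w where "w = (1 - s) *\<^sub>R v0 + s *\<^sub>R v"
    have xw: "x = p + t *\<^sub>R w" unfolding xs w_def by (simp add: algebra_simps)
    have "norm w \<le> (1 - s) * norm v0 + s * norm v"
      unfolding w_def using s by (metis abs_of_nonneg diff_ge_0_iff_ge norm_scaleR norm_triangle_ineq)
    also have "\<dots> \<le> 1 * norm v0 + 1 * norm v" using s by (intro add_mono mult_right_mono) auto
    finally have nw: "norm w \<le> r" by (simp add: r_def)
    have ntw: "norm (t *\<^sub>R w) \<le> t * r" using nw t by simp
    have xU: "x \<in> U" unfolding xw using ntw tr by (intro subsetD[OF d2(2)]) (simp add: dist_norm)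
    then have "F x = 0" using KU x(2) by blast
    then have "\<bar>g \<bullet> (t *\<^sub>R w)\<bar> \<le> (m / (2 * r)) * norm (t *\<^sub>R w)"
      using d1(2)[of "t *\<^sub>R w"] ntw tr(1) by (simp add: xw)
    also have "\<dots> \<le> (m / (2 * r)) * (t * r)" using ntw m r by (intro mult_left_mono) auto
    also have "\<dots> = t * (m / 2)" using r by simp
    finally have "\<bar>g0 \<bullet> w\<bar> \<le> m / 2"
      using t absg[of w] by (simp add: abs_mult)
    moreover have "m \<le> g0 \<bullet> w"
    proof -
      have "m = (1 - s) * m + s * m" by (simp add: algebra_simps)
      also have "\<dots> \<le> (1 - s) * (g0 \<bullet> v0) + s * (g0 \<bullet> v)"
        using s by (intro add_mono mult_left_mono) (auto simp: m_def)
      finally show ?thesis by (simp add: w_def inner_add_right)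
    qed
    ultimately show False using m by linarith
  qed
  have g0: "g0 \<bullet> g0 > 0" using g0v0 by auto
  define a where "a = (\<nu> \<bullet> g0) / (g0 \<bullet> g0)"
  define w where "w = \<nu> - a *\<^sub>R g0"
  have wg: "w \<bullet> g0 = 0" using g0 by (simp add: w_def a_def inner_diff_left)
  have "w = 0"
  proof (rule ccontr)
    assume "w \<noteq> 0"
    then have ww: "w \<bullet> w > 0" by simp
    \<comment> \<open>Moving by \<open>t\<close> along the component \<open>w\<close> of
      \<open>\<nu>\<close> orthogonal to \<open>g0\<close> stays in the half-space, but makes the
      inner product with \<open>\<nu>\<close> positive.\<close>
    define t where "t = (1 + \<bar>\<nu> \<bullet> g0\<bar>) / (w \<bullet> w)"
    have "g0 \<bullet> (g0 + t *\<^sub>R w) > 0" using g0 wg by (simp add: inner_add_right inner_commute)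
    then have "\<nu> \<bullet> (g0 + t *\<^sub>R w) \<le> 0" by (rule half)
    moreover have "\<nu> \<bullet> w = w \<bullet> w"
      using wg by (simp add: w_def inner_diff_left inner_commute)
    ultimately have "\<nu> \<bullet> g0 + (1 + \<bar>\<nu> \<bullet> g0\<bar>) \<le> 0"
      using ww by (simp add: inner_add_right t_def)
    then show False by linarith
  qed
  then have "\<nu> = (a * sgn (g \<bullet> (q - p))) *\<^sub>R g" by (simp add: w_def g0_def)
  then show ?thesis by blast
qed

text \<open>Three derivatives of the defining function are kept, as many as make the Hessian of the
  support function C1. The last clause orients the gradient outward, because an outer normal has
  positive inner product with its base point when the origin is interior.\<close>

definition defining_chart ::
  "'a::euclidean_space set \<Rightarrow> 'a set \<Rightarrow> ('a \<Rightarrow> real) \<Rightarrow> ('a \<Rightarrow> 'a) \<Rightarrow> ('a \<Rightarrow> 'a \<Rightarrow>\<^sub>L 'a) \<Rightarrow> bool" where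
  "defining_chart M U F g Dg \<longleftrightarrow> open U \<and>
     (\<forall>x\<in>U. (F has_derivative (\<lambda>v. g x \<bullet> v)) (at x)) \<and>
     (\<forall>x\<in>U. (g has_derivative Dg x) (at x)) \<and> C1_on U Dg \<and>
     M \<inter> U = {x \<in> U. F x = 0} \<and> (\<forall>x\<in>U. 0 < g x \<bullet> x)"

lemma gradient_representation:
  fixes F :: "'a::euclidean_space \<Rightarrow> real"
  assumes "(F has_derivative F') (at x)"
  shows "(F has_derivative (\<lambda>v. (\<Sum>b\<in>Basis. F' b *\<^sub>R b) \<bullet> v)) (at x)"
proof -
  have lin: "linear F'" using assms has_derivative_linear by blast
  have "F' v = (\<Sum>b\<in>Basis. F' b *\<^sub>R b) \<bullet> v" for v
  proof -
    have "F' v = F' (\<Sum>b\<in>Basis. (v \<bullet> b) *\<^sub>R b)" by (simp add: euclidean_representation)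
    also have "\<dots> = (\<Sum>b\<in>Basis. F' b *\<^sub>R b) \<bullet> v"
      unfolding linear_sum[OF lin] linear_scale[OF lin]
      by (simp add: inner_sum_left inner_commute[of v] mult.commute)
    finally show ?thesis .
  qed
  then have "F' = (\<lambda>v. (\<Sum>b\<in>Basis. F' b *\<^sub>R b) \<bullet> v)" by (rule ext)
  then show ?thesis by (rule has_derivative_eq_rhs[OF assms])
qed

lemma smooth_strictly_convexD:
  assumes "smooth_strictly_convex M K"
  shows "convex K" "closed K" "compact K" "interior K \<noteq> {}" "0 \<in> interior K" "M = frontier K" "M \<subseteq> K"
proof -
  show K: "convex K" "compact K" "interior K \<noteq> {}" "0 \<in> interior K" "M = frontier K"
    using assms by (auto simp: smooth_strictly_convex_def convex_body_def)
  then show "closed K" by (simp add: compact_imp_closed)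
  then show "M \<subseteq> K" using K(5) by (simp add: frontier_subset_closed)
qed

lemma defining_chart_exists:
  fixes M :: "'a::euclidean_space set"
  assumes sc: "smooth_strictly_convex M K" and p: "p \<in> M"
  obtains U F g Dg where "defining_chart M U F g Dg" "p \<in> U"
proof -
  note K = smooth_strictly_convexD[OF sc]
  have "smooth_hypersurface M" using sc unfolding smooth_strictly_convex_def by blast
  then have "\<exists>U (F :: 'a \<Rightarrow> real). open U \<and> p \<in> U \<and> smooth_on U F \<and> M \<inter> U = {x\<in>U. F x = 0} \<and>
      (\<forall>x\<in>M \<inter> U. \<exists>v. frechet_derivative F (at x) v \<noteq> 0)"
    unfolding smooth_hypersurface_def using p by (rule bspec)
  then obtain U and F :: "'a \<Rightarrow> real" where UF: "open U \<and> p \<in> U \<and> smooth_on U F \<and>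
      M \<inter> U = {x\<in>U. F x = 0} \<and> (\<forall>x\<in>M \<inter> U. \<exists>v. frechet_derivative F (at x) v \<noteq> 0)"
    by (elim exE)
  then have U: "open U" "p \<in> U" and smooth: "smooth_on U F" and MU: "M \<inter> U = {x \<in> U. F x = 0}"
    by blast+
  have reg: "\<exists>v. frechet_derivative F (at x) v \<noteq> 0" if "x \<in> M \<inter> U" for x
    using UF that by blast
  have C3: "Ck_on (Suc (Suc (Suc 0))) U F" using smooth unfolding smooth_on_def by blast
  let ?dF = "\<lambda>x. frechet_derivative F (at x)"
  let ?ddF = "\<lambda>b x. frechet_derivative (\<lambda>y. ?dF y b) (at x)"
  have F': "(F has_derivative ?dF x) (at x)" if "x \<in> U" for x
    using C3 that by (simp add: frechet_derivative_works)
  have F'': "((\<lambda>y. ?dF y b) has_derivative ?ddF b x) (at x)" if "x \<in> U" for x b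
    using C3 that by (simp add: frechet_derivative_works)
  have C1: "C1_on U (\<lambda>x. ?ddF b x v)" for b v
    using C3 by simp
  define g where "g x = (\<Sum>b\<in>Basis. ?dF x b *\<^sub>R b)" for x
  define D where "D x = Blinfun (\<lambda>v. \<Sum>b\<in>Basis. ?ddF b x v *\<^sub>R b)" for x
  have Fg: "(F has_derivative (\<lambda>v. g x \<bullet> v)) (at x)" if "x \<in> U" for x
    unfolding g_def by (rule gradient_representation[OF F'[OF that]])
  have g': "(g has_derivative (\<lambda>v. \<Sum>b\<in>Basis. ?ddF b x v *\<^sub>R b)) (at x)" if "x \<in> U" for x
    unfolding g_def by (intro has_derivative_sum has_derivative_scaleR_left F'' that)
  have D: "blinfun_apply (D x) = (\<lambda>v. \<Sum>b\<in>Basis. ?ddF b x v *\<^sub>R b)" if "x \<in> U" for x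
    unfolding D_def using g'[OF that] by (intro bounded_linear_Blinfun_apply has_derivative_bounded_linear)
  have gD: "(g has_derivative D x) (at x)" if "x \<in> U" for x
    using g'[OF that] D[OF that] by simp
  have C1D: "C1_on U D"
  proof (rule C1_on_blinfunI)
    show "C1_on U (\<lambda>x. D x v)" for v
    proof (rule C1_on_cong[OF U(1)])
      show "C1_on U (\<lambda>x. \<Sum>b\<in>Basis. ?ddF b x v *\<^sub>R b)"
        by (intro C1_on_sum C1_on_scaleR C1 C1_on_const)
    qed (simp add: D)
  qed
  have contg: "continuous_on U g"
    by (meson gD has_derivative_continuous continuous_at_imp_continuous_on)
  have g0: "g p \<noteq> 0"
  proof
    assume "g p = 0"
    then have "?dF p = (\<lambda>v. 0)"
      using has_derivative_unique[OF F'[OF U(2)] Fg[OF U(2)]] by simp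
    then show False using reg[of p] p U(2) by simp
  qed
  obtain \<nu> where \<nu>: "outer_normal K p \<nu>"
    using outer_normal_exists K p by metis
  then obtain c where c: "\<nu> = c *\<^sub>R g p"
    using outer_normal_parallel_gradient[OF K(1,4) _ U Fg[OF U(2)] g0 _ \<nu>] K(6) p MU by blast
  have "0 < \<nu> \<bullet> p" by (rule outer_normal_pos[OF K(5) \<nu>])
  then have gp: "g p \<bullet> p \<noteq> 0" using c by auto
  \<comment> \<open>An outer normal at \<open>p\<close> has positive inner product with
    \<open>p\<close> and is a multiple of \<open>g p\<close>; so this sign is nonzero, and
    multiplying \<open>F\<close> by it orients the gradient outward.\<close>
  define s where "s = sgn (g p \<bullet> p)"
  have s: "s \<noteq> 0" "0 < s * (g p \<bullet> p)" using gp by (auto simp: s_def sgn_if)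
  define U' where "U' = U \<inter> (\<lambda>x. s * (g x \<bullet> x)) -` {0<..}"
  have "defining_chart M U' (\<lambda>x. s * F x) (\<lambda>x. s *\<^sub>R g x) (\<lambda>x. s *\<^sub>R D x)"
    unfolding defining_chart_def
  proof (intro conjI ballI)
    show "open U'"
      unfolding U'_def by (intro continuous_open_preimage U(1) continuous_intros contg)
    show "((\<lambda>x. s * F x) has_derivative (\<lambda>v. (s *\<^sub>R g x) \<bullet> v)) (at x)" if "x \<in> U'" for x
      using has_derivative_mult_right[OF Fg, of x s] that by (simp add: U'_def)
    show "((\<lambda>x. s *\<^sub>R g x) has_derivative blinfun_apply (s *\<^sub>R D x)) (at x)" if "x \<in> U'" for x
      using has_derivative_scaleR_right[OF gD, of x s] that
      by (simp add: U'_def blinfun.scaleR_left[abs_def] scaleR_blinfun.rep_eq)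
    show "C1_on U' (\<lambda>x. s *\<^sub>R D x)"
      by (rule C1_on_scaleR[OF C1_on_const C1_on_subset[OF C1D]]) (auto simp: U'_def)
    show "M \<inter> U' = {x \<in> U'. s * F x = 0}"
      using MU s(1) by (auto simp: U'_def)
    show "0 < (s *\<^sub>R g x) \<bullet> x" if "x \<in> U'" for x
      using that by (simp add: U'_def)
  qed
  moreover have "p \<in> U'" using U(2) s(2) by (simp add: U'_def)
  ultimately show ?thesis by (rule that)
qed

lemma chart_outer_normal_iff:
  assumes sc: "smooth_strictly_convex M K" and ch: "defining_chart M U F g Dg" and x: "x \<in> M \<inter> U"
  shows "outer_normal K x \<nu> \<longleftrightarrow> (\<exists>c>0. \<nu> = c *\<^sub>R g x)"
proof -
  note K = smooth_strictly_convexD[OF sc]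
  have gx: "0 < g x \<bullet> x" using ch x by (simp add: defining_chart_def)
  have pos: "\<exists>c>0. \<nu> = c *\<^sub>R g x" if \<nu>: "outer_normal K x \<nu>" for \<nu>
  proof -
    have "\<exists>c. \<nu> = c *\<^sub>R g x"
      by (rule outer_normal_parallel_gradient[OF K(1,4) _ _ _ _ _ _ \<nu>, where U = U and F = F])
         (use ch x K(6) gx in \<open>auto simp: defining_chart_def\<close>)
    then obtain c where c: "\<nu> = c *\<^sub>R g x" by blast
    have "0 < c * (g x \<bullet> x)" using outer_normal_pos[OF K(5) \<nu>] c by simp
    then have "c > 0" using gx by (simp add: zero_less_mult_iff)
    then show ?thesis using c by blast
  qed
  obtain \<nu>0 where \<nu>0: "outer_normal K x \<nu>0" using outer_normal_exists K x by (metis IntD1)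
  then obtain c0 where c0: "c0 > 0" "\<nu>0 = c0 *\<^sub>R g x" using pos by blast
  have "g x = (1 / c0) *\<^sub>R \<nu>0" using c0 by simp
  then have "outer_normal K x (g x)" using outer_normal_scaleR[OF \<nu>0, of "1 / c0"] c0(1) by simp
  then show ?thesis using pos outer_normal_scaleR by blast
qed

lemma chart_gauss_map:
  assumes sc: "smooth_strictly_convex M K" and ch: "defining_chart M U F g Dg" and x: "x \<in> M \<inter> U"
  shows "gauss_map K x = (1 / norm (g x)) *\<^sub>R g x"
  unfolding gauss_map_def
proof (rule the_equality)
  have gx: "g x \<noteq> 0" using ch x by (force simp: defining_chart_def)
  have "outer_normal K x ((1 / norm (g x)) *\<^sub>R g x)"
    using chart_outer_normal_iff[OF sc ch x] gx by force
  then show "norm ((1 / norm (g x)) *\<^sub>R g x) = 1 \<and> (\<forall>y\<in>K. (y - x) \<bullet> ((1 / norm (g x)) *\<^sub>R g x) \<le> 0)"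
    using gx unfolding outer_normal_def by simp
  fix \<nu> assume \<nu>: "norm \<nu> = 1 \<and> (\<forall>y\<in>K. (y - x) \<bullet> \<nu> \<le> 0)"
  then have "outer_normal K x \<nu>" by (auto simp: outer_normal_def)
  then obtain c where c: "c > 0" "\<nu> = c *\<^sub>R g x" using chart_outer_normal_iff[OF sc ch x] by blast
  have "c * norm (g x) = 1" using \<nu> c by simp
  then have "c = 1 / norm (g x)" using gx by (simp add: field_simps)
  then show "\<nu> = (1 / norm (g x)) *\<^sub>R g x" using c by simp
qed

lemma chart_hessian_symmetric:
  assumes ch: "defining_chart M U F g Dg" and x: "x \<in> U"
  shows "Dg x v \<bullet> w = Dg x w \<bullet> v"
proof -
  have "((\<lambda>y. g y \<bullet> u) has_derivative (\<lambda>h. Dg x h \<bullet> u)) (at x)" for u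
    using ch x by (intro has_derivative_inner_left) (auto simp: defining_chart_def)
  from second_derivative_symmetric[of U x F "\<lambda>y v. g y \<bullet> v" v "\<lambda>u h. Dg x h \<bullet> u" w, OF _ x _ this this]
  show ?thesis using ch by (auto simp: defining_chart_def)
qed

text \<open>The Gauss curvature is the product of the eigenvalues of \<open>A\<close>, the
  tangential part of \<open>Dg p\<close> divided by the length of the gradient. A positive product
  excludes the eigenvalue 0, so the Hessian of \<open>F\<close> is nondegenerate on the tangent
  space.\<close>

lemma chart_nondegenerate:
  assumes sc: "smooth_strictly_convex M K" and ch: "defining_chart M U F g Dg" and p: "p \<in> M \<inter> U"
    and v: "g p \<bullet> v = 0" and Dv: "\<And>w. g p \<bullet> w = 0 \<Longrightarrow> Dg p v \<bullet> w = 0"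
  shows "v = 0"
proof -
  note K = smooth_strictly_convexD[OF sc]
  have gp: "g p \<noteq> 0" using ch p by (force simp: defining_chart_def)
  have U: "open U" "p \<in> U" using ch p by (auto simp: defining_chart_def)
  have gD: "(g has_derivative Dg p) (at p)" using ch p by (auto simp: defining_chart_def)
  have FD: "(F has_derivative (\<lambda>v. g x \<bullet> v)) (at x)" if "x \<in> U" for x
    using ch that by (auto simp: defining_chart_def)
  have MU: "x \<in> M \<longleftrightarrow> F x = 0" if "x \<in> U" for x
    using ch that by (auto simp: defining_chart_def)
  let ?r = "1 / norm (g p)"
  have "(\<lambda>x. norm (g x)) differentiable (at p)"
    using differentiable_chain_at[of g p norm] gD gp differentiable_norm_at[of "g p"]
    by (auto simp: o_def differentiable_def)
  then have "(\<lambda>x. 1 / norm (g x)) differentiable (at p)"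
    using gp by (intro differentiable_divide differentiable_const) auto
  then obtain r' where r': "((\<lambda>x. 1 / norm (g x)) has_derivative r') (at p)"
    by (auto simp: differentiable_def)
  let ?DN = "\<lambda>v. ?r *\<^sub>R Dg p v + r' v *\<^sub>R g p"
  have N: "((\<lambda>x. (1 / norm (g x)) *\<^sub>R g x) has_derivative ?DN) (at p within M)"
    by (rule has_derivative_at_withinI[OF has_derivative_scaleR[OF r' gD]])
  have G: "(gauss_map K has_derivative ?DN) (at p within M)"
  proof -
    obtain e where e: "e > 0" "ball p e \<subseteq> U" using U openE by blast
    show ?thesis
    proof (rule has_derivative_transform_within[OF N e(1)])
      show "p \<in> M" using p by simp
      fix x assume "x \<in> M" "dist x p < e"
      then show "(1 / norm (g x)) *\<^sub>R g x = gauss_map K x"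
        using chart_gauss_map[OF sc ch, of x] e(2) by (auto simp: dist_commute)
    qed
  qed
  define D where "D = frechet_derivative (gauss_map K) (at p within M)"
  have D: "(gauss_map K has_derivative D) (at p within M)"
    unfolding D_def using G by (auto simp: differentiable_def simp flip: frechet_derivative_works)
  have contF: "continuous_on U F"
    by (meson FD has_derivative_continuous continuous_at_imp_continuous_on)
  define V where "V = {v. g p \<bullet> v = 0}"
  have V: "subspace V" by (auto simp: V_def subspace_def inner_add_right)
  \<comment> \<open>A derivative within \<open>M\<close> is not determined in the normal direction,
    but on tangent vectors the chosen one must agree with that of the normalized gradient.\<close>
  have DV: "D v = ?DN v" if "v \<in> V" for v
    by (rule has_derivative_within_level_set_unique[OF U contF FD[OF U(2)] _ gp _ D G])
       (use that MU p in \<open>auto simp: V_def\<close>)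
  have Vgauss: "{v. gauss_map K p \<bullet> v = 0} = V"
    using gp by (auto simp: chart_gauss_map[OF sc ch p] V_def)
  define A where "A v = ?r *\<^sub>R (Dg p v - ((Dg p v \<bullet> g p) / (g p \<bullet> g p)) *\<^sub>R g p)" for v
  have linA: "linear A"
    unfolding A_def
    by (rule linearI) (simp_all add: blinfun.add_right blinfun.scaleR_right inner_add_left
        scaleR_add_right scaleR_diff_right add_divide_distrib scaleR_add_left algebra_simps)
  have AV: "A v \<in> V" for v
    using gp by (simp add: V_def A_def inner_diff_right inner_commute)
  have Aw: "A v \<bullet> w = ?r * (Dg p v \<bullet> w)" if "w \<in> V" for v w
    using that by (simp add: V_def A_def inner_diff_left)
  have B: "second_fundamental_form K p v w = A v \<bullet> w" if "v \<in> V" "w \<in> V" for v w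
    using DV[OF that(1)] Aw[OF that(2)] that(2)
    by (simp add: second_fundamental_form_def D_def V_def inner_add_left flip: K(6))
  have Asym: "A v \<bullet> w = v \<bullet> A w" if "v \<in> V" "w \<in> V" for v w
    using Aw[OF that(2), of v] Aw[OF that(1), of w] chart_hessian_symmetric[OF ch U(2), of v w]
    by (simp add: inner_commute)
  obtain E \<mu> where E: "finite E" "E \<subseteq> V" "span E = V" "pairwise orthogonal E" "\<And>e. e \<in> E \<Longrightarrow> norm e = 1"
    "\<And>e. e \<in> E \<Longrightarrow> A e = \<mu> e *\<^sub>R e"
    using selfadjoint_eigenbasis[OF V linA AV Asym] by metis
  obtain es where es: "form_eigenvalues V (second_fundamental_form K p) = map \<mu> es" "distinct es" "set es = E"
    using form_eigenvalues_eq[OF V linA AV B E] by metis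
  have "gauss_curvature K p > 0" using sc p by (simp add: smooth_strictly_convex_def)
  then have "prod_list (map \<mu> es) \<noteq> 0"
    unfolding gauss_curvature_def Vgauss es(1) by simp
  then have \<mu>: "\<mu> e \<noteq> 0" if "e \<in> E" for e
    using that es(3) by (auto simp: prod_list_zero_iff)
  have vV: "v \<in> V" using v by (simp add: V_def)
  have "v \<bullet> e = 0" if "e \<in> E" for e
  proof -
    have eV: "e \<in> V" using that E(2) by blast
    have "\<mu> e * (v \<bullet> e) = v \<bullet> A e" by (simp add: E(6)[OF that])
    also have "\<dots> = ?r * (Dg p v \<bullet> e)" using Asym[OF vV eV] Aw[OF eV] by simp
    also have "\<dots> = 0" using Dv[of e] eV by (simp add: V_def)
    finally show ?thesis using \<mu>[OF that] by simp
  qed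
  then have "v = 0"
    using orthonormal_basis_expand[OF E(4,5) _ E(1), of v] vV E(3) by simp
  then show ?thesis .
qed

section \<open>Regularity of the inverse Gauss map\<close>

lemma C1_on_locally:
  assumes "\<And>x. x \<in> S \<Longrightarrow> \<exists>T. open T \<and> x \<in> T \<and> C1_on T f"
  shows "C1_on S f"
proof (rule C1_onI)
  fix x assume "x \<in> S"
  then obtain T where "x \<in> T" "C1_on T f" using assms by blast
  then show "(f has_derivative frechet_derivative f (at x)) (at x)"
    using C1_on_has_derivative by blast
next
  fix v
  have "isCont (\<lambda>x. frechet_derivative f (at x) v) x" if x: "x \<in> S" for x
  proof -
    obtain T where T: "open T" "x \<in> T" "C1_on T f" using assms x by blast
    show ?thesis
      using C1_on_continuous_derivative[OF T(3), of v] T(1,2) by (simp add: continuous_on_eq_continuous_at)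
  qed
  then show "continuous_on S (\<lambda>x. frechet_derivative f (at x) v)"
    by (rule continuous_at_imp_continuous_on[OF ballI])
qed

lemma C1_on_Pair:
  assumes "C1_on S f" "C1_on S g"
  shows "C1_on S (\<lambda>x. (f x, g x))"
  by (rule C1_onI, rule has_derivative_Pair[OF C1_on_has_derivative[OF assms(1)] C1_on_has_derivative[OF assms(2)]])
     (use assms in \<open>auto intro!: continuous_on_Pair\<close>)

text \<open>A point \<open>x\<close> of \<open>M\<close> with outer normal \<open>z = t g x\<close> is characterized by
  \<open>(t g x, F x) = (z, 0)\<close>, so the inverse of this map yields the inverse Gauss map.\<close>

definition chart_map :: "('a::euclidean_space \<Rightarrow> real) \<Rightarrow> ('a \<Rightarrow> 'a) \<Rightarrow> 'a \<times> real \<Rightarrow> 'a \<times> real" where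
  "chart_map F g q = (snd q *\<^sub>R g (fst q), F (fst q))"

text \<open>For a kernel vector of the derivative at \<open>(p, t0)\<close> the second component
  gives tangency, and the inner product of the first with tangent vectors removes the
  \<open>g p\<close> term; \<open>chart_nondegenerate\<close> then leaves 0. The last conclusion is
  the equation derivative times inverse = identity, written out.\<close>

lemma chart_inverse:
  fixes M :: "'a::euclidean_space set"
  assumes sc: "smooth_strictly_convex M K" and ch: "defining_chart M U F g Dg" and p: "p \<in> M \<inter> U"
    and t0: "0 < t0"
  obtains W V G R where "open W" "W \<subseteq> U \<times> {0<..}" "(p, t0) \<in> W" "open V" "(t0 *\<^sub>R g p, 0) \<in> V"
    "homeomorphism W V (chart_map F g) G"
    "\<And>y. y \<in> V \<Longrightarrow> (G has_derivative blinfun_apply (R y)) (at y)"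
    "C1_on V R"
    "\<And>y w. y \<in> V \<Longrightarrow> (snd (R y w) *\<^sub>R g (fst (G y)) + snd (G y) *\<^sub>R Dg (fst (G y)) (fst (R y w)),
        g (fst (G y)) \<bullet> fst (R y w)) = w"
proof -
  define S where "S = U \<times> {0::real<..}"
  have U: "open U" and FD: "\<And>x. x \<in> U \<Longrightarrow> (F has_derivative (\<lambda>v. g x \<bullet> v)) (at x)"
    and gD: "\<And>x. x \<in> U \<Longrightarrow> (g has_derivative Dg x) (at x)" and C1D: "C1_on U Dg"
    and MU: "M \<inter> U = {x \<in> U. F x = 0}"
    using ch by (auto simp: defining_chart_def)
  have gp: "g p \<noteq> 0" using ch p by (force simp: defining_chart_def)
  have openS: "open S" unfolding S_def by (intro open_Times U) simp
  let ?T = "\<lambda>q w. (snd w *\<^sub>R g (fst q) + snd q *\<^sub>R Dg (fst q) (fst w), g (fst q) \<bullet> fst w)"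
  have gfst: "((\<lambda>q. g (fst q)) has_derivative (\<lambda>w. Dg (fst q) (fst w))) (at q)"
    and Ffst: "((\<lambda>q. F (fst q)) has_derivative (\<lambda>w. g (fst q) \<bullet> fst w)) (at q)"
    if q: "q \<in> S" for q :: "'a \<times> real"
  proof -
    have q': "fst q \<in> U" using q by (auto simp: S_def)
    have f: "(fst has_derivative fst) (at q)" by (rule bounded_linear_imp_has_derivative[OF bounded_linear_fst])
    show "((\<lambda>q. g (fst q)) has_derivative (\<lambda>w. Dg (fst q) (fst w))) (at q)"
      by (rule has_derivative_compose[OF f gD[OF q']])
    show "((\<lambda>q. F (fst q)) has_derivative (\<lambda>w. g (fst q) \<bullet> fst w)) (at q)"
      by (rule has_derivative_compose[OF f FD[OF q']])
  qed
  have der: "(chart_map F g has_derivative ?T q) (at q)" if q: "q \<in> S" for q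
  proof -
    have s: "(snd has_derivative snd) (at q)" by (rule bounded_linear_imp_has_derivative[OF bounded_linear_snd])
    have "((\<lambda>q. (snd q *\<^sub>R g (fst q), F (fst q))) has_derivative
        (\<lambda>w. (snd q *\<^sub>R Dg (fst q) (fst w) + snd w *\<^sub>R g (fst q), g (fst q) \<bullet> fst w))) (at q)"
      by (intro has_derivative_Pair has_derivative_scaleR s gfst Ffst q)
    then show ?thesis unfolding chart_map_def[abs_def] by (simp add: add.commute)
  qed
  define T where "T q = Blinfun (?T q)" for q
  have T: "blinfun_apply (T q) = ?T q" if "q \<in> S" for q
    unfolding T_def using der[OF that] by (intro bounded_linear_Blinfun_apply has_derivative_bounded_linear)
  have derT: "(chart_map F g has_derivative blinfun_apply (T q)) (at q)" if "q \<in> S" for q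
    using der[OF that] T[OF that] by simp
  have C1g: "C1_on U g"
    by (rule C1_onI[OF gD]) (use C1_on_imp_continuous_on[OF C1D] in \<open>auto intro!: continuous_intros\<close>)
  have C1fst: "C1_on S (\<lambda>q. f (fst q))" if "C1_on U f" for f :: "'a \<Rightarrow> 'c::real_normed_vector"
    by (rule C1_on_compose[OF C1_on_linear_self[OF bounded_linear_fst] that]) (auto simp: S_def)
  have C1T: "C1_on S T"
  proof (rule C1_on_blinfunI)
    fix w
    show "C1_on S (\<lambda>q. T q w)"
    proof (rule C1_on_cong[OF openS])
      show "C1_on S (\<lambda>q. ?T q w)"
        by (intro C1_on_Pair C1_on_add C1_on_scaleR C1_on_const C1_on_inner C1_on_blinfun_apply
            C1fst C1g C1D C1_on_linear_self[OF bounded_linear_snd])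
    qed (simp add: T)
  qed
  have pS: "(p, t0) \<in> S" using p t0 by (simp add: S_def)
  have "inj (blinfun_apply (T (p, t0)))"
  proof (rule linear_injective_0[THEN iffD2, OF _ allI, OF _ impI])
    show "linear (blinfun_apply (T (p, t0)))"
      by (rule bounded_linear.linear[OF blinfun.bounded_linear_right])
    fix w assume "blinfun_apply (T (p, t0)) w = 0"
    then have w: "snd w *\<^sub>R g p + t0 *\<^sub>R Dg p (fst w) = 0" "g p \<bullet> fst w = 0"
      by (simp_all add: T[OF pS] zero_prod_def)
    have "Dg p (fst w) \<bullet> u = 0" if "g p \<bullet> u = 0" for u
    proof -
      have "(snd w *\<^sub>R g p + t0 *\<^sub>R Dg p (fst w)) \<bullet> u = 0" unfolding w(1) by simp
      then show ?thesis using that t0 by (simp add: inner_add_left)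
    qed
    then have "fst w = 0" by (rule chart_nondegenerate[OF sc ch p w(2)])
    then show "w = 0" using w(1) gp by (simp add: prod_eq_iff)
  qed
  then obtain L where L: "linear L" "L \<circ> blinfun_apply (T (p, t0)) = id"
    using linear_injective_left_inverse[of "blinfun_apply (T (p, t0))"]
      bounded_linear.linear[OF blinfun.bounded_linear_right] by blast
  have inv: "Blinfun L o\<^sub>L T (p, t0) = id_blinfun"
  proof (rule blinfun_eqI)
    fix w
    show "blinfun_apply (Blinfun L o\<^sub>L T (p, t0)) w = blinfun_apply id_blinfun w"
      using fun_cong[OF L(2), of w] bounded_linear_Blinfun_apply[of L] L(1)
      by (simp add: linear_conv_bounded_linear)
  qed
  obtain W V G G' where W: "open W" "W \<subseteq> S" "(p, t0) \<in> W" and V: "open V" "chart_map F g (p, t0) \<in> V"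
    and hom: "homeomorphism W V (chart_map F g) G"
    and G: "\<And>y. y \<in> V \<Longrightarrow> (G has_derivative (G' y)) (at y)"
    and G': "\<And>y. y \<in> V \<Longrightarrow> G' y = inv (blinfun_apply (T (G y)))"
    and bij: "\<And>y. y \<in> V \<Longrightarrow> bij (blinfun_apply (T (G y)))"
    using inverse_function_theorem[OF openS derT C1_on_imp_continuous_on[OF C1T] pS inv] by metis
  define R where "R y = Blinfun (G' y)" for y
  have R: "blinfun_apply (R y) = G' y" if "y \<in> V" for y
    unfolding R_def using G[OF that] by (intro bounded_linear_Blinfun_apply has_derivative_bounded_linear)
  have GR: "(G has_derivative blinfun_apply (R y)) (at y)" if "y \<in> V" for y
    using G[OF that] R[OF that] by simp
  have GV: "G y \<in> W" "G y \<in> S" if "y \<in> V" for y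
    using hom that W(2) by (auto simp: homeomorphism_def)
  have TR: "T (G y) o\<^sub>L R y = id_blinfun" if "y \<in> V" for y
    using bij[OF that] by (intro blinfun_eqI) (simp add: R[OF that] G'[OF that] bij_is_surj surj_f_inv_f)
  have RT: "R y o\<^sub>L T (G y) = id_blinfun" if "y \<in> V" for y
    using bij[OF that] by (intro blinfun_eqI) (simp add: R[OF that] G'[OF that] bij_is_inj)
  have contG: "continuous_on V G" using hom by (simp add: homeomorphism_def)
  have contTG: "continuous_on V (\<lambda>y. T (G y))"
    by (rule continuous_on_compose2[OF C1_on_imp_continuous_on[OF C1T] contG]) (use GV in auto)
  \<comment> \<open>Bootstrapping: continuity of \<open>R\<close> makes \<open>G\<close> C1, hence
    \<open>T (G y)\<close> is C1 in \<open>y\<close>, and so is its inverse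
    \<open>R\<close>.\<close>
  have contR: "continuous_on V R"
    by (rule continuous_on_blinfun_inverse[OF contTG TR RT])
  have C1G: "C1_on V G"
    by (rule C1_onI[OF GR]) (use contR in \<open>auto intro!: continuous_intros\<close>)
  have C1R: "C1_on V R"
    by (rule C1_on_blinfun_inverse[OF V(1) C1_on_compose[OF C1G C1T GV(2)] TR RT])
  show ?thesis
  proof (rule that[OF W(1) _ W(3) V(1) _ hom GR C1R])
    show "W \<subseteq> U \<times> {0<..}" using W(2) by (simp add: S_def)
    show "(t0 *\<^sub>R g p, 0) \<in> V" using V(2) MU p by (auto simp: chart_map_def)
    show "?T (G y) (R y w) = w" if "y \<in> V" for y w
    proof -
      have "blinfun_apply (T (G y)) (R y w) = w"
        using TR[OF that] by (metis blinfun_apply_blinfun_compose blinfun_apply_id_blinfun)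
      then show ?thesis by (simp only: T[OF GV(2)[OF that]])
    qed
  qed
qed

section \<open>Support points as functions of the normal\<close>

lemma outer_normal_imp_frontier:
  fixes K :: "'a::euclidean_space set"
  assumes "p \<in> K" "outer_normal K p \<nu>"
  shows "p \<in> frontier K"
proof -
  have "p \<notin> interior K"
  proof
    assume "p \<in> interior K"
    then obtain e where e: "e > 0" "ball p e \<subseteq> K" by (metis mem_interior)
    let ?x = "p + (e / (2 * norm \<nu>)) *\<^sub>R \<nu>"
    have n: "\<nu> \<noteq> 0" using assms(2) by (simp add: outer_normal_def)
    then have "?x \<in> K" using e by (intro subsetD[OF e(2)]) (simp add: dist_norm)
    then have "(?x - p) \<bullet> \<nu> \<le> 0" using assms(2) unfolding outer_normal_def by blast
    then have "(e / (2 * norm \<nu>)) * (\<nu> \<bullet> \<nu>) \<le> 0" by simp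
    moreover have "0 < (e / (2 * norm \<nu>)) * (\<nu> \<bullet> \<nu>)" using n e(1) by simp
    ultimately show False by linarith
  qed
  then show ?thesis using assms(1) closure_subset by (auto simp: frontier_def)
qed

text \<open>By convexity, two points with the normal \<open>z\<close> are joined by a segment of
  such points. One of them close to \<open>p\<close>, with its own scaling factor, has the same
  image (z, 0) under \<open>chart_map\<close> as \<open>p\<close>, so injectivity on
  \<open>W\<close> applies.\<close>

lemma support_point_unique:
  assumes sc: "smooth_strictly_convex M K"
    and p: "p \<in> K" "outer_normal K p z" and q: "q \<in> K" "outer_normal K q z"
  shows "q = p"
proof -
  note K = smooth_strictly_convexD[OF sc]
  have pM: "p \<in> M" using outer_normal_imp_frontier[OF p] K(6) by simp
  obtain U F g Dg where ch: "defining_chart M U F g Dg" and pU: "p \<in> U"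
    using defining_chart_exists[OF sc pM] by blast
  obtain c where c: "c > 0" "z = c *\<^sub>R g p"
    using chart_outer_normal_iff[OF sc ch] pM pU p(2) by blast
  obtain W V G R where W: "open W" "W \<subseteq> U \<times> {0<..}" "(p, c) \<in> W"
    and hom: "homeomorphism W V (chart_map F g) G"
    by (rule chart_inverse[OF sc ch _ c(1), of p]) (use pM pU in auto)
  have g0: "g x \<noteq> 0" if "x \<in> U" for x using ch that by (force simp: defining_chart_def)
  define y where "y t = p + t *\<^sub>R (q - p)" for t
  \<comment> \<open>The second component is the factor that scales \<open>g (y t)\<close> to the
    length of \<open>z\<close>, so that \<open>f t\<close> tends to \<open>(p, c)\<close>.\<close>
  define f where "f t = (y t, norm z / norm (g (y t)))" for t
  have "(g has_derivative Dg p) (at p)" using ch pU unfolding defining_chart_def by blast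
  then have "isCont g p" by (rule has_derivative_continuous)
  then have "((\<lambda>t. g (y t)) \<longlongrightarrow> g p) (at 0)"
    by (rule isCont_tendsto_compose) (auto simp: y_def intro!: tendsto_eq_intros)
  then have "(f \<longlongrightarrow> (p, norm z / norm (g p))) (at 0)"
    unfolding f_def using g0[OF pU] by (intro tendsto_intros) (auto simp: y_def intro!: tendsto_eq_intros)
  moreover have "norm z / norm (g p) = c" using c g0[OF pU] by simp
  ultimately have "\<forall>\<^sub>F t in at 0. f t \<in> W"
    using W by (intro topological_tendstoD) auto
  then obtain d where d: "d > 0" "\<And>t. t \<noteq> 0 \<Longrightarrow> \<bar>t\<bar> < d \<Longrightarrow> f t \<in> W"
    by (auto simp: eventually_at dist_real_def)
  define t where "t = min 1 (d / 2)"
  have t: "0 < t" "t \<le> 1" "\<bar>t\<bar> < d" using d(1) by (auto simp: t_def)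
  have fW: "f t \<in> W" using d(2) t by simp
  have yU: "y t \<in> U" using fW W(2) by (auto simp: f_def)
  have "y t \<in> K"
    using convexD_alt[OF K(1) p(1) q(1), of t] t by (simp add: y_def algebra_simps)
  moreover have pq: "p \<bullet> z = q \<bullet> z"
    using p q by (force simp: outer_normal_def inner_diff_left)
  have "outer_normal K (y t) z"
    using p(2) pq by (auto simp: outer_normal_def y_def inner_diff_left inner_add_left)
  ultimately have yM: "y t \<in> M \<inter> U"
    using outer_normal_imp_frontier K(6) yU by blast
  obtain c' where c': "c' > 0" "z = c' *\<^sub>R g (y t)"
    using chart_outer_normal_iff[OF sc ch yM] \<open>outer_normal K (y t) z\<close> by blast
  have "norm z / norm (g (y t)) = c'" using c' g0[OF yU] by simp
  moreover have "F (y t) = 0" "F p = 0"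
    using yM pM pU ch unfolding defining_chart_def by blast+
  ultimately have "chart_map F g (f t) = chart_map F g (p, c)"
    by (simp only: chart_map_def f_def fst_conv snd_conv flip: c(2) c'(2))
  then have "f t = (p, c)"
    using hom fW W(3) by (metis homeomorphism_def)
  then show ?thesis using t(1) by (simp add: f_def y_def)
qed

lemma support_point_exists:
  assumes sc: "smooth_strictly_convex M K" and z: "z \<noteq> 0"
  obtains p where "p \<in> K" "outer_normal K p z"
proof -
  note K = smooth_strictly_convexD[OF sc]
  have "K \<noteq> {}" using K(5) interior_subset by blast
  moreover have "continuous_on K (\<lambda>x. x \<bullet> z)" by (intro continuous_intros)
  ultimately obtain p where "p \<in> K" "\<forall>x\<in>K. x \<bullet> z \<le> p \<bullet> z"
    using continuous_attains_sup[OF K(3)] by blast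
  then show ?thesis using that[of p] z by (simp add: outer_normal_def inner_diff_left)
qed

definition support_point :: "'a::euclidean_space set \<Rightarrow> 'a \<Rightarrow> 'a" where
  "support_point K z = (THE p. p \<in> K \<and> outer_normal K p z)"

lemma support_point_eqI:
  assumes "smooth_strictly_convex M K" "p \<in> K" "outer_normal K p z"
  shows "support_point K z = p"
  unfolding support_point_def using assms support_point_unique by (intro the_equality) blast+

lemma support_point:
  assumes "smooth_strictly_convex M K" "z \<noteq> 0"
  shows "support_point K z \<in> K" "outer_normal K (support_point K z) z"
  using support_point_exists[OF assms] support_point_eqI[OF assms(1)] by metis+

text \<open>It deserves the name once \<open>support_fun_has_derivative\<close> recognizes
  \<open>support_point\<close> as the gradient of \<open>support_fun\<close>.\<close>

definition support_hessian :: "'a::euclidean_space set \<Rightarrow> 'a \<Rightarrow> 'a \<Rightarrow>\<^sub>L 'a" where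
  "support_hessian K z = Blinfun (frechet_derivative (support_point K) (at z))"

text \<open>Near \<open>z\<close> the support point is the first component of the local inverse on
  the slice where \<open>F\<close> is 0, and inherits its regularity. If
  \<open>support_hessian K z v\<close> vanishes, the last equation of \<open>chart_inverse\<close>
  leaves \<open>v\<close> as a multiple of \<open>g p\<close>, hence of \<open>z\<close>.\<close>

lemma support_point_regularity:
  assumes sc: "smooth_strictly_convex M K" and z: "z \<noteq> 0"
  shows support_point_has_derivative: "(support_point K has_derivative support_hessian K z) (at z)"
    and support_hessian_C1_near: "\<exists>T. open T \<and> z \<in> T \<and> C1_on T (support_hessian K)"
    and support_hessian_kernel: "support_hessian K z v = 0 \<Longrightarrow> \<exists>c. v = c *\<^sub>R z"
proof -
  note K = smooth_strictly_convexD[OF sc]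
  define p where "p = support_point K z"
  have p: "p \<in> K" "outer_normal K p z" unfolding p_def using support_point[OF sc z] by auto
  have pM: "p \<in> M" using outer_normal_imp_frontier[OF p] K(6) by simp
  obtain U F g Dg where ch: "defining_chart M U F g Dg" and pU: "p \<in> U"
    using defining_chart_exists[OF sc pM] by blast
  obtain c where c: "c > 0" "z = c *\<^sub>R g p"
    using chart_outer_normal_iff[OF sc ch] pM pU p(2) by blast
  have pMU: "p \<in> M \<inter> U" using pM pU by simp
  obtain W V G R where W: "open W" "W \<subseteq> U \<times> {0<..}" "(p, c) \<in> W" and V: "open V" "(c *\<^sub>R g p, 0) \<in> V"
    and hom: "homeomorphism W V (chart_map F g) G"
    and G: "\<And>y. y \<in> V \<Longrightarrow> (G has_derivative blinfun_apply (R y)) (at y)"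
    and C1R: "C1_on V R"
    and R: "\<And>y w. y \<in> V \<Longrightarrow> (snd (R y w) *\<^sub>R g (fst (G y)) + snd (G y) *\<^sub>R Dg (fst (G y)) (fst (R y w)),
        g (fst (G y)) \<bullet> fst (R y w)) = w"
    by (rule chart_inverse[OF sc ch pMU c(1)]) blast
  define T where "T = (\<lambda>y::'a. (y, 0::real)) -` V"
  have T: "open T" "z \<in> T"
    using V c unfolding T_def by (auto intro!: open_vimage continuous_intros)
  have GW: "G y \<in> W" "chart_map F g (G y) = y" if "y \<in> V" for y
    using hom that by (auto simp: homeomorphism_def)
  have X: "support_point K y = fst (G (y, 0))" if "y \<in> T" for y
  proof -
    let ?q = "G (y, 0)"
    have yV: "(y, 0) \<in> V" using that by (simp add: T_def)
    have "?q \<in> U \<times> {0<..}" using GW(1)[OF yV] W(2) by blast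
    then have q: "fst ?q \<in> U" "0 < snd ?q" by auto
    have eq: "snd ?q *\<^sub>R g (fst ?q) = y" "F (fst ?q) = 0"
      using GW(2)[OF yV] by (auto simp: chart_map_def)
    have qM: "fst ?q \<in> M \<inter> U" using ch q(1) eq(2) by (auto simp: defining_chart_def)
    then have "outer_normal K (fst ?q) y"
      unfolding chart_outer_normal_iff[OF sc ch qM] by (intro exI[of _ "snd ?q"]) (simp add: q(2) eq(1))
    then show ?thesis using qM K(7) by (intro support_point_eqI[OF sc]) auto
  qed
  let ?pr = "fst_blinfun :: ('a \<times> real) \<Rightarrow>\<^sub>L 'a"
  let ?em = "Blinfun (\<lambda>v::'a. (v, 0::real))"
  have em: "blinfun_apply ?em = (\<lambda>v. (v, 0))"
    by (intro bounded_linear_Blinfun_apply bounded_linear_Pair bounded_linear_ident bounded_linear_zero)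
  define H where "H y = ?pr o\<^sub>L R (y, 0) o\<^sub>L ?em" for y
  have H: "blinfun_apply (H y) = (\<lambda>v. fst (R (y, 0) (v, 0)))" for y
    by (simp add: H_def fun_eq_iff em)
  have der: "(support_point K has_derivative H y) (at y)" if y: "y \<in> T" for y
  proof -
    have yV: "(y, 0) \<in> V" using y by (simp add: T_def)
    have e: "((\<lambda>y::'a. (y, 0::real)) has_derivative (\<lambda>v. (v, 0))) (at y)"
      by (intro has_derivative_Pair has_derivative_ident has_derivative_const)
    have "((\<lambda>y. fst (G (y, 0))) has_derivative H y) (at y)"
      unfolding H by (rule has_derivative_fst[OF has_derivative_compose[OF e G[OF yV]]])
    then show ?thesis
      by (rule has_derivative_transform_within_open[OF _ T(1) y]) (simp add: X)
  qed
  have eqH: "support_hessian K y = H y" if "y \<in> T" for y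
  proof -
    have "frechet_derivative (support_point K) (at y) = blinfun_apply (H y)"
      using frechet_derivative_at[OF der[OF that]] by simp
    then show ?thesis by (simp add: support_hessian_def blinfun_apply_inverse)
  qed
  show "(support_point K has_derivative support_hessian K z) (at z)"
    using der[OF T(2)] eqH[OF T(2)] by simp
  have "C1_on T H"
    unfolding H_def
  proof (intro C1_on_blinfun_compose C1_on_const)
    show "C1_on T (\<lambda>y. R (y, 0))"
      by (rule C1_on_compose[OF C1_on_Pair[OF C1_on_ident C1_on_const] C1R]) (simp add: T_def)
  qed
  then have "C1_on T (support_hessian K)"
    by (rule C1_on_cong[OF T(1), rotated]) (simp add: eqH)
  then show "\<exists>T. open T \<and> z \<in> T \<and> C1_on T (support_hessian K)" using T by blast
  assume v: "support_hessian K z v = 0"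
  have zV: "(z, 0) \<in> V" using T(2) by (simp add: T_def)
  let ?w = "R (z, 0) (v, 0)"
  have w0: "fst ?w = 0" using v eqH[OF T(2)] by (simp add: H)
  have "snd ?w *\<^sub>R g (fst (G (z, 0))) = v"
    using R[OF zV, of "(v, 0)"] w0 by (simp add: blinfun.zero_right)
  moreover have "fst (G (z, 0)) = p" using X[OF T(2)] by (simp add: p_def)
  ultimately have "v = (snd ?w / c) *\<^sub>R z" using c by simp
  then show "\<exists>c. v = c *\<^sub>R z" by blast
qed

lemma C1_on_support_hessian:
  assumes "smooth_strictly_convex M K"
  shows "C1_on (- {0}) (support_hessian K)"
  by (rule C1_on_locally) (use support_hessian_C1_near[OF assms] in auto)

section \<open>The support function\<close>

lemma support_point_in:
  assumes "smooth_strictly_convex M K" "z \<noteq> 0"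
  shows "support_point K z \<in> M"
  using outer_normal_imp_frontier[OF support_point[OF assms]] smooth_strictly_convexD(6)[OF assms(1)] by simp

lemma support_point_max:
  assumes "smooth_strictly_convex M K" "z \<noteq> 0" "x \<in> K"
  shows "x \<bullet> z \<le> support_point K z \<bullet> z"
  using support_point(2)[OF assms(1,2)] assms(3) by (auto simp: outer_normal_def inner_diff_left)

lemma support_point_surj:
  assumes sc: "smooth_strictly_convex M K" and p: "p \<in> M"
  obtains z where "norm z = 1" "support_point K z = p"
proof -
  note K = smooth_strictly_convexD[OF sc]
  obtain \<nu> where \<nu>: "outer_normal K p \<nu>" using outer_normal_exists K p by metis
  then have n: "\<nu> \<noteq> 0" by (simp add: outer_normal_def)
  have "outer_normal K p ((1 / norm \<nu>) *\<^sub>R \<nu>)"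
    using outer_normal_scaleR[OF \<nu>, of "1 / norm \<nu>"] n by simp
  then have "support_point K ((1 / norm \<nu>) *\<^sub>R \<nu>) = p"
    using support_point_eqI[OF sc] K(7) p by blast
  then show ?thesis using that[of "(1 / norm \<nu>) *\<^sub>R \<nu>"] n by simp
qed

lemma support_fun_eq:
  assumes "smooth_strictly_convex M K" "z \<noteq> 0"
  shows "support_fun K z = support_point K z \<bullet> z"
  unfolding support_fun_def
  by (rule cSup_eq_maximum) (use support_point(1)[OF assms] support_point_max[OF assms] in auto)

lemma support_fun_pos:
  assumes "smooth_strictly_convex M K" "z \<noteq> 0"
  shows "0 < support_fun K z"
  using outer_normal_pos[OF smooth_strictly_convexD(5)[OF assms(1)] support_point(2)[OF assms]]
  by (simp add: support_fun_eq[OF assms] inner_commute)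

lemma support_point_scaleR:
  assumes "smooth_strictly_convex M K" "z \<noteq> 0" "0 < c"
  shows "support_point K (c *\<^sub>R z) = support_point K z"
  using support_point[OF assms(1,2)] assms(3)
  by (intro support_point_eqI[OF assms(1)] outer_normal_scaleR) auto

lemma support_point_monotone:
  assumes "smooth_strictly_convex M K" "y \<noteq> 0" "z \<noteq> 0"
  shows "0 \<le> (support_point K y - support_point K z) \<bullet> y"
  using support_point_max[OF assms(1,2) support_point(1)[OF assms(1,3)]] by (simp add: inner_diff_left)

text \<open>An envelope argument: the remainder equals (X y - X z) \<bullet> y, which maximality at
  \<open>y\<close> makes nonnegative and maximality at \<open>z\<close> bounds by (X y - X z)
  \<bullet> (y - z). Continuity of X does the rest.\<close>

lemma support_fun_has_derivative:
  assumes sc: "smooth_strictly_convex M K" and z: "z \<noteq> 0"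
  shows "(support_fun K has_derivative (\<lambda>v. support_point K z \<bullet> v)) (at z)"
proof (rule has_derivativeI_sandwich[where e = "norm z" and H = "\<lambda>y. norm (support_point K y - support_point K z)"])
  let ?X = "support_point K"
  show "0 < norm z" using z by simp
  show "bounded_linear (\<lambda>v. ?X z \<bullet> v)" by (rule bounded_linear_inner_right)
  have "isCont ?X z" by (rule has_derivative_continuous[OF support_point_has_derivative[OF sc z]])
  then have "((\<lambda>y. norm (?X y - ?X z)) \<longlongrightarrow> norm (?X z - ?X z)) (at z)"
    unfolding isCont_def by (intro tendsto_intros)
  then show "((\<lambda>y. norm (?X y - ?X z)) \<longlongrightarrow> 0) (at z)" by simp
  fix y assume y: "y \<noteq> z" "dist y z < norm z"
  then have y0: "y \<noteq> 0" by auto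
  have eq: "support_fun K y - support_fun K z - ?X z \<bullet> (y - z) = (?X y - ?X z) \<bullet> y"
    by (simp add: support_fun_eq[OF sc y0] support_fun_eq[OF sc z] inner_diff_left inner_diff_right)
  have "(?X y - ?X z) \<bullet> y = (?X y - ?X z) \<bullet> (y - z) - (?X z - ?X y) \<bullet> z"
    by (simp add: inner_diff_left inner_diff_right)
  also have "\<dots> \<le> norm (?X y - ?X z) * norm (y - z)"
    using support_point_monotone[OF sc z y0] norm_cauchy_schwarz[of "?X y - ?X z" "y - z"] by linarith
  finally have "norm (support_fun K y - support_fun K z - ?X z \<bullet> (y - z)) \<le> norm (?X y - ?X z) * norm (y - z)"
    unfolding eq using support_point_monotone[OF sc y0 z] by simp
  then show "norm (support_fun K y - support_fun K z - ?X z \<bullet> (y - z)) / norm (y - z) \<le> norm (?X y - ?X z)"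
    using y(1) by (simp add: field_simps)
qed

lemma support_hessian_symmetric:
  assumes sc: "smooth_strictly_convex M K" and z: "z \<noteq> 0"
  shows "support_hessian K z v \<bullet> w = v \<bullet> support_hessian K z w"
proof -
  have d: "((\<lambda>y. support_point K y \<bullet> u) has_derivative (\<lambda>h. support_hessian K z h \<bullet> u)) (at z)" for u
    by (intro has_derivative_inner_left support_point_has_derivative[OF sc z])
  have "support_hessian K z w \<bullet> v = support_hessian K z v \<bullet> w"
    by (rule second_derivative_symmetric[of "- {0}" z "support_fun K" "\<lambda>y v. support_point K y \<bullet> v" v
          "\<lambda>u h. support_hessian K z h \<bullet> u" w, OF _ _ _ d d])
       (use z support_fun_has_derivative[OF sc] in auto)
  then show ?thesis by (simp add: inner_commute)
qed

text \<open>Support points are constant along rays.\<close>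

lemma support_hessian_radial:
  assumes sc: "smooth_strictly_convex M K" and z: "z \<noteq> 0"
  shows "support_hessian K z z = 0"
proof -
  let ?X = "support_point K"
  have "((\<lambda>t. ?X (z + t *\<^sub>R z)) has_derivative (\<lambda>t. support_hessian K z (t *\<^sub>R z))) (at 0)"
  proof (rule has_derivative_compose[where f = "\<lambda>t. z + t *\<^sub>R z" and f' = "\<lambda>t. t *\<^sub>R z"
        and g = ?X and g' = "support_hessian K z"])
    show "((\<lambda>t. z + t *\<^sub>R z) has_derivative (\<lambda>t. t *\<^sub>R z)) (at 0)"
      by (auto intro!: derivative_eq_intros)
    show "(?X has_derivative support_hessian K z) (at (z + 0 *\<^sub>R z))"
      using support_point_has_derivative[OF sc z] by simp
  qed
  moreover have "((\<lambda>t. ?X (z + t *\<^sub>R z)) has_derivative (\<lambda>t. 0)) (at 0)"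
  proof (rule has_derivative_transform_within_open[of "\<lambda>t. ?X z" _ _ UNIV "{-1<..}"])
    fix t :: real assume "t \<in> {-1<..}"
    then show "?X z = ?X (z + t *\<^sub>R z)"
      using support_point_scaleR[OF sc z, of "1 + t"] by (simp add: scaleR_add_left)
  qed auto
  ultimately have "(\<lambda>t. support_hessian K z (t *\<^sub>R z)) = (\<lambda>t. 0)"
    by (rule has_derivative_unique)
  from fun_cong[OF this, of 1] show ?thesis by simp
qed

lemma support_hessian_nonneg:
  assumes sc: "smooth_strictly_convex M K" and z: "z \<noteq> 0"
  shows "0 \<le> support_hessian K z v \<bullet> v"
proof (rule ccontr)
  let ?X = "support_point K"
  assume neg: "\<not> ?thesis"
  define a where "a = - (support_hessian K z v \<bullet> v)"
  have a: "a > 0" using neg by (simp add: a_def)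
  then have v: "v \<noteq> 0" by (auto simp: a_def)
  \<comment> \<open>With this tolerance the error is at most half of \<open>t * a\<close>, the
    amount by which the linear term would violate monotonicity of support points.\<close>
  obtain d where d: "d > 0" "\<And>y. norm y < d \<Longrightarrow>
      norm (?X (z + y) - ?X z - support_hessian K z y) \<le> (a / (2 * (norm v)\<^sup>2)) * norm y"
    using has_derivative_at_remainder[OF support_point_has_derivative[OF sc z], of "a / (2 * (norm v)\<^sup>2)"] a v
    by auto
  define t where "t = min d (norm z) / (2 * norm v)"
  have t: "t > 0" using d z v by (simp add: t_def)
  have "norm (t *\<^sub>R v) = t * norm v" using t by simp
  also have "\<dots> = min d (norm z) / 2" using v by (simp add: t_def)
  finally have "norm (t *\<^sub>R v) = min d (norm z) / 2" .
  then have tv: "norm (t *\<^sub>R v) < d" "norm (t *\<^sub>R v) < norm z"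
    using d(1) zero_less_norm_iff[of z] z by linarith+
  have y0: "z + t *\<^sub>R v \<noteq> 0"
    using tv(2) by (metis add_eq_0_iff norm_minus_cancel less_irrefl)
  have "0 \<le> (?X (z + t *\<^sub>R v) - ?X z) \<bullet> (t *\<^sub>R v)"
    using support_point_monotone[OF sc y0 z] support_point_monotone[OF sc z y0]
    unfolding inner_diff_left inner_add_right by linarith
  then have 1: "0 \<le> (?X (z + t *\<^sub>R v) - ?X z) \<bullet> v" using t by (simp add: zero_le_mult_iff)
  have "(?X (z + t *\<^sub>R v) - ?X z) \<bullet> v =
      (?X (z + t *\<^sub>R v) - ?X z - support_hessian K z (t *\<^sub>R v)) \<bullet> v - t * a"
    by (simp add: inner_diff_left a_def blinfun.scaleR_right)
  also have "\<dots> \<le> norm (?X (z + t *\<^sub>R v) - ?X z - support_hessian K z (t *\<^sub>R v)) * norm v - t * a"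
    using norm_cauchy_schwarz by (intro diff_right_mono) blast
  also have "\<dots> \<le> (a / (2 * (norm v)\<^sup>2)) * norm (t *\<^sub>R v) * norm v - t * a"
    using d(2)[OF tv(1)] by (intro diff_right_mono mult_right_mono) auto
  also have "(a / (2 * (norm v)\<^sup>2)) * norm (t *\<^sub>R v) * norm v = t * a / 2"
    using t v by (simp add: power2_eq_square)
  finally have "0 \<le> t * a / 2 - t * a" using 1 by linarith
  moreover have "t * a > 0" using t a by simp
  ultimately show False by linarith
qed

lemma support_hessian_scaleR:
  assumes sc: "smooth_strictly_convex M K" and z: "z \<noteq> 0" and c: "0 < c"
  shows "support_hessian K (c *\<^sub>R z) = (1 / c) *\<^sub>R support_hessian K z"
proof (rule blinfun_eqI)
  fix v
  let ?X = "support_point K"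
  have cz: "c *\<^sub>R z \<noteq> 0" using z c by simp
  have "((\<lambda>y. ?X (c *\<^sub>R y)) has_derivative (\<lambda>v. support_hessian K (c *\<^sub>R z) (c *\<^sub>R v))) (at z)"
    by (rule has_derivative_compose[where f = "\<lambda>y. c *\<^sub>R y" and f' = "\<lambda>v. c *\<^sub>R v"])
       (intro has_derivative_scaleR_right has_derivative_ident support_point_has_derivative[OF sc cz])+
  then have "(?X has_derivative (\<lambda>v. support_hessian K (c *\<^sub>R z) (c *\<^sub>R v))) (at z)"
    by (rule has_derivative_transform_within_open[of _ _ _ UNIV "- {0}"])
       (use z support_point_scaleR[OF sc _ c] in auto)
  from has_derivative_unique[OF this support_point_has_derivative[OF sc z]]
  have "support_hessian K (c *\<^sub>R z) (c *\<^sub>R v) = support_hessian K z v" by (rule fun_cong)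
  then have "c *\<^sub>R support_hessian K (c *\<^sub>R z) v = support_hessian K z v" by (simp add: blinfun.scaleR_right)
  then have "(1 / c) *\<^sub>R (c *\<^sub>R support_hessian K (c *\<^sub>R z) v) = (1 / c) *\<^sub>R support_hessian K z v" by simp
  then show "blinfun_apply (support_hessian K (c *\<^sub>R z)) v = blinfun_apply ((1 / c) *\<^sub>R support_hessian K z) v"
    using c by (simp add: blinfun.scaleR_left)
qed

text \<open>The Codazzi equation is the symmetry of the third derivatives of the support function.
  The last identity expresses degree -1: differentiating \<open>support_hessian K y y = 0\<close> in
  direction \<open>v\<close> gives \<open>H' v z = - support_hessian K z v\<close>, and the symmetry
  exchanges \<open>v\<close> and \<open>z\<close>.\<close>

lemma support_hessian_has_derivative:
  assumes sc: "smooth_strictly_convex M K" and z: "z \<noteq> 0"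
  obtains H' where "(support_hessian K has_derivative H') (at z)"
    "\<And>v w. H' v w = H' w v" "H' z = - support_hessian K z"
proof -
  define H' where "H' = frechet_derivative (support_hessian K) (at z)"
  have H': "(support_hessian K has_derivative H') (at z)"
    unfolding H'_def using C1_on_has_derivative[OF C1_on_support_hessian[OF sc]] z by simp
  have codazzi: "H' v w = H' w v" for v w
  proof -
    have "H' v w \<bullet> c = H' w v \<bullet> c" for c
    proof -
      have d: "((\<lambda>y. support_hessian K y u \<bullet> c) has_derivative (\<lambda>h. H' h u \<bullet> c)) (at z)" for u
        by (intro has_derivative_inner_left bounded_linear.has_derivative[OF blinfun.bounded_linear_left] H')
      show ?thesis
        by (rule second_derivative_symmetric[of "- {0}" z "\<lambda>y. support_point K y \<bullet> c"
              "\<lambda>y u. support_hessian K y u \<bullet> c" w "\<lambda>u h. H' h u \<bullet> c" v, OF _ _ _ d d])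
           (use z support_point_has_derivative[OF sc] in \<open>auto intro!: has_derivative_inner_left\<close>)
    qed
    then show ?thesis by (metis inner_eq_zero_iff inner_diff_left right_minus_eq)
  qed
  have "((\<lambda>y. support_hessian K y y) has_derivative (\<lambda>v. support_hessian K z v + H' v z)) (at z)"
    by (rule bounded_bilinear.FDERIV[OF bounded_bilinear_blinfun_apply H' has_derivative_ident])
  moreover have "((\<lambda>y. support_hessian K y y) has_derivative (\<lambda>v. 0)) (at z)"
    by (rule has_derivative_transform_within_open[of "\<lambda>y. 0" _ _ UNIV "- {0}"])
       (use z support_hessian_radial[OF sc] in auto)
  ultimately have "(\<lambda>v. support_hessian K z v + H' v z) = (\<lambda>v. 0)"
    by (rule has_derivative_unique)
  then have "support_hessian K z v + H' v z = 0" for v by (rule fun_cong)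
  then have "H' z v = - support_hessian K z v" for v
    using codazzi[of v z] by (metis add_eq_0_iff)
  then have "H' z = - support_hessian K z" by (intro blinfun_eqI) (simp add: blinfun.minus_left)
  with H' codazzi show ?thesis by (rule that)
qed

text \<open>The radial unit vector \<open>u\<close> completes an eigenbasis of the tangent
  hyperplane to one of the whole space; its eigenvalue 0 does not change symmetric functions. The
  other eigenvalues are nonnegative by monotonicity and nonzero because the kernel is
  radial.\<close>

lemma support_hessian_eigenbasis:
  fixes K :: "'a::euclidean_space set"
  assumes sc: "smooth_strictly_convex M K" and x: "x \<noteq> 0"
  obtains E \<mu> where "finite E" "card E = DIM('a) - 1" "span E = {v. x \<bullet> v = 0}" "pairwise orthogonal E"
    "\<And>e. e \<in> E \<Longrightarrow> norm e = 1" "\<And>e. e \<in> E \<Longrightarrow> support_hessian K x e = \<mu> e *\<^sub>R e"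
    "\<And>e. e \<in> E \<Longrightarrow> 0 < \<mu> e" "\<And>k. sigma_op k (support_hessian K x) = esym k E \<mu>"
    "\<And>k e. e \<in> E \<Longrightarrow> newton_tensor k (support_hessian K x) e = esym k (E - {e}) \<mu> *\<^sub>R e"
proof -
  let ?H = "support_hessian K x"
  define V where "V = {v. x \<bullet> v = 0}"
  have V: "subspace V" by (auto simp: V_def subspace_def inner_add_right)
  have HV: "?H v \<in> V" for v
    using support_hessian_symmetric[OF sc x, of x v] support_hessian_radial[OF sc x] by (simp add: V_def)
  obtain E \<mu> where E: "finite E" "E \<subseteq> V" "span E = V" "pairwise orthogonal E" "\<And>e. e \<in> E \<Longrightarrow> norm e = 1"
    and \<mu>: "\<And>e. e \<in> E \<Longrightarrow> ?H e = \<mu> e *\<^sub>R e"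
    using selfadjoint_eigenbasis[OF V bounded_linear.linear[OF blinfun.bounded_linear_right] HV
        support_hessian_symmetric[OF sc x]] by metis
  have E0: "0 \<notin> E" using E(5) by force
  have "independent E" using pairwise_orthogonal_independent[OF E(4)] E0 by blast
  then have "card E = dim V" using E(3) dim_eq_card_independent dim_span by metis
  then have card: "card E = DIM('a) - 1" using dim_hyperplane[OF x] by (simp add: V_def)
  have pos: "0 < \<mu> e" if e: "e \<in> E" for e
  proof -
    have ee: "e \<bullet> e = 1" using E(5)[OF e] by (simp add: norm_eq_1)
    have "0 \<le> \<mu> e" using support_hessian_nonneg[OF sc x, of e] \<mu>[OF e] ee by simp
    moreover have "\<mu> e \<noteq> 0"
    proof
      assume "\<mu> e = 0"
      then obtain c where c: "e = c *\<^sub>R x" using support_hessian_kernel[OF sc x, of e] \<mu>[OF e] by auto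
      have "x \<bullet> e = 0" using E(2) e by (auto simp: V_def)
      then have "e \<bullet> e = 0" using c by simp
      then show False using ee by simp
    qed
    ultimately show ?thesis by simp
  qed
  define u where "u = (1 / norm x) *\<^sub>R x"
  have u: "norm u = 1" using x by (simp add: u_def)
  have uE: "u \<bullet> e = 0" if "e \<in> E" for e using that E(2) by (auto simp: u_def V_def)
  have uu: "u \<bullet> u = 1" using u by (simp add: norm_eq_1)
  have unE: "u \<notin> E" using uE[of u] uu by auto
  let ?E = "insert u E" and ?\<mu> = "\<mu>(u := 0)"
  have "v \<in> span ?E" for v
  proof -
    have "v - (v \<bullet> u) *\<^sub>R u \<in> V"
    proof -
      have "u \<bullet> (v - (v \<bullet> u) *\<^sub>R u) = 0" using uu by (simp add: inner_diff_right inner_commute)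
      then show ?thesis using x by (simp add: u_def V_def)
    qed
    then have "v - (v \<bullet> u) *\<^sub>R u \<in> span ?E" using E(3) span_mono[of E ?E] by blast
    from span_add[OF this span_scale[OF span_base, of u ?E "v \<bullet> u"]] show ?thesis by simp
  qed
  then have sp: "span ?E = UNIV" by blast
  have full: "finite ?E" "pairwise orthogonal ?E" "\<And>e. e \<in> ?E \<Longrightarrow> norm e = 1"
    using E u uE by (auto simp: pairwise_insert orthogonal_def inner_commute)
  have \<mu>': "?H e = ?\<mu> e *\<^sub>R e" if "e \<in> ?E" for e
    using that \<mu> unE by (auto simp: u_def blinfun.scaleR_right support_hessian_radial[OF sc x])
  have cong: "esym k F ?\<mu> = esym k F \<mu>" if "F \<subseteq> E" for k F
    unfolding esym_def using that unE by (intro sum.cong prod.cong refl) auto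
  have ins: "esym k (insert u F) ?\<mu> = esym k F \<mu>" if F: "F \<subseteq> E" for k F
  proof -
    have fF: "finite F" "u \<notin> F" using F E(1) unE by (auto intro: finite_subset)
    show ?thesis
    proof (cases k)
      case 0
      then show ?thesis using fF by (simp add: esym_0)
    next
      case (Suc j)
      show ?thesis unfolding Suc esym_insert[OF fF] using cong[OF F] by simp
    qed
  qed
  have s: "sigma_op k ?H = esym k E \<mu>" for k
    by (simp only: sigma_op_eq_esym[OF full sp \<mu>'] ins[OF order_refl])
  have t: "newton_tensor k ?H e = esym k (E - {e}) \<mu> *\<^sub>R e" if e: "e \<in> E" for k e
  proof -
    have "?E - {e} = insert u (E - {e})" using e unE by auto
    then show ?thesis
      by (simp only: newton_tensor_eigenvector[OF full sp \<mu>' insertI2[OF e]] ins[OF Diff_subset])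
  qed
  show ?thesis
    using that[OF E(1) card _ E(4) E(5) \<mu> pos s t] E(3) by (simp add: V_def)
qed

section \<open>Comparison with the intrinsic quantities on the sphere\<close>

lemma has_derivative_within_sphere_unique:
  fixes f :: "'a::euclidean_space \<Rightarrow> 'b::real_normed_vector"
  assumes z: "z \<in> unit_sphere"
    and L: "(f has_derivative L1) (at z within unit_sphere)" "(f has_derivative L2) (at z within unit_sphere)"
    and v: "z \<bullet> v = 0"
  shows "L1 v = L2 v"
proof (rule has_derivative_within_level_set_unique[of UNIV z "\<lambda>x. x \<bullet> x - 1" "2 *\<^sub>R z" _ f, OF _ _ _ _ _ _ _ L])
  show "((\<lambda>x. x \<bullet> x - 1) has_derivative (\<lambda>v. (2 *\<^sub>R z) \<bullet> v)) (at z)"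
    by (auto intro!: derivative_eq_intros simp: inner_commute)
  show "x \<in> unit_sphere" if "x \<bullet> x - 1 = 0" for x :: 'a
    using that by (simp add: norm_eq_1)
qed (use z v in \<open>auto simp: norm_eq_1 intro!: continuous_intros\<close>)

lemma sphere_grad_support_fun:
  assumes sc: "smooth_strictly_convex M K" and z: "z \<in> unit_sphere"
  shows "sphere_grad (support_fun K) z = support_point K z - support_fun K z *\<^sub>R z"
proof -
  have z0: "z \<noteq> 0" and zz: "z \<bullet> z = 1" using z by (auto simp: norm_eq_1)
  let ?g = "support_point K z - support_fun K z *\<^sub>R z"
  \<comment> \<open>The subtracted multiple of \<open>x \<bullet> x - 1\<close> vanishes on the
    sphere and removes the radial part of the ambient gradient.\<close>
  have "((\<lambda>x. support_fun K x - (support_fun K z / 2) * (x \<bullet> x - 1)) has_derivative (\<lambda>v. ?g \<bullet> v)) (at z)"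
    by (rule has_derivative_eq_rhs, (rule derivative_intros support_fun_has_derivative[OF sc z0])+)
       (auto simp: fun_eq_iff inner_diff_left inner_diff_right inner_commute)
  then have "((\<lambda>x. support_fun K x - (support_fun K z / 2) * (x \<bullet> x - 1)) has_derivative (\<lambda>v. ?g \<bullet> v))
      (at z within unit_sphere)"
    by (rule has_derivative_at_withinI)
  then have der: "(support_fun K has_derivative (\<lambda>v. ?g \<bullet> v)) (at z within unit_sphere)"
    by (rule has_derivative_transform[rotated 2]) (use z in \<open>auto simp: norm_eq_1\<close>)
  have tan: "?g \<in> tangent_sphere z"
    using support_fun_eq[OF sc z0] zz by (simp add: tangent_sphere_def inner_diff_right inner_commute)
  show ?thesis
    unfolding sphere_grad_def
  proof (rule the_equality)
    show "?g \<in> tangent_sphere z \<and> (support_fun K has_derivative (\<lambda>v. ?g \<bullet> v)) (at z within unit_sphere)"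
      using tan der by simp
    fix g assume g: "g \<in> tangent_sphere z \<and> (support_fun K has_derivative (\<lambda>v. g \<bullet> v)) (at z within unit_sphere)"
    have "z \<bullet> (g - ?g) = 0" using g tan by (simp add: tangent_sphere_def inner_diff_right)
    then have "g \<bullet> (g - ?g) = ?g \<bullet> (g - ?g)"
      using has_derivative_within_sphere_unique[OF z conjunct2[OF g] der] by blast
    then have "(g - ?g) \<bullet> (g - ?g) = 0" by (simp only: inner_diff_left[of g ?g "g - ?g"])
    then show "g = ?g" by (simp only: inner_eq_zero_iff right_minus_eq)
  qed
qed

lemma inverse_gauss_eq:
  assumes "smooth_strictly_convex M K" "z \<in> unit_sphere"
  shows "inverse_gauss K z = support_point K z"
  by (simp add: inverse_gauss_def sphere_grad_support_fun[OF assms])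

text \<open>The tangential gradient X - u z has the ambient derivative H v - u v - (X \<bullet> v)
  z. Against a tangent \<open>w\<close> the last term drops out, and the metric term in the
  definition of W cancels the second.\<close>

lemma W_form_eq:
  assumes sc: "smooth_strictly_convex M K" and z: "z \<in> unit_sphere"
    and v: "v \<in> tangent_sphere z" and w: "w \<in> tangent_sphere z"
  shows "W_form K z v w = support_hessian K z v \<bullet> w"
proof -
  have z0: "z \<noteq> 0" using z by auto
  let ?Y = "\<lambda>y. support_point K y - support_fun K y *\<^sub>R y"
  let ?DY = "\<lambda>v. support_hessian K z v - (support_fun K z *\<^sub>R v + (support_point K z \<bullet> v) *\<^sub>R z)"
  have "(?Y has_derivative ?DY) (at z)"
    by (intro has_derivative_diff has_derivative_scaleR support_point_has_derivative[OF sc z0]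
        support_fun_has_derivative[OF sc z0] has_derivative_ident)
  then have "(?Y has_derivative ?DY) (at z within unit_sphere)"
    by (rule has_derivative_at_withinI)
  then have der: "(sphere_grad (support_fun K) has_derivative ?DY) (at z within unit_sphere)"
    by (rule has_derivative_transform[rotated 2]) (use z sphere_grad_support_fun[OF sc] in auto)
  define D where "D = frechet_derivative (sphere_grad (support_fun K)) (at z within unit_sphere)"
  have "(sphere_grad (support_fun K) has_derivative D) (at z within unit_sphere)"
    unfolding D_def using der by (auto simp: differentiable_def simp flip: frechet_derivative_works)
  from has_derivative_within_sphere_unique[OF z this der]
  have "D v = ?DY v" using v by (simp add: tangent_sphere_def)
  then show ?thesis
    using w by (simp add: W_form_def sphere_hess_def sphere_connection_def Let_def tangent_sphere_def
        inner_diff_left inner_add_left flip: D_def)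
qed

lemma P_W_eq:
  fixes K :: "'a::euclidean_space set"
  assumes sc: "smooth_strictly_convex M K" and z: "z \<in> unit_sphere"
  shows "P_W k K z = sigma_op k (support_hessian K z) / real ((DIM('a) - 1) choose k)"
proof -
  have z0: "z \<noteq> 0" using z by auto
  obtain E \<mu> where E: "finite E" "card E = DIM('a) - 1" "span E = {v. z \<bullet> v = 0}" "pairwise orthogonal E"
    "\<And>e. e \<in> E \<Longrightarrow> norm e = 1" "\<And>e. e \<in> E \<Longrightarrow> support_hessian K z e = \<mu> e *\<^sub>R e"
    and s: "\<And>k. sigma_op k (support_hessian K z) = esym k E \<mu>"
    using support_hessian_eigenbasis[OF sc z0] by metis
  let ?V = "tangent_sphere z"
  have V: "subspace ?V" by (auto simp: tangent_sphere_def subspace_def inner_add_right)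
  have HV: "support_hessian K z v \<in> ?V" for v
    using support_hessian_symmetric[OF sc z0, of z v] support_hessian_radial[OF sc z0]
    by (simp add: tangent_sphere_def)
  have span: "span E = ?V" using E(3) by (simp add: tangent_sphere_def)
  have sub: "E \<subseteq> ?V" using span span_superset by blast
  obtain es where es: "form_eigenvalues ?V (W_form K z) = map \<mu> es" "distinct es" "set es = E"
    using form_eigenvalues_eq[OF V bounded_linear.linear[OF blinfun.bounded_linear_right] HV
        W_form_eq[OF sc z] E(1) sub span E(4,5,6)] by metis
  show ?thesis
    unfolding P_W_def es(1) normalized_elem_sym_map[OF es(2)] es(3) s E(2) ..
qed

section \<open>Tangential Newton fields\<close>

lemma C1_on_support_point:
  assumes "smooth_strictly_convex M K"
  shows "C1_on (- {0}) (support_point K)"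
  by (rule C1_onI[where f' = "\<lambda>x. support_hessian K x"])
     (use support_point_has_derivative[OF assms] C1_on_imp_continuous_on[OF C1_on_support_hessian[OF assms]]
       in \<open>auto intro!: continuous_intros\<close>)

lemma C1_on_support_fun:
  assumes "smooth_strictly_convex M K"
  shows "C1_on (- {0}) (support_fun K)"
  by (rule C1_onI[where f' = "\<lambda>x v. support_point K x \<bullet> v"])
     (use support_fun_has_derivative[OF assms] C1_on_imp_continuous_on[OF C1_on_support_point[OF assms]]
       in \<open>auto intro!: continuous_intros\<close>)

text \<open>The orthogonal projection of \<open>support_point K x\<close> along \<open>x\<close>,
  because \<open>support_fun K x\<close> is its inner product with \<open>x\<close>; on the unit
  sphere it is the gradient of u.\<close>

definition tangential_point :: "'a::euclidean_space set \<Rightarrow> 'a \<Rightarrow> 'a" where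
  "tangential_point K x = support_point K x - (support_fun K x / (x \<bullet> x)) *\<^sub>R x"

text \<open>The Newton tensor of the Hessian of the support function applied to the tangential part of
  its gradient; on the sphere this is \<open>T\<^sub>k \<nabla>u\<close>.\<close>

definition newton_field :: "nat \<Rightarrow> 'a::euclidean_space set \<Rightarrow> 'a \<Rightarrow> 'a" where
  "newton_field k K x = newton_tensor k (support_hessian K x) (support_point K x)
     - (sigma_op k (support_hessian K x) * support_fun K x * inverse (x \<bullet> x)) *\<^sub>R x"

lemma tangential_point_orthogonal:
  assumes "smooth_strictly_convex M K" "x \<noteq> 0"
  shows "x \<bullet> tangential_point K x = 0"
  using assms(2) support_fun_eq[OF assms] by (simp add: tangential_point_def inner_diff_right inner_commute)

lemma newton_field_eq:
  assumes "smooth_strictly_convex M K" "x \<noteq> 0"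
  shows "newton_field k K x = newton_tensor k (support_hessian K x) (tangential_point K x)"
  using newton_tensor_kernel[OF support_hessian_radial[OF assms], of k]
  by (simp add: newton_field_def tangential_point_def blinfun.diff_right blinfun.scaleR_right divide_inverse mult_ac)

lemma newton_field_orthogonal:
  assumes sc: "smooth_strictly_convex M K" and x: "x \<noteq> 0"
  shows "x \<bullet> newton_field k K x = 0"
  using newton_tensor_selfadjoint[OF support_hessian_symmetric[OF sc x], of k x "tangential_point K x"]
    newton_tensor_kernel[OF support_hessian_radial[OF sc x], of k] tangential_point_orthogonal[OF sc x]
  by (simp add: newton_field_eq[OF sc x])

lemma C1_on_newton_field:
  assumes sc: "smooth_strictly_convex M K"
  shows "C1_on (- {0}) (newton_field k K)"
  unfolding newton_field_def[abs_def]
  by (intro C1_on_diff C1_on_scaleR C1_on_blinfun_apply C1_on_mult C1_on_inverse C1_on_inner C1_on_ident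
      C1_on_newton_tensor C1_on_sigma_op C1_on_support_hessian[OF sc] C1_on_support_point[OF sc]
      C1_on_support_fun[OF sc]) auto

lemma divergence_scaleR:
  assumes c: "(c has_derivative c') (at x)" and V: "(V has_derivative V') (at x)"
  shows "divergence (\<lambda>y. c y *\<^sub>R V y) x = c' (V x) + c x * divergence V x"
proof -
  have "(\<Sum>b\<in>Basis. c' b * (V x \<bullet> b)) = c' (\<Sum>b\<in>Basis. (V x \<bullet> b) *\<^sub>R b)"
    unfolding linear_sum[OF has_derivative_linear[OF c]] linear_scale[OF has_derivative_linear[OF c]]
    by (simp add: mult.commute)
  then show ?thesis
    unfolding divergence_eq[OF has_derivative_scaleR[OF c V]] divergence_eq[OF V]
    by (simp add: inner_add_left sum.distrib sum_distrib_left euclidean_representation)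
qed

text \<open>T_k is divergence free, so the first part contributes tr(T_k H) = (k + 1) sigma_(k+1).
  The radial part is s x with s homogeneous of degree - (k + 1); by Euler its divergence is s times
  the dimension minus k + 1.\<close>

lemma divergence_newton_field:
  fixes K :: "'a::euclidean_space set"
  assumes sc: "smooth_strictly_convex M K" and x: "x \<noteq> 0"
  shows "divergence (newton_field k K) x = real (Suc k) * sigma_op (Suc k) (support_hessian K x)
    - (real DIM('a) - 1 - real k) * sigma_op k (support_hessian K x) * support_fun K x * inverse (x \<bullet> x)"
proof -
  let ?H = "support_hessian K x" and ?X = "support_point K x" and ?h = "support_fun K x"
  obtain H' where H': "(support_hessian K has_derivative H') (at x)"
    and codazzi: "\<And>v w. H' v w = H' w v" and H'x: "H' x = - ?H"
    using support_hessian_has_derivative[OF sc x] by blast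
  obtain T' s' where T': "((\<lambda>y. newton_tensor k (support_hessian K y)) has_derivative T') (at x)"
    and s': "((\<lambda>y. sigma_op k (support_hessian K y)) has_derivative s') (at x)"
    using newton_tensor_differentiable[OF H'] by metis
  \<comment> \<open>Euler's relation for sigma_k, of degree -k, obtained from the fact
    \<open>H'x\<close>.\<close>
  have s'x: "s' x = - (real k * sigma_op k ?H)"
  proof (cases k)
    case 0
    then have "s' = (\<lambda>v. 0)" using has_derivative_unique[OF s'] by simp
    then show ?thesis using 0 by simp
  next
    case (Suc j)
    have "s' = (\<lambda>v. blinfun_trace (newton_tensor j ?H o\<^sub>L H' v))"
      using has_derivative_unique[OF s'[unfolded Suc] has_derivative_sigma[OF H']] .
    then have "s' x = blinfun_trace (newton_tensor j ?H o\<^sub>L (- ?H))" using H'x by simp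
    also have "\<dots> = - blinfun_trace (newton_tensor j ?H o\<^sub>L ?H)"
      by (simp add: blinfun_trace_def blinfun.minus_left blinfun.minus_right sum_negf)
    finally show ?thesis by (simp add: Suc sigma_op.simps(2))
  qed
  have qq: "((\<lambda>y. y \<bullet> y) has_derivative (\<lambda>v. 2 * (x \<bullet> v))) (at x)"
    by (auto intro!: derivative_eq_intros simp: inner_commute)
  have q: "((\<lambda>y. inverse (y \<bullet> y)) has_derivative (\<lambda>v. - (inverse (x \<bullet> x) * (2 * (x \<bullet> v)) * inverse (x \<bullet> x)))) (at x)"
    by (rule Deriv.has_derivative_inverse[where f = "\<lambda>y. y \<bullet> y", OF _ qq]) (use x in simp)
  let ?s = "\<lambda>y. sigma_op k (support_hessian K y) * support_fun K y * inverse (y \<bullet> y)"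
  let ?ds = "\<lambda>v. (sigma_op k ?H * ?h) * (- (inverse (x \<bullet> x) * (2 * (x \<bullet> v)) * inverse (x \<bullet> x)))
      + (sigma_op k ?H * (?X \<bullet> v) + s' v * ?h) * inverse (x \<bullet> x)"
  have ds: "(?s has_derivative ?ds) (at x)"
    by (intro has_derivative_mult s' support_fun_has_derivative[OF sc x] q)
  have Xx: "?X \<bullet> x = ?h" by (rule support_fun_eq[OF sc x, symmetric])
  have dsx: "?ds x = - (real k + 1) * ?s x"
    using x unfolding s'x Xx by (simp add: field_simps)
  have TX: "((\<lambda>y. newton_tensor k (support_hessian K y) (support_point K y)) has_derivative
      (\<lambda>v. newton_tensor k ?H (?H v) + T' v ?X)) (at x)"
    by (rule bounded_bilinear.FDERIV[OF bounded_bilinear_blinfun_apply T' support_point_has_derivative[OF sc x]])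
  have lin: "linear ?ds" by (rule has_derivative_linear[OF ds])
  have "(newton_field k K has_derivative
      (\<lambda>v. (newton_tensor k ?H (?H v) + T' v ?X) - (?s x *\<^sub>R v + ?ds v *\<^sub>R x))) (at x)"
    unfolding newton_field_def[abs_def]
    by (rule has_derivative_diff[OF TX has_derivative_scaleR[OF ds has_derivative_ident]])
  then have "divergence (newton_field k K) x =
      (\<Sum>b\<in>Basis. ((newton_tensor k ?H (?H b) + T' b ?X) - (?s x *\<^sub>R b + ?ds b *\<^sub>R x)) \<bullet> b)"
    by (rule divergence_eq)
  also have "\<dots> = (\<Sum>b\<in>Basis. newton_tensor k ?H (?H b) \<bullet> b) + (\<Sum>b\<in>Basis. T' b ?X \<bullet> b)
      - ((\<Sum>b\<in>(Basis::'a set). ?s x * (b \<bullet> b)) + (\<Sum>b\<in>Basis. ?ds b * (x \<bullet> b)))"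
    unfolding inner_diff_left inner_add_left inner_scaleR_left sum_subtractf sum.distrib ..
  also have "(\<Sum>b\<in>Basis. newton_tensor k ?H (?H b) \<bullet> b) = real (Suc k) * sigma_op (Suc k) ?H"
    by (simp add: sigma_op.simps(2) blinfun_trace_def)
  also have "(\<Sum>b\<in>Basis. T' b ?X \<bullet> b) = 0"
    by (rule newton_tensor_divergence_free[OF H' codazzi T'])
  also have "(\<Sum>b\<in>(Basis::'a set). ?s x * (b \<bullet> b)) = real DIM('a) * ?s x"
    by simp
  also have "(\<Sum>b\<in>Basis. ?ds b * (x \<bullet> b)) = ?ds (\<Sum>b\<in>Basis. (x \<bullet> b) *\<^sub>R b)"
    unfolding linear_sum[OF lin] linear_scale[OF lin] real_scaleR_def by (simp only: mult.commute)
  also have "(\<Sum>b\<in>Basis. (x \<bullet> b) *\<^sub>R b) = x" by (rule euclidean_representation)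
  also note dsx
  finally show ?thesis by (simp add: algebra_simps)
qed

lemma DERIV_max_0_square: "((\<lambda>t::real. (max 0 t)\<^sup>2) has_real_derivative 2 * max 0 t) (at t)"
proof (cases "t = 0")
  case True
  have "((\<lambda>h::real. (max 0 h)\<^sup>2 / h) \<longlongrightarrow> 0) (at 0)"
  proof (rule Lim_null_comparison[where g = abs])
    show "\<forall>\<^sub>F h::real in at 0. norm ((max 0 h)\<^sup>2 / h) \<le> \<bar>h\<bar>"
      by (rule always_eventually) (auto simp: max_def power2_eq_square abs_mult)
    show "((\<lambda>h::real. \<bar>h\<bar>) \<longlongrightarrow> 0) (at 0)" by (rule tendsto_rabs_zero) (rule tendsto_ident_at)
  qed
  then show ?thesis using True by (simp add: DERIV_def)
next
  case False
  show ?thesis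
  proof (cases "t > 0")
    case True
    have "((\<lambda>t::real. t\<^sup>2) has_real_derivative 2 * max 0 t) (at t)"
      using True by (auto intro!: derivative_eq_intros)
    then show ?thesis
      by (rule has_field_derivative_transform_within_open[of _ _ _ "{0<..}"]) (use True in auto)
  next
    case F: False
    have "((\<lambda>t::real. 0) has_real_derivative 2 * max 0 t) (at t)"
      using F by (auto intro!: derivative_eq_intros)
    then show ?thesis
      by (rule has_field_derivative_transform_within_open[of _ _ _ "{..<0}"]) (use False F in auto)
  qed
qed

text \<open>For a tangential field the radial cutoff does not contribute to the divergence.\<close>

lemma tangential_field_divergence_eq_0:
  fixes V :: "'a::euclidean_space \<Rightarrow> 'a"
  assumes V: "C1_on (- {0}) V" and tan: "\<And>x. x \<noteq> 0 \<Longrightarrow> x \<bullet> V x = 0"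
    and nonneg: "\<And>x. x \<noteq> 0 \<Longrightarrow> 0 \<le> divergence V x"
    and z: "norm z = 1"
  shows "divergence V z = 0"
proof -
  \<comment> \<open>A polynomial in |x|^2 that is positive exactly for 1/2 < |x| < 2; the square of
    its positive part is a C1 radial cutoff with the value 9^2 = 81 on the unit sphere.\<close>
  define p where "p x = (4 * (x \<bullet> x) - 1) * (4 - x \<bullet> x)" for x :: 'a
  define cut where "cut x = (max 0 (p x))\<^sup>2" for x
  have C1p: "C1_on S p" for S
    unfolding p_def by (intro C1_on_mult C1_on_diff C1_on_const C1_on_inner C1_on_ident)
  have C1cut: "C1_on S cut" for S
    unfolding cut_def
    by (rule C1_on_real_compose[where g = "\<lambda>t. (max 0 t)\<^sup>2" and T = UNIV, OF C1p DERIV_max_0_square])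
       (auto intro!: continuous_intros)
  have p0: "p x \<le> 0" if "norm x < 1/2 \<or> norm x > 2" for x
  proof -
    have sq: "x \<bullet> x = (norm x)\<^sup>2" by (simp add: dot_square_norm)
    from that show ?thesis
    proof
      assume "norm x < 1/2"
      then have "(norm x)\<^sup>2 < (1/2)\<^sup>2" by (intro power_strict_mono) auto
      then show ?thesis unfolding p_def sq by (intro mult_nonpos_nonneg) (auto simp: power2_eq_square)
    next
      assume "norm x > 2"
      then have "(2::real)\<^sup>2 < (norm x)\<^sup>2" by (intro power_strict_mono) auto
      then show ?thesis unfolding p_def sq by (intro mult_nonneg_nonpos) (auto simp: power2_eq_square)
    qed
  qed
  have cut0: "cut x = 0" if "norm x < 1/2 \<or> norm x > 2" for x
    using p0[OF that] by (simp add: cut_def max_def)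
  let ?V = "\<lambda>x. cut x *\<^sub>R V x"
  have der: "divergence ?V x = cut x * divergence V x" if x: "x \<noteq> 0" for x
  proof -
    have p': "(p has_derivative (\<lambda>v. (34 - 16 * (x \<bullet> x)) * (x \<bullet> v))) (at x)"
      unfolding p_def by (auto intro!: derivative_eq_intros simp: fun_eq_iff inner_commute algebra_simps)
    have "(cut has_derivative (\<lambda>v. 2 * max 0 (p x) * ((34 - 16 * (x \<bullet> x)) * (x \<bullet> v)))) (at x)"
      unfolding cut_def
      by (rule has_derivative_compose[OF p' DERIV_max_0_square[unfolded has_field_derivative_def]])
    from divergence_scaleR[OF this, of V] show ?thesis
      using C1_on_has_derivative[OF V, of x] x tan[OF x] by simp
  qed
  have C1V: "C1_on UNIV ?V"
  proof -
    have "C1_on (ball 0 (1/2)) ?V"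
      by (rule C1_on_cong[OF open_ball _ C1_on_const[of _ 0]]) (simp add: cut0)
    moreover have "C1_on (- {0}) ?V" by (rule C1_on_scaleR[OF C1cut V])
    ultimately have "C1_on (ball 0 (1/2) \<union> - {0}) ?V"
      by (intro C1_on_open_Un) auto
    moreover have "ball 0 (1/2) \<union> - {0::'a} = UNIV" by auto
    ultimately show ?thesis by metis
  qed
  have "divergence ?V z = 0"
  proof (rule divergence_nonneg_imp_0[OF C1V, of 2])
    show "cut x *\<^sub>R V x = 0" if "2 < norm x" for x using cut0 that by simp
    show "0 \<le> divergence ?V x" for x
    proof (cases "x = 0")
      case True
      have "(?V has_derivative (\<lambda>v. 0)) (at 0)"
        by (rule has_derivative_transform_within_open[of "\<lambda>x. 0" _ _ UNIV "ball 0 (1/2)"]) (auto simp: cut0)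
      then show ?thesis unfolding True by (simp add: divergence_eq)
    next
      case False
      then show ?thesis using der nonneg by (simp add: cut_def)
    qed
  qed
  moreover have "cut z = 81" using z by (simp add: cut_def p_def norm_eq_1)
  moreover have "z \<noteq> 0" using z by auto
  ultimately show ?thesis using der by simp
qed

text \<open>In the eigenbasis both expressions are sums of the squares
  \<open>(?t \<bullet> e)\<^sup>2\<close> with weights \<open>esym k (E - {e}) \<mu>\<close>, in the
  second case times \<open>\<mu> e\<close>. The bound on \<open>k\<close> leaves at least
  \<open>k\<close> positive eigenvalues after removing one, so the weights are positive.\<close>

lemma newton_field_positive:
  fixes K :: "'a::euclidean_space set"
  assumes sc: "smooth_strictly_convex M K" and x: "x \<noteq> 0" and k: "k < DIM('a) - 1"
    and tp: "tangential_point K x \<noteq> 0"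
  shows "0 < support_point K x \<bullet> newton_field k K x"
    and "0 < support_hessian K x (newton_field k K x) \<bullet> support_point K x"
proof -
  let ?H = "support_hessian K x" and ?t = "tangential_point K x" and ?w = "newton_field k K x"
  obtain E \<mu> where E: "finite E" "card E = DIM('a) - 1" "span E = {v. x \<bullet> v = 0}" "pairwise orthogonal E"
    "\<And>e. e \<in> E \<Longrightarrow> norm e = 1" and \<mu>: "\<And>e. e \<in> E \<Longrightarrow> ?H e = \<mu> e *\<^sub>R e" "\<And>e. e \<in> E \<Longrightarrow> 0 < \<mu> e"
    and T: "\<And>e. e \<in> E \<Longrightarrow> newton_tensor k ?H e = esym k (E - {e}) \<mu> *\<^sub>R e"
    using support_hessian_eigenbasis[OF sc x] by metis
  have "?t \<in> span E" using tangential_point_orthogonal[OF sc x] E(3) by simp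
  then have t: "?t = (\<Sum>e\<in>E. (?t \<bullet> e) *\<^sub>R e)"
    using orthonormal_basis_expand[OF E(4,5) _ E(1)] by simp
  obtain e0 where e0: "e0 \<in> E" "?t \<bullet> e0 \<noteq> 0"
    using t tp by (metis (mono_tags, lifting) scaleR_zero_left sum.neutral)
  have T0: "0 < esym k (E - {e}) \<mu>" if "e \<in> E" for e
    using E(1,2) \<mu>(2) k that by (intro esym_pos) auto
  have w: "?w = (\<Sum>e\<in>E. (?t \<bullet> e * esym k (E - {e}) \<mu>) *\<^sub>R e)"
    unfolding newton_field_eq[OF sc x]
    by (subst t) (simp add: blinfun.sum_right blinfun.scaleR_right T)
  have Xw: "support_point K x \<bullet> v = ?t \<bullet> v" if "x \<bullet> v = 0" for v
    using that by (simp add: tangential_point_def inner_diff_left)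
  have xw: "x \<bullet> ?w = 0" by (rule newton_field_orthogonal[OF sc x])
  have pos: "0 < (\<Sum>e\<in>E. f e * (?t \<bullet> e)\<^sup>2)" if "\<And>e. e \<in> E \<Longrightarrow> 0 < f e" for f :: "'a \<Rightarrow> real"
    by (rule sum_pos2[OF E(1) e0(1)]) (use e0 that in \<open>auto simp: less_imp_le\<close>)
  have "?t \<bullet> ?w = (\<Sum>e\<in>E. esym k (E - {e}) \<mu> * (?t \<bullet> e)\<^sup>2)"
    unfolding w inner_sum_right by (simp add: power2_eq_square mult_ac)
  then show "0 < support_point K x \<bullet> ?w" using pos[OF T0] Xw[OF xw] by simp
  have xH: "x \<bullet> ?H ?w = 0"
    using support_hessian_symmetric[OF sc x, of x ?w] support_hessian_radial[OF sc x] by simp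
  have "?H ?w = (\<Sum>e\<in>E. (?t \<bullet> e * esym k (E - {e}) \<mu> * \<mu> e) *\<^sub>R e)"
    unfolding w by (simp add: blinfun.sum_right blinfun.scaleR_right \<mu>(1))
  then have "?t \<bullet> ?H ?w = (\<Sum>e\<in>E. (esym k (E - {e}) \<mu> * \<mu> e) * (?t \<bullet> e)\<^sup>2)"
    by (simp add: inner_sum_right power2_eq_square mult_ac)
  moreover have "0 < (\<Sum>e\<in>E. (esym k (E - {e}) \<mu> * \<mu> e) * (?t \<bullet> e)\<^sup>2)"
    by (rule pos) (use T0 \<mu>(2) in simp)
  ultimately have "0 < ?t \<bullet> ?H ?w" by simp
  then show "0 < ?H ?w \<bullet> support_point K x" using Xw[OF xH] by (simp add: inner_commute)
qed

lemma newton_field_eq_0: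
  "smooth_strictly_convex M K \<Longrightarrow> x \<noteq> 0 \<Longrightarrow> tangential_point K x = 0 \<Longrightarrow> newton_field k K x = 0"
  by (simp add: newton_field_eq blinfun.zero_right)

section \<open>The main theorem\<close>

text \<open>The chain rule takes the total derivative, whereas the sign hypotheses concern
  \<open>deriv\<close> in each variable; restricting the former to the axes identifies them.\<close>

lemma C1_has_partial_derivatives:
  fixes \<psi> :: "real \<Rightarrow> real \<Rightarrow> real"
  assumes C1: "Ck_on 1 ({0<..} \<times> {0<..}) (\<lambda>(s, t). \<psi> s t)" and st: "0 < s" "0 < t"
  shows "((\<lambda>p. \<psi> (fst p) (snd p)) has_derivative
    (\<lambda>v. fst v * deriv (\<lambda>x. \<psi> x t) s + snd v * deriv (\<lambda>y. \<psi> s y) t)) (at (s, t))"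
proof -
  let ?\<Psi> = "\<lambda>p. \<psi> (fst p) (snd p)"
  define D where "D = frechet_derivative ?\<Psi> (at (s, t))"
  have "?\<Psi> = (\<lambda>(s, t). \<psi> s t)" by auto
  then have D: "(?\<Psi> has_derivative D) (at (s, t))"
    unfolding D_def using C1_on_has_derivative[of "{0<..} \<times> {0<..}" ?\<Psi> "(s, t)"] C1 st by simp
  interpret D: linear D by (rule has_derivative_linear[OF D])
  have e1: "(\<lambda>h. D (h, 0)) = (*) (D (1, 0))"
  proof
    show "D (h, 0) = D (1, 0) * h" for h using D.scale[of h "(1, 0)"] by (simp only: scaleR_Pair) simp
  qed
  have "((\<lambda>x. ?\<Psi> (x, t)) has_derivative (\<lambda>h. D (h, 0))) (at s)"
    by (rule has_derivative_compose[where f = "\<lambda>x. (x, t)" and g = ?\<Psi>, OF _ D])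
       (intro has_derivative_Pair has_derivative_ident has_derivative_const)
  then have "((\<lambda>x. \<psi> x t) has_real_derivative D (1, 0)) (at s)"
    unfolding has_field_derivative_def e1 fst_conv snd_conv .
  then have 1: "deriv (\<lambda>x. \<psi> x t) s = D (1, 0)" by (rule DERIV_imp_deriv)
  have e2: "(\<lambda>h. D (0, h)) = (*) (D (0, 1))"
  proof
    show "D (0, h) = D (0, 1) * h" for h using D.scale[of h "(0, 1)"] by (simp only: scaleR_Pair) simp
  qed
  have "((\<lambda>y. ?\<Psi> (s, y)) has_derivative (\<lambda>h. D (0, h))) (at t)"
    by (rule has_derivative_compose[where f = "\<lambda>y. (s, y)" and g = ?\<Psi>, OF _ D])
       (intro has_derivative_Pair has_derivative_ident has_derivative_const)
  then have "((\<lambda>y. \<psi> s y) has_real_derivative D (0, 1)) (at t)"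
    unfolding has_field_derivative_def e2 fst_conv snd_conv .
  then have 2: "deriv (\<lambda>y. \<psi> s y) t = D (0, 1)" by (rule DERIV_imp_deriv)
  have "D v = fst v * D (1, 0) + snd v * D (0, 1)" for v
    using D.add[of "fst v *\<^sub>R (1, 0)" "snd v *\<^sub>R (0, 1)"]
    unfolding D.scale by (simp add: scaleR_Pair)
  then have "D = (\<lambda>v. fst v * deriv (\<lambda>x. \<psi> x t) s + snd v * deriv (\<lambda>y. \<psi> s y) t)"
    unfolding 1 2 by blast
  then show ?thesis using D by simp
qed

lemma support_point_nonzero:
  assumes "smooth_strictly_convex M K" "x \<noteq> 0"
  shows "support_point K x \<noteq> 0"
  using support_fun_pos[OF assms] support_fun_eq[OF assms] by auto

text \<open>The degrees of homogeneity are -1 for the Hessian, 0 for the support point and 1 for the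
  support function; so normalizing \<open>x\<close> leaves the second argument of
  \<open>\<psi>\<close> unchanged and rescales the first.\<close>

lemma sigma_op_homogeneous_extension:
  fixes K :: "'a::euclidean_space set"
  assumes sc: "smooth_strictly_convex M K" and k: "k \<le> DIM('a) - 1" and x: "x \<noteq> 0"
    and eq: "\<And>z. z \<in> unit_sphere \<Longrightarrow> P_W k K z = \<psi> (support_fun K z) (radial_fun K z)"
  shows "sigma_op k (support_hessian K x) = real ((DIM('a) - 1) choose k) * inverse (norm x) ^ k *
    \<psi> (support_fun K x * inverse (norm x)) (norm (support_point K x))"
proof -
  define z where "z = inverse (norm x) *\<^sub>R x"
  have n: "0 < norm x" "0 < inverse (norm x)" using x by auto
  have z: "z \<in> unit_sphere" "z \<noteq> 0" using x by (auto simp: z_def)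
  have xz: "x = norm x *\<^sub>R z" using x by (simp add: z_def)
  have "support_hessian K x = inverse (norm x) *\<^sub>R support_hessian K z"
    using support_hessian_scaleR[OF sc z(2) n(1)] xz by (simp add: inverse_eq_divide)
  then have "sigma_op k (support_hessian K x) = inverse (norm x) ^ k * sigma_op k (support_hessian K z)"
    by (simp only: sigma_op_scaleR)
  also have "sigma_op k (support_hessian K z) = real ((DIM('a) - 1) choose k) * P_W k K z"
    using P_W_eq[OF sc z(1), of k] k by simp
  also have "P_W k K z = \<psi> (support_fun K z) (norm (support_point K z))"
    using eq[OF z(1)] inverse_gauss_eq[OF sc z(1)] by (simp add: radial_fun_def)
  also have X: "support_point K z = support_point K x"
    using support_point_scaleR[OF sc x n(2)] by (simp add: z_def)
  also have "support_fun K z = support_fun K x * inverse (norm x)"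
    unfolding support_fun_eq[OF sc z(2)] support_fun_eq[OF sc x] X by (simp add: z_def)
  finally show ?thesis by simp
qed

text \<open>The equation extends to all \<open>x \<noteq> 0\<close> by homogeneity, and in tangential directions \<open>w\<close> the
  radial scaling factors are constant, so only \<open>\<psi>\<close> is differentiated.\<close>

lemma sigma_op_derivative_pos:
  fixes K :: "'a::euclidean_space set" and \<psi> :: "real \<Rightarrow> real \<Rightarrow> real"
  assumes sc: "smooth_strictly_convex M K" and k: "k \<le> DIM('a) - 1" and x: "x \<noteq> 0"
    and C1: "Ck_on 1 ({0<..} \<times> {0<..}) (\<lambda>(s, t). \<psi> s t)"
    and d1: "\<And>s t. 0 < s \<Longrightarrow> 0 < t \<Longrightarrow> 0 \<le> deriv (\<lambda>x. \<psi> x t) s"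
    and d2: "\<And>s t. 0 < s \<Longrightarrow> 0 < t \<Longrightarrow> 0 \<le> deriv (\<lambda>y. \<psi> s y) t"
    and strict: "\<And>s t. 0 < s \<Longrightarrow> 0 < t \<Longrightarrow>
      0 < deriv (\<lambda>x. \<psi> x t) s \<or> 0 < deriv (\<lambda>y. \<psi> s y) t"
    and eq: "\<And>z. z \<in> unit_sphere \<Longrightarrow> P_W k K z = \<psi> (support_fun K z) (radial_fun K z)"
    and S': "((\<lambda>y. sigma_op k (support_hessian K y)) has_derivative S') (at x)"
    and w: "x \<bullet> w = 0" "0 < support_point K x \<bullet> w" "0 < support_hessian K x w \<bullet> support_point K x"
  shows "0 < S' w"
proof -
  let ?X = "support_point K x" and ?h = "support_fun K x" and ?C = "real ((DIM('a) - 1) choose k)"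
  define r where "r y = inverse (norm y)" for y :: 'a
  define r' where "r' v = - (r x * (v \<bullet> sgn x) * r x)" for v
  have rx: "r x > 0" using x by (simp add: r_def)
  have normx: "(norm has_derivative (\<lambda>v. v \<bullet> sgn x)) (at x)" by (rule has_derivative_norm[OF x])
  have r: "(r has_derivative r') (at x)"
    unfolding r_def[abs_def] r'_def[abs_def]
    by (rule Deriv.has_derivative_inverse[where f = norm, OF _ normx]) (use x in simp)
  have r'w: "r' w = 0" using w(1) by (simp add: r'_def sgn_div_norm inner_commute)
  have X0: "?X \<noteq> 0" by (rule support_point_nonzero[OF sc x])
  define s where "s = ?h * r x"
  define t where "t = norm ?X"
  have st: "0 < s" "0 < t" using support_fun_pos[OF sc x] rx X0 by (auto simp: s_def t_def)
  let ?d1 = "deriv (\<lambda>x. \<psi> x t) s" and ?d2 = "deriv (\<lambda>y. \<psi> s y) t"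
  let ?s' = "\<lambda>v. ?h * r' v + (?X \<bullet> v) * r x" and ?t' = "\<lambda>v. support_hessian K x v \<bullet> sgn ?X"
  have s': "((\<lambda>y. support_fun K y * r y) has_derivative ?s') (at x)"
    by (rule has_derivative_mult[OF support_fun_has_derivative[OF sc x] r])
  have t': "((\<lambda>y. norm (support_point K y)) has_derivative ?t') (at x)"
    by (rule has_derivative_compose[where g = norm, OF support_point_has_derivative[OF sc x] has_derivative_norm[OF X0]])
  have "((\<lambda>y. \<psi> (fst (support_fun K y * r y, norm (support_point K y)))
        (snd (support_fun K y * r y, norm (support_point K y)))) has_derivative
      (\<lambda>v. fst (?s' v, ?t' v) * ?d1 + snd (?s' v, ?t' v) * ?d2)) (at x)"
  proof (rule has_derivative_compose[where f = "\<lambda>y. (support_fun K y * r y, norm (support_point K y))"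
        and f' = "\<lambda>v. (?s' v, ?t' v)" and g = "\<lambda>p. \<psi> (fst p) (snd p)"
        and g' = "\<lambda>v. fst v * ?d1 + snd v * ?d2"])
    show "((\<lambda>y. (support_fun K y * r y, norm (support_point K y))) has_derivative (\<lambda>v. (?s' v, ?t' v))) (at x)"
      by (rule has_derivative_Pair[OF s' t'])
    show "((\<lambda>p. \<psi> (fst p) (snd p)) has_derivative (\<lambda>v. fst v * ?d1 + snd v * ?d2))
        (at (support_fun K x * r x, norm (support_point K x)))"
      using C1_has_partial_derivatives[OF C1 st] by (simp add: s_def t_def)
  qed
  then have \<psi>': "((\<lambda>y. \<psi> (support_fun K y * r y) (norm (support_point K y))) has_derivative
      (\<lambda>v. ?s' v * ?d1 + ?t' v * ?d2)) (at x)"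
    by simp
  have rk: "((\<lambda>y. ?C * r y ^ k) has_derivative (\<lambda>v. ?C * (of_nat k * r' v * r x ^ (k - 1)))) (at x)"
    by (intro has_derivative_mult_right has_derivative_power r)
  have "((\<lambda>y. ?C * r y ^ k * \<psi> (support_fun K y * r y) (norm (support_point K y))) has_derivative
      (\<lambda>v. ?C * r x ^ k * (?s' v * ?d1 + ?t' v * ?d2)
        + ?C * (of_nat k * r' v * r x ^ (k - 1)) * \<psi> (?h * r x) (norm ?X))) (at x)"
    by (rule has_derivative_mult[OF rk \<psi>'])
  then have "((\<lambda>y. sigma_op k (support_hessian K y)) has_derivative
      (\<lambda>v. ?C * r x ^ k * (?s' v * ?d1 + ?t' v * ?d2)
        + ?C * (of_nat k * r' v * r x ^ (k - 1)) * \<psi> (?h * r x) (norm ?X))) (at x)"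
  proof (rule has_derivative_transform_within_open[where s = "- {0}"])
    fix y :: 'a assume "y \<in> - {0}"
    then show "?C * r y ^ k * \<psi> (support_fun K y * r y) (norm (support_point K y)) =
        sigma_op k (support_hessian K y)"
      using sigma_op_homogeneous_extension[OF sc k _ eq] by (simp add: r_def)
  qed (use x in auto)
  from fun_cong[OF has_derivative_unique[OF S' this], of w]
  have "S' w = ?C * r x ^ k * (?s' w * ?d1 + ?t' w * ?d2)" by (simp only: r'w mult_zero_left mult_zero_right add_0_left add_0_right)
  moreover have "?s' w > 0" using w(2) rx r'w by simp
  moreover have "?t' w > 0" using w(3) X0 by (simp add: sgn_div_norm)
  moreover have "?C > 0" using k by simp
  moreover have "0 < p * ?d1 + q * ?d2" if "0 < p" "0 < q" for p q
    using strict[OF st]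
  proof
    assume "0 < ?d1"
    then show ?thesis using that d2[OF st] by (intro add_pos_nonneg mult_pos_pos mult_nonneg_nonneg) auto
  next
    assume "0 < ?d2"
    then show ?thesis using that d1[OF st] by (intro add_nonneg_pos mult_pos_pos mult_nonneg_nonneg) auto
  qed
  ultimately show ?thesis using rx by (simp only: mult_pos_pos zero_less_power)
qed

lemma divergence_add:
  assumes "V differentiable (at x)" "W differentiable (at x)"
  shows "divergence (\<lambda>y. V y + W y) x = divergence V x + divergence W x"
proof -
  note d = assms[unfolded frechet_derivative_works]
  show ?thesis
    unfolding divergence_eq[OF has_derivative_add[OF d]] divergence_eq[OF d(1)] divergence_eq[OF d(2)]
    by (simp add: inner_add_left sum.distrib)
qed

lemma newton_field_differentiable:
  assumes "smooth_strictly_convex M K" "x \<noteq> 0"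
  shows "(newton_field k K has_derivative frechet_derivative (newton_field k K) (at x)) (at x)"
  using C1_on_has_derivative[OF C1_on_newton_field[OF assms(1)]] assms(2) by simp

lemma sigma_op_support_differentiable:
  assumes "smooth_strictly_convex M K" "x \<noteq> 0"
  shows "((\<lambda>y. sigma_op k (support_hessian K y)) has_derivative
    frechet_derivative (\<lambda>y. sigma_op k (support_hessian K y)) (at x)) (at x)"
  using C1_on_has_derivative[OF C1_on_sigma_op[OF C1_on_support_hessian[OF assms(1)]]] assms(2) by simp

text \<open>For \<open>k < n\<close> the field is \<open>\<sigma>\<^sub>k Z\<^sub>0 - n/(n - k) Z\<^sub>k\<close>, whose divergence is nonnegative by
  \<open>n (k + 1) \<sigma>\<^sub>k\<^sub>+\<^sub>1 \<le> (n - k) \<sigma>\<^sub>1 \<sigma>\<^sub>k\<close>. For \<open>k = n\<close> it is \<open>Z\<^sub>0 - \<sigma>\<^sub>n\<^bsup>-(n-1)/n\<^esup> Z\<^sub>n\<^sub>-\<^sub>1\<close>; the coefficients are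
  chosen such that the terms free of derivatives of \<open>\<sigma>\<^sub>n\<close> are controlled by the two inequalities
  \<open>\<sigma>\<^sub>1 \<ge> n \<sigma>\<^sub>n\<^bsup>1/n\<^esup>\<close> and \<open>\<sigma>\<^sub>n\<^sub>-\<^sub>1 \<ge> n \<sigma>\<^sub>n\<^bsup>(n-1)/n\<^esup>\<close>.\<close>

lemma tangential_point_eq_0:
  fixes K :: "'a::euclidean_space set" and \<psi> :: "real \<Rightarrow> real \<Rightarrow> real"
  assumes sc: "smooth_strictly_convex M K" and dim: "DIM('a) = n + 1" and n: "2 \<le> n"
    and k: "1 \<le> k" "k \<le> n" and z: "norm z = 1"
    and pos: "\<And>x w S'. \<lbrakk>x \<noteq> 0; ((\<lambda>y. sigma_op k (support_hessian K y)) has_derivative S') (at x);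
        x \<bullet> w = 0; 0 < support_point K x \<bullet> w; 0 < support_hessian K x w \<bullet> support_point K x\<rbrakk> \<Longrightarrow> 0 < S' w"
  shows "tangential_point K z = 0"
proof -
  let ?\<sigma> = "\<lambda>j x. sigma_op j (support_hessian K x)"
  let ?\<sigma>' = "\<lambda>j x. frechet_derivative (\<lambda>y. sigma_op j (support_hessian K y)) (at x)"
  let ?Z = "\<lambda>j. newton_field j K"
  have z0: "z \<noteq> 0" using z by auto
  have \<sigma>'Z: "0 \<le> ?\<sigma>' k x (?Z j x)" "tangential_point K x \<noteq> 0 \<Longrightarrow> 0 < ?\<sigma>' k x (?Z j x)"
    if x: "x \<noteq> 0" and j: "j < n" for x j
  proof -
    have d: "(?\<sigma> k has_derivative ?\<sigma>' k x) (at x)" by (rule sigma_op_support_differentiable[OF sc x])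
    show 1: "0 < ?\<sigma>' k x (?Z j x)" if "tangential_point K x \<noteq> 0"
      using newton_field_positive[OF sc x _ that, of j] j dim
      by (intro pos[OF x d newton_field_orthogonal[OF sc x]]) auto
    show "0 \<le> ?\<sigma>' k x (?Z j x)"
    proof (cases "tangential_point K x = 0")
      case True
      then show ?thesis
        using newton_field_eq_0[OF sc x True] linear_0[OF has_derivative_linear[OF d]] by simp
    qed (use 1 in \<open>simp add: less_imp_le\<close>)
  qed
  have eig: "\<exists>(E :: 'a set) \<mu>. finite E \<and> card E = n \<and> (\<forall>e\<in>E. 0 < \<mu> e) \<and> (\<forall>j. ?\<sigma> j x = esym j E \<mu>)"
    if x: "x \<noteq> 0" for x
  proof (rule support_hessian_eigenbasis[OF sc x])
    fix E :: "'a set" and \<mu> assume "finite E" "card E = DIM('a) - 1" "\<And>e. e \<in> E \<Longrightarrow> 0 < \<mu> e"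
      "\<And>j. ?\<sigma> j x = esym j E \<mu>"
    then show ?thesis using dim by (intro exI[of _ E] exI[of _ \<mu>]) simp
  qed
  have divZ: "divergence (?Z j) x = real (Suc j) * ?\<sigma> (Suc j) x
      - (real n - real j) * ?\<sigma> j x * support_fun K x * inverse (x \<bullet> x)" if "x \<noteq> 0" for x j
    using divergence_newton_field[OF sc that, of j] dim by simp
  have h0: "0 < support_fun K x * inverse (x \<bullet> x)" if "x \<noteq> 0" for x
    using support_fun_pos[OF sc that] that by simp
  show ?thesis
  proof (cases "k < n")
    case True
    \<comment> \<open>The divergence of \<open>?Z 0\<close> times sigma_k contains - n sigma_k
      h/|x|^2, that of \<open>?Z k\<close> contains - (n - k) sigma_k h/|x|^2; this factor makes the
      two cancel.\<close>
    define c where "c = - (real n / (real n - real k))"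
    have cn: "c * (real n - real k) = - real n" using True by (simp add: c_def)
    define V where "V x = ?\<sigma> k x *\<^sub>R ?Z 0 x + c *\<^sub>R ?Z k x" for x
    have div: "divergence V x = ?\<sigma>' k x (?Z 0 x)
        + (?\<sigma> (Suc 0) x * ?\<sigma> k x + c * (real (Suc k) * ?\<sigma> (Suc k) x))" if x: "x \<noteq> 0" for x
    proof -
      note dZ = newton_field_differentiable[OF sc x]
      have "divergence V x = divergence (\<lambda>x. ?\<sigma> k x *\<^sub>R ?Z 0 x) x + divergence (\<lambda>x. c *\<^sub>R ?Z k x) x"
        unfolding V_def
        by (rule divergence_add[OF
              differentiableI[OF has_derivative_scaleR[OF sigma_op_support_differentiable[OF sc x] dZ]]
              differentiableI[OF has_derivative_scaleR[OF has_derivative_const dZ]]])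
      also have "\<dots> = (?\<sigma>' k x (?Z 0 x) + ?\<sigma> k x * divergence (?Z 0) x) + c * divergence (?Z k) x"
        unfolding divergence_scaleR[OF sigma_op_support_differentiable[OF sc x] dZ]
          divergence_scaleR[OF has_derivative_const dZ] by simp
      also have "c * divergence (?Z k) x = c * (real (Suc k) * ?\<sigma> (Suc k) x)
          + real n * ?\<sigma> k x * support_fun K x * inverse (x \<bullet> x)"
      proof -
        have "c * (p - (real n - real k) * q * r * t) = c * p - (c * (real n - real k)) * q * r * t" for p q r t
          by (simp add: algebra_simps)
        then show ?thesis unfolding divZ[OF x] cn by simp
      qed
      finally show ?thesis unfolding divZ[OF x] by (simp add: algebra_simps)
    qed
    have newton: "0 \<le> ?\<sigma> (Suc 0) x * ?\<sigma> k x + c * (real (Suc k) * ?\<sigma> (Suc k) x)" if x: "x \<noteq> 0" for x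
    proof -
      obtain E :: "'a set" and \<mu> where E: "finite E" "card E = n" "\<forall>e\<in>E. 0 < \<mu> e" "\<forall>j. ?\<sigma> j x = esym j E \<mu>"
        using eig[OF x] by blast
      have "real n * (real (Suc k) * ?\<sigma> (Suc k) x) \<le> (real n - real k) * (?\<sigma> (Suc 0) x * ?\<sigma> k x)"
        using esym_Suc_le[OF E(1), of \<mu> k] E by (auto simp: less_imp_le)
      moreover have "(real n - real k) * (p + c * q) = (real n - real k) * p + (c * (real n - real k)) * q" for p q
        by (simp add: algebra_simps)
      ultimately have "0 \<le> (real n - real k) * (?\<sigma> (Suc 0) x * ?\<sigma> k x + c * (real (Suc k) * ?\<sigma> (Suc k) x))"
        unfolding cn by simp
      then show ?thesis using True by (simp add: zero_le_mult_iff)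
    qed
    have "divergence V z = 0"
    proof (rule tangential_field_divergence_eq_0[OF _ _ _ z])
      show "C1_on (- {0}) V"
        unfolding V_def by (intro C1_on_add C1_on_scaleR C1_on_const C1_on_sigma_op
            C1_on_support_hessian[OF sc] C1_on_newton_field[OF sc])
      show "x \<bullet> V x = 0" if "x \<noteq> 0" for x
        using newton_field_orthogonal[OF sc that] by (simp add: V_def inner_add_right inner_diff_right)
      show "0 \<le> divergence V x" if "x \<noteq> 0" for x
        using div[OF that] newton[OF that] \<sigma>'Z(1)[OF that, of 0] n by simp
    qed
    \<comment> \<open>Two nonnegative summands with sum 0: the first one, which is positive wherever
      the tangential part is nonzero, must vanish.\<close>
    then have "?\<sigma>' k z (?Z 0 z) \<le> 0"
      unfolding div[OF z0] using newton[OF z0] by linarith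
    then show ?thesis
      using \<sigma>'Z(2)[OF z0, of 0] n by linarith
  next
    case False
    then have kn: "k = n" using k by simp
    \<comment> \<open>With y = sigma_n^(1/n) this gives sigma_n^a = y^(-(n-1)), so that sigma_n^a n
      sigma_n = n y is comparable with sigma_1, and sigma_n^a sigma_(n-1) with n. As a < 0, the
      coefficient - sigma_n^a increases with sigma_n, which gives the derivative term its
      sign.\<close>
    define a where "a = - ((real n - 1) / real n)"
    define V where "V x = ?Z 0 x + (- (?\<sigma> n x powr a)) *\<^sub>R ?Z (n - 1) x" for x
    have \<sigma>pos: "0 < ?\<sigma> n x" if x: "x \<noteq> 0" for x
    proof -
      obtain E :: "'a set" and \<mu> where "finite E" "card E = n" "\<forall>e\<in>E. 0 < \<mu> e" "\<forall>j. ?\<sigma> j x = esym j E \<mu>"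
        using eig[OF x] by blast
      then show ?thesis using esym_pos[of E \<mu> n] by simp
    qed
    have c': "((\<lambda>y. - (?\<sigma> n y powr a)) has_derivative
        (\<lambda>v. - (?\<sigma>' n x v * (a * ?\<sigma> n x powr (a - 1))))) (at x)" if x: "x \<noteq> 0" for x
    proof -
      have "((\<lambda>s. s powr a) has_derivative (\<lambda>h. h * (a * ?\<sigma> n x powr (a - 1)))) (at (?\<sigma> n x))"
        using has_real_derivative_powr[OF \<sigma>pos[OF x], of a]
        by (simp add: has_field_derivative_def mult_commute_abs)
      from has_derivative_compose[where g = "\<lambda>s. s powr a", OF sigma_op_support_differentiable[OF sc x] this]
      show ?thesis by (rule has_derivative_minus)
    qed
    have C1c: "C1_on (- {0}) (\<lambda>y. - (?\<sigma> n y powr a))"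
    proof (intro C1_on_minus C1_on_real_compose[where g = "\<lambda>s. s powr a" and T = "{0<..}"])
      show "C1_on (- {0}) (?\<sigma> n)" by (intro C1_on_sigma_op C1_on_support_hessian[OF sc])
      show "((\<lambda>s. s powr a) has_real_derivative a * t powr (a - 1)) (at t)" if "t \<in> {0<..}" for t
        using that by (intro has_real_derivative_powr) simp
      show "continuous_on {0<..} (\<lambda>t. a * t powr (a - 1))" by (intro continuous_intros) auto
    qed (use \<sigma>pos in auto)
    have div: "divergence V x = (- a) * ?\<sigma> n x powr (a - 1) * ?\<sigma>' n x (?Z (n - 1) x)
        + ((?\<sigma> (Suc 0) x - ?\<sigma> n x powr a * (real n * ?\<sigma> n x))
        + (?\<sigma> n x powr a * ?\<sigma> (n - 1) x - real n) * (support_fun K x * inverse (x \<bullet> x)))"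
      if x: "x \<noteq> 0" for x
    proof -
      note dZ = newton_field_differentiable[OF sc x]
      have "divergence V x = divergence (?Z 0) x + divergence (\<lambda>x. (- (?\<sigma> n x powr a)) *\<^sub>R ?Z (n - 1) x) x"
        unfolding V_def
        by (rule divergence_add[OF differentiableI[OF dZ] differentiableI[OF has_derivative_scaleR[OF c'[OF x] dZ]]])
      also have "\<dots> = divergence (?Z 0) x + (- (?\<sigma>' n x (?Z (n - 1) x) * (a * ?\<sigma> n x powr (a - 1)))
          + (- (?\<sigma> n x powr a)) * divergence (?Z (n - 1)) x)"
        unfolding divergence_scaleR[OF c'[OF x] dZ] ..
      finally show ?thesis
        using n unfolding divZ[OF x] by (simp add: of_nat_diff algebra_simps)
    qed
    have amgm: "0 \<le> ?\<sigma> (Suc 0) x - ?\<sigma> n x powr a * (real n * ?\<sigma> n x)"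
      "0 \<le> ?\<sigma> n x powr a * ?\<sigma> (n - 1) x - real n" if x: "x \<noteq> 0" for x
    proof -
      obtain E :: "'a set" and \<mu> where E: "finite E" "card E = n" "\<forall>e\<in>E. 0 < \<mu> e" "\<forall>j. ?\<sigma> j x = esym j E \<mu>"
        using eig[OF x] by blast
      define y where "y = ?\<sigma> n x powr (1 / real n)"
      have y: "0 < y" using \<sigma>pos[OF x] by (simp add: y_def)
      have yn: "y ^ n = ?\<sigma> n x"
        using \<sigma>pos[OF x] n by (simp add: y_def powr_powr flip: powr_realpow)
      have ya: "?\<sigma> n x powr a * y ^ (n - 1) = 1"
      proof -
        have "y ^ (n - 1) = ?\<sigma> n x powr ((real n - 1) / real n)"
          using \<sigma>pos[OF x] n by (simp add: y_def powr_powr of_nat_diff flip: powr_realpow)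
        then show ?thesis using \<sigma>pos[OF x] by (simp add: a_def flip: powr_add)
      qed
      have yy: "y ^ n = y ^ (n - 1) * y" using n by (cases n) auto
      have "?\<sigma> n x powr a * (real n * ?\<sigma> n x) = real n * y * (?\<sigma> n x powr a * y ^ (n - 1))"
        unfolding yn[symmetric, unfolded yy] by (simp add: mult_ac)
      also have "\<dots> = real n * y" unfolding ya by simp
      also have "\<dots> \<le> ?\<sigma> (Suc 0) x"
        using arith_geo_mean[OF E(1), of \<mu> y] E y yn esym_card[OF E(1), of \<mu>] esym_1[OF E(1), of \<mu>] by auto
      finally show "0 \<le> ?\<sigma> (Suc 0) x - ?\<sigma> n x powr a * (real n * ?\<sigma> n x)" by simp
      have "real n * y ^ (n - 1) \<le> ?\<sigma> (n - 1) x"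
        using esym_arith_geo_mean[OF E(1), of \<mu> y] E y yn by auto
      then have "?\<sigma> n x powr a * (real n * y ^ (n - 1)) \<le> ?\<sigma> n x powr a * ?\<sigma> (n - 1) x"
        by (intro mult_left_mono) auto
      then show "0 \<le> ?\<sigma> n x powr a * ?\<sigma> (n - 1) x - real n"
        using ya by (simp add: mult.left_commute)
    qed
    have a: "- a > 0" using n by (simp add: a_def)
    have rest: "0 \<le> (?\<sigma> (Suc 0) x - ?\<sigma> n x powr a * (real n * ?\<sigma> n x))
        + (?\<sigma> n x powr a * ?\<sigma> (n - 1) x - real n) * (support_fun K x * inverse (x \<bullet> x))"
      if x: "x \<noteq> 0" for x
      by (rule add_nonneg_nonneg[OF amgm(1)[OF x] mult_nonneg_nonneg[OF amgm(2)[OF x] less_imp_le[OF h0[OF x]]]])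
    have "divergence V z = 0"
    proof (rule tangential_field_divergence_eq_0[OF _ _ _ z])
      show "C1_on (- {0}) V"
        unfolding V_def by (intro C1_on_add C1_on_scaleR C1c C1_on_newton_field[OF sc])
      show "x \<bullet> V x = 0" if "x \<noteq> 0" for x
        using newton_field_orthogonal[OF sc that] by (simp add: V_def inner_add_right inner_diff_right)
      show "0 \<le> divergence V x" if x: "x \<noteq> 0" for x
        unfolding div[OF x]
        using \<sigma>'Z(1)[OF x, of "n - 1"] n a kn
        by (intro add_nonneg_nonneg[OF mult_nonneg_nonneg[OF mult_nonneg_nonneg] rest[OF x]]) auto
    qed
    moreover have "0 < (- a) * ?\<sigma> n z powr (a - 1) * ?\<sigma>' n z (?Z (n - 1) z)" if "tangential_point K z \<noteq> 0"
      using \<sigma>'Z(2)[OF z0 _ that, of "n - 1"] n a kn \<sigma>pos[OF z0] by (intro mult_pos_pos) auto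
    ultimately show ?thesis
      unfolding div[OF z0] using rest[OF z0] by linarith
  qed
qed

theorem corollary1p3:
  fixes n k :: nat
    and \<psi> :: "real \<Rightarrow> real \<Rightarrow> real"
    and M K :: "'a::euclidean_space set"
  assumes dim: "DIM('a) = n + 1"
    and n: "2 \<le> n"
    and k: "1 \<le> k" "k \<le> n"
    and psi_pos: "\<And>s t. 0 < s \<Longrightarrow> 0 < t \<Longrightarrow> 0 < \<psi> s t"
    and psi_C1: "Ck_on 1 ({0<..} \<times> {0<..}) (\<lambda>(s, t). \<psi> s t)"
    and psi_d1: "\<And>s t. 0 < s \<Longrightarrow> 0 < t \<Longrightarrow> 0 \<le> deriv (\<lambda>x. \<psi> x t) s"
    and psi_d2: "\<And>s t. 0 < s \<Longrightarrow> 0 < t \<Longrightarrow> 0 \<le> deriv (\<lambda>y. \<psi> s y) t"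
    and psi_strict: "\<And>s t. 0 < s \<Longrightarrow> 0 < t \<Longrightarrow>
          0 < deriv (\<lambda>x. \<psi> x t) s \<or> 0 < deriv (\<lambda>y. \<psi> s y) t"
    and M: "smooth_strictly_convex M K"
    and eq: "\<And>z. z \<in> unit_sphere \<Longrightarrow> P_W k K z = \<psi> (support_fun K z) (radial_fun K z)"
  shows "\<exists>R>0. M = sphere 0 R"
proof -
  let ?X = "support_point K"
  have tan: "tangential_point K z = 0" if "norm z = 1" for z
  proof (rule tangential_point_eq_0[OF M dim n k that])
    fix x w S'
    assume x: "x \<noteq> 0" and S': "((\<lambda>y. sigma_op k (support_hessian K y)) has_derivative S') (at x)"
      and w: "x \<bullet> w = 0" "0 < ?X x \<bullet> w" "0 < support_hessian K x w \<bullet> ?X x"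
    have k': "k \<le> DIM('a) - 1" using k dim by simp
    show "0 < S' w"
      by (rule sigma_op_derivative_pos[OF M k' x psi_C1 psi_d1 psi_d2 psi_strict eq S' w])
  qed
  have Xz: "?X z = support_fun K z *\<^sub>R z" if "norm z = 1" for z
    using tan[OF that] that by (simp add: tangential_point_def norm_eq_1)
  \<comment> \<open>\<open>?X x\<close> is now a multiple of \<open>x\<close>, so the derivative 2 X
    \<bullet> H v is a multiple of x \<bullet> H v = H x \<bullet> v = 0. Thus |X| is constant, and
    its value is the radius.\<close>
  have "((\<lambda>x. ?X x \<bullet> ?X x) has_derivative (\<lambda>v. 0)) (at x within - {0})" if x: "x \<in> - {0}" for x
  proof -
    have x0: "x \<noteq> 0" using x by simp
    define z where "z = (1 / norm x) *\<^sub>R x"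
    have "?X x = ?X z" using support_point_scaleR[OF M x0, of "1 / norm x"] x0 by (simp add: z_def)
    also have "\<dots> = (support_fun K z / norm x) *\<^sub>R x" using Xz[of z] x0 by (simp add: z_def)
    finally have "?X x \<bullet> support_hessian K x v = 0" for v
      using support_hessian_symmetric[OF M x0, of x v] support_hessian_radial[OF M x0] by simp
    then have "(\<lambda>v. ?X x \<bullet> support_hessian K x v + support_hessian K x v \<bullet> ?X x) = (\<lambda>v. 0)"
      by (simp add: inner_commute)
    with has_derivative_inner[OF support_point_has_derivative[OF M x0] support_point_has_derivative[OF M x0]]
    show ?thesis by (metis has_derivative_at_withinI)
  qed
  moreover have "connected (- {0::'a})" using dim n by (intro connected_punctured_universe) simp
  ultimately have "(\<lambda>x. ?X x \<bullet> ?X x) constant_on (- {0})"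
    by (intro has_derivative_zero_connected_constant_on[where K = "{}"])
       (auto intro!: continuous_on_inner C1_on_imp_continuous_on[OF C1_on_support_point[OF M]])
  then obtain c where c: "\<And>x. x \<noteq> 0 \<Longrightarrow> ?X x \<bullet> ?X x = c" by (auto simp: constant_on_def)
  define R where "R = sqrt c"
  have R: "norm (?X x) = R" if "x \<noteq> 0" for x using c[OF that] by (simp add: R_def norm_eq_sqrt_inner)
  obtain e :: 'a where "e \<in> Basis" using nonempty_Basis by blast
  then have "e \<noteq> 0" by auto
  then have Rpos: "R > 0" using R support_point_nonzero[OF M] by (metis zero_less_norm_iff)
  have "M = sphere 0 R"
  proof (intro equalityI subsetI)
    fix p assume "p \<in> M"
    then obtain z where z: "norm z = 1" "?X z = p" using support_point_surj[OF M] by blast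
    then have "z \<noteq> 0" by auto
    then show "p \<in> sphere 0 R" using R[of z] z(2) by simp
  next
    fix p :: 'a assume p: "p \<in> sphere 0 R"
    define z where "z = (1 / R) *\<^sub>R p"
    have z: "norm z = 1" using p Rpos by (simp add: z_def)
    have z0: "z \<noteq> 0" using z by auto
    have "support_fun K z = R" using R[OF z0] Xz[OF z] z support_fun_pos[OF M z0] by simp
    then have "?X z = p" using Xz[OF z] Rpos by (simp add: z_def)
    then show "p \<in> M" using support_point_in[OF M z0] by simp
  qed
  then show ?thesis using Rpos by blast
qed

end
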